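(* Let $G$ be a finite group and $R$ a commutative noetherian ring. For each prime number $p$, the natural map $$H^*(G,R)\otimes_RR/pR\longrightarrow H^*(G,R/pR)$$ is an F-isomorphism.
   Context: $H^*(G,-)$ denotes group cohomology with coefficients in modules with trivial $G$-action; for a commutative ring $R$, $H^*(G,R)$ is a graded-commutative $R$-algebra under cup product. A map of rings $f\colon S\to T$ containing a field of positive characteristic $p$ is an F-isomorphism if $\ker(f)$ is nilpotent and for each $t\in T$ there exists an integer $n$ such that $t^{p^n}$ is in the image of $f$. *)

theory Defs
  imports "HOL-Computational_Algebra.Primes" "HOL-Library.Poly_Mapping" "HOL-Algebra.Algebra"
begin

section \<open>Group cohomology with trivial coefficients\<close>

text \<open>
  The inhomogeneous (bar) cochain algebra of a group \<open>G\<close> with coefficients in a ring \<open>A\<close> on which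
  \<open>G\<close> acts trivially. A cochain is an element of the direct sum over all \<open>n\<close> of the maps from
  \<open>G\<^sup>n\<close> to \<open>A\<close>. It is represented by a single function on lists, whose degree \<open>n\<close> component is the
  restriction to lists of length \<open>n\<close>. The length bound expresses that only finitely many
  components are nonzero, and functions are normalised to zero outside \<open>lists (carrier G)\<close>.
\<close>

definition cochains :: "('g, 'm) monoid_scheme \<Rightarrow> ('a, 'k) ring_scheme \<Rightarrow> ('g list \<Rightarrow> 'a) set" where
  "cochains G A =
     {c. (\<forall>l. c l \<in> carrier A) \<and>
         (\<forall>l. l \<notin> lists (carrier G) \<longrightarrow> c l = \<zero>\<^bsub>A\<^esub>) \<and>
         (\<exists>N. \<forall>l. N < length l \<longrightarrow> c l = \<zero>\<^bsub>A\<^esub>)}"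

text \<open>
  The multiplication is the cup product
  \<open>(a \<union> b)(g\<^sub>1,\<dots>,g\<^sub>m\<^sub>+\<^sub>n) = a(g\<^sub>1,\<dots>,g\<^sub>m) b(g\<^sub>m\<^sub>+\<^sub>1,\<dots>,g\<^sub>m\<^sub>+\<^sub>n)\<close> for \<open>a\<close> of degree \<open>m\<close> and
  \<open>b\<close> of degree \<open>n\<close>, extended biadditively to sums of homogeneous cochains.
\<close>

definition cochain_ring ::
    "('g, 'm) monoid_scheme \<Rightarrow> ('a, 'k) ring_scheme \<Rightarrow> ('g list \<Rightarrow> 'a) ring" where
  "cochain_ring G A =
     \<lparr>carrier = cochains G A,
      monoid.mult = (\<lambda>a b l. \<Oplus>\<^bsub>A\<^esub>i\<in>{..length l}. a (take i l) \<otimes>\<^bsub>A\<^esub> b (drop i l)),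
      one = (\<lambda>l. if l = [] then \<one>\<^bsub>A\<^esub> else \<zero>\<^bsub>A\<^esub>),
      ring.zero = (\<lambda>l. \<zero>\<^bsub>A\<^esub>),
      add = (\<lambda>a b l. a l \<oplus>\<^bsub>A\<^esub> b l)\<rparr>"

text \<open>
  In degree \<open>n\<close> this is
  \<open>(d c)(g\<^sub>1,\<dots>,g\<^sub>n\<^sub>+\<^sub>1) = c(g\<^sub>2,\<dots>,g\<^sub>n\<^sub>+\<^sub>1) + (\<Sum>i=1..n. (-1)\<^sup>i c(g\<^sub>1,\<dots>,g\<^sub>i g\<^sub>i\<^sub>+\<^sub>1,\<dots>,g\<^sub>n\<^sub>+\<^sub>1)) + (-1)\<^sup>n\<^sup>+\<^sup>1 c(g\<^sub>1,\<dots>,g\<^sub>n)\<close>.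
  List positions are counted from 0, so the index of the sum is shifted by one.
\<close>

definition coboundary ::
    "('g, 'm) monoid_scheme \<Rightarrow> ('a, 'k) ring_scheme \<Rightarrow> ('g list \<Rightarrow> 'a) \<Rightarrow> 'g list \<Rightarrow> 'a" where
  "coboundary G A c l =
     (if l \<in> lists (carrier G) \<and> l \<noteq> []
      then c (tl l)
        \<oplus>\<^bsub>A\<^esub> (\<Oplus>\<^bsub>A\<^esub>i\<in>{..<length l - 1}.
                add_pow A ((- 1 :: int) ^ (i + 1))
                  (c (take i l @ (l ! i \<otimes>\<^bsub>G\<^esub> l ! (i + 1)) # drop (i + 2) l)))
        \<oplus>\<^bsub>A\<^esub> add_pow A ((- 1 :: int) ^ length l) (c (butlast l))
      else \<zero>\<^bsub>A\<^esub>)"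

definition cocycles :: "('g, 'm) monoid_scheme \<Rightarrow> ('a, 'k) ring_scheme \<Rightarrow> ('g list \<Rightarrow> 'a) set" where
  "cocycles G A = {c \<in> cochains G A. coboundary G A c = (\<lambda>l. \<zero>\<^bsub>A\<^esub>)}"

definition coboundaries :: "('g, 'm) monoid_scheme \<Rightarrow> ('a, 'k) ring_scheme \<Rightarrow> ('g list \<Rightarrow> 'a) set" where
  "coboundaries G A = coboundary G A ` cochains G A"

abbreviation cocycle_ring ::
    "('g, 'm) monoid_scheme \<Rightarrow> ('a, 'k) ring_scheme \<Rightarrow> ('g list \<Rightarrow> 'a) ring" where
  "cocycle_ring G A \<equiv> (cochain_ring G A)\<lparr>carrier := cocycles G A\<rparr>"

text \<open>
  The ring \<open>H\<^sup>*(G,A)\<close>: since the differential is homogeneous, cocycles modulo coboundaries on the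
  direct sum of all cochain groups is the direct sum of the groups \<open>H\<^sup>n(G,A)\<close>.
\<close>

definition cohomology_ring ::
    "('g, 'm) monoid_scheme \<Rightarrow> ('a, 'k) ring_scheme \<Rightarrow> ('g list \<Rightarrow> 'a) set ring" where
  "cohomology_ring G A = cocycle_ring G A Quot coboundaries G A"

definition cohomology_class ::
    "('g, 'm) monoid_scheme \<Rightarrow> ('a, 'k) ring_scheme \<Rightarrow> ('g list \<Rightarrow> 'a) \<Rightarrow> ('g list \<Rightarrow> 'a) set" where
  "cohomology_class G A c = coboundaries G A +>\<^bsub>cocycle_ring G A\<^esub> c"

text \<open>
  The structure map of the \<open>A\<close>-algebra \<open>H\<^sup>*(G,A)\<close>, identifying \<open>A\<close> with \<open>H\<^sup>0(G,A)\<close>. Cup product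
  with the image of \<open>r\<close> is scalar multiplication by \<open>r\<close> on cochains.
\<close>

definition cohomology_unit ::
    "('g, 'm) monoid_scheme \<Rightarrow> ('a, 'k) ring_scheme \<Rightarrow> 'a \<Rightarrow> ('g list \<Rightarrow> 'a) set" where
  "cohomology_unit G A r = cohomology_class G A (\<lambda>l. if l = [] then r else \<zero>\<^bsub>A\<^esub>)"

text \<open>The map \<open>H\<^sup>*(G,A) \<rightarrow> H\<^sup>*(G,B)\<close> induced by a ring homomorphism \<open>f : A \<rightarrow> B\<close>.\<close>

definition cohomology_map ::
    "('g, 'm) monoid_scheme \<Rightarrow> ('b, 'k) ring_scheme \<Rightarrow> ('a \<Rightarrow> 'b) \<Rightarrow>
       ('g list \<Rightarrow> 'a) set \<Rightarrow> ('g list \<Rightarrow> 'b) set" where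
  "cohomology_map G B f Y = the_elem ((\<lambda>c. cohomology_class G B (\<lambda>l. f (c l))) ` Y)"


section \<open>Tensor products of algebras\<close>

definition monoid_ring :: "('a, 'm) monoid_scheme \<Rightarrow> ('a \<Rightarrow>\<^sub>0 int) ring" where
  "monoid_ring M =
     \<lparr>carrier = {c. Poly_Mapping.keys c \<subseteq> carrier M},
      monoid.mult = (\<lambda>c d. frag_extend (\<lambda>x. frag_extend (\<lambda>y. frag_of (x \<otimes>\<^bsub>M\<^esub> y)) d) c),
      one = frag_of \<one>\<^bsub>M\<^esub>,
      ring.zero = 0,
      add = (+)\<rparr>"

text \<open>
  For a commutative ring \<open>R\<close> and \<open>R\<close>-algebras \<open>A\<close>, \<open>B\<close> (not necessarily commutative) with
  structure maps \<open>\<phi> : R \<rightarrow> A\<close>, \<open>\<psi> : R \<rightarrow> B\<close> landing in the centres, the tensor product over \<open>R\<close>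
  is the free abelian group on \<open>A \<times> B\<close> modulo the additive subgroup generated by the relations
  below. That subgroup is a two-sided ideal of the monoid ring of the multiplicative monoid
  \<open>A \<times> B\<close>, so the quotient carries the product \<open>(a \<otimes> b)(a' \<otimes> b') = aa' \<otimes> bb'\<close>.
\<close>

definition tensor_relations ::
    "('r, 'k) ring_scheme \<Rightarrow> ('a, 'm) ring_scheme \<Rightarrow> ('b, 'n) ring_scheme \<Rightarrow>
       ('r \<Rightarrow> 'a) \<Rightarrow> ('r \<Rightarrow> 'b) \<Rightarrow> (('a \<times> 'b) \<Rightarrow>\<^sub>0 int) set" where
  "tensor_relations R A B \<phi> \<psi> =
     {frag_of (a \<oplus>\<^bsub>A\<^esub> a', b) - frag_of (a, b) - frag_of (a', b) | a a' b.
        a \<in> carrier A \<and> a' \<in> carrier A \<and> b \<in> carrier B} \<union>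
     {frag_of (a, b \<oplus>\<^bsub>B\<^esub> b') - frag_of (a, b) - frag_of (a, b') | a b b'.
        a \<in> carrier A \<and> b \<in> carrier B \<and> b' \<in> carrier B} \<union>
     {frag_of (\<phi> r \<otimes>\<^bsub>A\<^esub> a, b) - frag_of (a, \<psi> r \<otimes>\<^bsub>B\<^esub> b) | r a b.
        r \<in> carrier R \<and> a \<in> carrier A \<and> b \<in> carrier B}"

definition tensor_algebra ::
    "('r, 'k) ring_scheme \<Rightarrow> ('a, 'm) ring_scheme \<Rightarrow> ('b, 'n) ring_scheme \<Rightarrow>
       ('r \<Rightarrow> 'a) \<Rightarrow> ('r \<Rightarrow> 'b) \<Rightarrow> (('a \<times> 'b) \<Rightarrow>\<^sub>0 int) set ring" where
  "tensor_algebra R A B \<phi> \<psi> =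
     monoid_ring (A \<times>\<times> B) Quot
       generate (add_monoid (monoid_ring (A \<times>\<times> B))) (tensor_relations R A B \<phi> \<psi>)"

text \<open>
  The map out of the tensor product sending the class of the pure tensor of \<open>a\<close> and \<open>b\<close> to
  \<open>f a \<otimes>\<^bsub>C\<^esub> g b\<close>; the argument \<open>Y\<close> is a coset of formal \<open>\<int>\<close>-linear combinations of pairs.
\<close>

definition tensor_lift ::
    "('c, 'k) ring_scheme \<Rightarrow> ('a \<Rightarrow> 'c) \<Rightarrow> ('b \<Rightarrow> 'c) \<Rightarrow> (('a \<times> 'b) \<Rightarrow>\<^sub>0 int) set \<Rightarrow> 'c" where
  "tensor_lift C f g Y =
     the_elem ((\<lambda>c. \<Oplus>\<^bsub>C\<^esub>z\<in>Poly_Mapping.keys c.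
                  add_pow C (Poly_Mapping.lookup c z) (f (fst z) \<otimes>\<^bsub>C\<^esub> g (snd z))) ` Y)"


section \<open>F-isomorphisms\<close>

text \<open>
  That \<open>S\<close> and \<open>T\<close> contain a field of characteristic \<open>p\<close> is expressed by \<open>p \<cdot> 1 = 0\<close>, which
  also admits the zero ring.
\<close>

definition F_isomorphism ::
    "nat \<Rightarrow> ('s, 'm) ring_scheme \<Rightarrow> ('t, 'n) ring_scheme \<Rightarrow> ('s \<Rightarrow> 't) \<Rightarrow> bool" where
  "F_isomorphism p S T f \<longleftrightarrow>
     Factorial_Ring.prime p \<and> ring_hom_ring S T f \<and>
     add_pow S p \<one>\<^bsub>S\<^esub> = \<zero>\<^bsub>S\<^esub> \<and> add_pow T p \<one>\<^bsub>T\<^esub> = \<zero>\<^bsub>T\<^esub> \<and>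
     (\<exists>N :: nat. a_kernel S T f [^]\<^bsub>ideals_set S\<^esub> N = \<zero>\<^bsub>ideals_set S\<^esub>) \<and>
     (\<forall>t\<in>carrier T. \<exists>n :: nat. t [^]\<^bsub>T\<^esub> (p ^ n) \<in> f ` carrier S)"


section \<open>Reduction modulo a prime\<close>

definition multiples :: "nat \<Rightarrow> ('r, 'k) ring_scheme \<Rightarrow> 'r set" where
  "multiples p R = {add_pow R p r | r. r \<in> carrier R}"

abbreviation reduction :: "nat \<Rightarrow> ('r, 'k) ring_scheme \<Rightarrow> 'r set ring" where
  "reduction p R \<equiv> R Quot multiples p R"

abbreviation reduction_map :: "nat \<Rightarrow> ('r, 'k) ring_scheme \<Rightarrow> 'r \<Rightarrow> 'r set" where
  "reduction_map p R \<equiv> (\<lambda>r. multiples p R +>\<^bsub>R\<^esub> r)"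

text \<open>\<open>H\<^sup>*(G,R) \<otimes>\<^sub>R R/pR\<close> and its natural map to \<open>H\<^sup>*(G,R/pR)\<close>, \<open>x \<otimes> s \<mapsto> s \<cdot> \<pi>\<^sub>*(x)\<close>.\<close>

definition cohomology_mod ::
    "nat \<Rightarrow> ('g, 'm) monoid_scheme \<Rightarrow> ('r, 'k) ring_scheme \<Rightarrow>
       ((('g list \<Rightarrow> 'r) set \<times> 'r set) \<Rightarrow>\<^sub>0 int) set ring" where
  "cohomology_mod p G R =
     tensor_algebra R (cohomology_ring G R) (reduction p R)
       (cohomology_unit G R) (reduction_map p R)"

definition natural_map ::
    "nat \<Rightarrow> ('g, 'm) monoid_scheme \<Rightarrow> ('r, 'k) ring_scheme \<Rightarrow>
       ((('g list \<Rightarrow> 'r) set \<times> 'r set) \<Rightarrow>\<^sub>0 int) set \<Rightarrow> ('g list \<Rightarrow> 'r set) set" where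
  "natural_map p G R =
     tensor_lift (cohomology_ring G (reduction p R))
       (cohomology_map G (reduction p R) (reduction_map p R))
       (cohomology_unit G (reduction p R))"

end

theory Submission
  imports Defs
begin

text \<open>
  Let \<open>C(A)\<close> be the differential graded ring of cochains of \<open>G\<close> with values in \<open>A\<close>, with differential
  \<open>\<delta>\<close>, and let \<open>\<pi>\<close> be reduction modulo \<open>p\<close>. A cochain over \<open>R/pR\<close> lifts to \<open>C(R)\<close>, and \<open>\<pi>\<close> kills exactly
  the multiples of \<open>p\<close>. So everything can be said about cochains over \<open>R\<close> and their divisibility by \<open>p\<close>.

  The kernel. Since \<open>R \<rightarrow> R/pR\<close> is onto, every element of \<open>H\<^sup>*(G,R) \<otimes> R/pR\<close> is of the form \<open>x \<otimes> 1\<close>, and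
  its image is \<open>\<pi>\<^sub>*(x)\<close>. If the image is zero, then \<open>x\<close> is the class of a cocycle \<open>p a\<close>, where \<open>a\<close> need not
  be a cocycle. For two such classes \<open>a \<union> p b\<close> is a cocycle, because its coboundary is
  \<open>\<delta> (p a) \<union> b \<plusminus> a \<union> \<delta> (p b) = 0\<close>. Hence \<open>(p a) \<union> (p b)\<close> is \<open>p\<close> times a cocycle, which is zero in the
  tensor product: the kernel has square zero (\<open>kernel_product\<close>).

  Powers. The cup-one product gives the graded commutativity of \<open>H\<^sup>*\<close>; it is needed only in the form
  \<open>\<delta> (c \<union>\<^sub>1 u) = \<delta> c \<union>\<^sub>1 u - u \<union> c \<plusminus> c \<union> u\<close> for cocycles \<open>u\<close> of odd degree (\<open>d_cup_one\<close>). Over \<open>R/pR\<close> it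
  shows that a \<open>p\<close>-th power is represented by a cocycle in even degrees (\<open>pth_power_even\<close>): even and odd
  classes commute, and twice the square of an odd class vanishes. An even cocycle over \<open>R/pR\<close> lifts to
  an even cochain \<open>c\<close> with \<open>\<delta> c = p e\<close>. If \<open>\<delta> c = q e\<close> for a power \<open>q\<close> of \<open>p\<close>, then
  \<open>\<delta> (c\<^sup>p) = \<Sum> c\<^sup>i (\<delta> c) c\<^sup>p\<^sup>-\<^sup>1\<^sup>-\<^sup>i\<close> would be \<open>p c\<^sup>p\<^sup>-\<^sup>1 \<delta> c\<close> if \<open>c\<close> and \<open>\<delta> c\<close> commuted. They commute up to the
  coboundary of \<open>c \<union>\<^sub>1 \<delta> c\<close>, a multiple of \<open>q\<close>, and up to \<open>\<delta> c \<union>\<^sub>1 \<delta> c\<close>, a multiple of \<open>q\<^sup>2\<close>. So a change of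
  \<open>c\<^sup>p\<close> by a multiple of \<open>q\<close> makes its coboundary divisible by \<open>q p\<close> (\<open>lift_step\<close>).

  Iterating this, some power of \<open>c\<close> is congruent modulo \<open>p\<close> to a cochain \<open>c'\<close> whose coboundary is divisible
  by an arbitrarily high power \<open>p\<^sup>n\<close>, say \<open>\<delta> c' = p\<^sup>n e\<close>. As \<open>R\<close> is noetherian, a fixed power \<open>p\<^sup>k\<close> kills all
  \<open>p\<close>-power torsion of \<open>R\<close> (\<open>bounded_torsion\<close>), so \<open>p\<^sup>k e\<close> is a cocycle. It is of positive degree, so the order
  of \<open>G\<close> times it is a coboundary \<open>\<delta> f\<close>. Writing that order as \<open>p\<^sup>v m\<close> with \<open>m\<close> prime to \<open>p\<close> and taking
  \<open>n = k + v + 1\<close> gives \<open>m \<delta> c' = p \<delta> f\<close>. Thus \<open>m c' - p f\<close> is a cocycle, and dividing by \<open>m\<close> modulo \<open>p\<close>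
  produces a cocycle that reduces to a power of the given class (\<open>power_lifts_to_cocycle\<close>).
\<close>

section \<open>Preliminaries on rings\<close>

lemma (in abelian_group) add_pow_neg:
  "x \<in> carrier G \<Longrightarrow> add_pow G (n :: nat) (\<ominus> x) = \<ominus> add_pow G n x"
  by (induction n) (simp_all add: minus_add, simp add: a_inv_def)

context abelian_group
begin

lemma add_minus_cancel_left: "x \<in> carrier G \<Longrightarrow> y \<in> carrier G \<Longrightarrow> x \<oplus> (y \<oplus> \<ominus> x) = y"
  by (simp add: a_lcomm[of x y] r_neg)

lemma add_minus_eqI:
  assumes "x = y \<oplus> (\<ominus> a \<oplus> b)" "y \<in> carrier G" "a \<in> carrier G" "b \<in> carrier G"
  shows "a \<oplus> \<ominus> b = y \<oplus> \<ominus> x"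
  using assms by (simp add: minus_add r_neg2)

end

lemma (in ring) commuting_pow_add_square_zero:
  assumes "x \<in> carrier R" "y \<in> carrier R" "x \<otimes> y = y \<otimes> x" "y \<otimes> y = \<zero>"
  shows "(x \<oplus> y) [^] Suc n = x [^] Suc n \<oplus> add_pow R (Suc n) (x [^] n \<otimes> y)"
proof (induction n)
  case (Suc n)
  have xy: "x [^] n \<otimes> y \<otimes> x = x [^] Suc n \<otimes> y" "x [^] n \<otimes> y \<otimes> y = \<zero>"
    using assms by (simp_all add: m_assoc)
  have "(x \<oplus> y) [^] Suc (Suc n) = (x [^] Suc n \<oplus> add_pow R (Suc n) (x [^] n \<otimes> y)) \<otimes> (x \<oplus> y)"
    using Suc by simp
  also have "\<dots> = (x [^] Suc n \<otimes> x \<oplus> x [^] Suc n \<otimes> y)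
      \<oplus> (add_pow R (Suc n) (x [^] n \<otimes> y \<otimes> x) \<oplus> add_pow R (Suc n) (x [^] n \<otimes> y \<otimes> y))"
    using assms(1,2)
    by (simp add: l_distr r_distr add_pow_ldistr a_ac del: nat_pow_Suc add.nat_pow_Suc)
  also have "\<dots> = x [^] Suc (Suc n) \<oplus> add_pow R (Suc (Suc n)) (x [^] Suc n \<otimes> y)"
    unfolding xy using assms(1,2) by (simp add: a_ac)
  finally show ?case .
qed (use assms in simp)

section \<open>Recursive formulas for the cochain operations\<close>

text \<open>
  The identities between cochain operations are proved by induction on the list of arguments, with
  the cochain varying: fixing the first argument \<open>g\<close> of \<open>c\<close> gives the function \<open>\<lambda>m. c (g # m)\<close>. This replaces
  sums over positions in the list by recursion. The functions that occur on the way, such as \<open>faces c g\<close>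
  below, may be nonzero outside \<open>lists (carrier G)\<close>, so the formulas are about functions on lists rather than cochains.
\<close>

locale cochain_algebra = cring A + G: group G
  for A :: "('a, 'k) ring_scheme" (structure) and G :: "('g, 'm) monoid_scheme" (structure)
begin

text \<open>
  The terms of the coboundary of \<open>c\<close> at \<open>g # l\<close> other than \<open>c l\<close>. The recursion splits off the term that
  multiplies \<open>g\<close> with its neighbour; the sign in front of the remaining terms comes from the index shift.
\<close>

primrec faces :: "('g list \<Rightarrow> 'a) \<Rightarrow> 'g \<Rightarrow> 'g list \<Rightarrow> 'a" where
  "faces c g [] = \<ominus> c []"
| "faces c g (h # l) = \<ominus> c ((g \<otimes>\<^bsub>G\<^esub> h) # l) \<oplus> \<ominus> faces (\<lambda>m. c (g # m)) h l"

primrec cup :: "('g list \<Rightarrow> 'a) \<Rightarrow> ('g list \<Rightarrow> 'a) \<Rightarrow> 'g list \<Rightarrow> 'a" where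
  "cup a b [] = a [] \<otimes> b []"
| "cup a b (g # l) = a [] \<otimes> b (g # l) \<oplus> cup (\<lambda>m. a (g # m)) b l"

text \<open>
  The sum of \<open>c (k\<cdot>y # z) \<cdot> v y\<close> over all ways to write the list as \<open>y @ z\<close>, where \<open>k\<cdot>y\<close> is the product of
  \<open>k\<close> and the entries of \<open>y\<close>. It collects the terms of the cup-one product whose block starts at a given entry.
\<close>

primrec blocks :: "('g list \<Rightarrow> 'a) \<Rightarrow> ('g list \<Rightarrow> 'a) \<Rightarrow> 'g \<Rightarrow> 'g list \<Rightarrow> 'a" where
  "blocks c v k [] = c [k] \<otimes> v []"
| "blocks c v k (h # l) = c (k # h # l) \<otimes> v [] \<oplus> blocks c (\<lambda>m. v (h # m)) (k \<otimes>\<^bsub>G\<^esub> h) l"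

text \<open>
  Steenrod's cup-one product: the sum of \<open>c (x @ [\<Prod>y] @ z) \<cdot> u y\<close> over all ways to write the list as
  \<open>x @ y @ z\<close> with \<open>y\<close> nonempty. The exponent of its usual sign is the length of \<open>x\<close> times one less than the
  degree of \<open>u\<close>; there are no signs here because the second factor will be of odd degree.
\<close>

primrec cup_one :: "('g list \<Rightarrow> 'a) \<Rightarrow> ('g list \<Rightarrow> 'a) \<Rightarrow> 'g list \<Rightarrow> 'a" where
  "cup_one c u [] = \<zero>"
| "cup_one c u (g # l) = blocks c (\<lambda>m. u (g # m)) g l \<oplus> cup_one (\<lambda>m. c (g # m)) u l"

definition sign :: "('g list \<Rightarrow> 'a) \<Rightarrow> 'g list \<Rightarrow> 'a" where
  "sign c l = (if even (length l) then c l else \<ominus> c l)"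

text \<open>
  The formula for the coboundary on lists with entries in \<open>G\<close>, extended to all lists.
\<close>

definition d :: "('g list \<Rightarrow> 'a) \<Rightarrow> 'g list \<Rightarrow> 'a" where
  "d c l = (case l of [] \<Rightarrow> \<zero> | g # m \<Rightarrow> c m \<oplus> faces c g m)"

lemma d_simps [simp]: "d c [] = \<zero>" "d c (g # m) = c m \<oplus> faces c g m"
  by (simp_all add: d_def)

lemma sign_simps [simp]: "sign c [] = c []"
  "(\<And>l. c l \<in> carrier A) \<Longrightarrow> sign c (g # m) = \<ominus> sign (\<lambda>m. c (g # m)) m"
  by (simp_all add: sign_def)

lemma faces_closed [simp]: "(\<And>l. c l \<in> carrier A) \<Longrightarrow> faces c g l \<in> carrier A"
  by (induction l arbitrary: c g) simp_all

lemma cup_closed [simp]: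
  "(\<And>l. a l \<in> carrier A) \<Longrightarrow> (\<And>l. b l \<in> carrier A) \<Longrightarrow> cup a b l \<in> carrier A"
  by (induction l arbitrary: a) simp_all

lemma blocks_closed [simp]:
  "(\<And>l. c l \<in> carrier A) \<Longrightarrow> (\<And>l. v l \<in> carrier A) \<Longrightarrow> blocks c v k l \<in> carrier A"
  by (induction l arbitrary: v k) simp_all

lemma cup_one_closed [simp]:
  "(\<And>l. c l \<in> carrier A) \<Longrightarrow> (\<And>l. u l \<in> carrier A) \<Longrightarrow> cup_one c u l \<in> carrier A"
  by (induction l arbitrary: c) simp_all

lemma sign_closed [simp]: "(\<And>l. c l \<in> carrier A) \<Longrightarrow> sign c l \<in> carrier A"
  by (simp add: sign_def)

lemma d_closed [simp]: "(\<And>l. c l \<in> carrier A) \<Longrightarrow> d c l \<in> carrier A"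
  by (cases l) simp_all

lemma faces_add:
  "(\<And>l. c l \<in> carrier A) \<Longrightarrow> (\<And>l. e l \<in> carrier A) \<Longrightarrow>
     faces (\<lambda>l. c l \<oplus> e l) g l = faces c g l \<oplus> faces e g l"
proof (induction l arbitrary: c e g)
  case (Cons h l)
  show ?case using Cons.prems by (simp add: Cons.IH l_distr r_distr minus_add a_ac)
qed (simp add: minus_add)

lemma faces_neg:
  "(\<And>l. c l \<in> carrier A) \<Longrightarrow> faces (\<lambda>l. \<ominus> c l) g l = \<ominus> faces c g l"
  by (induction l arbitrary: c g) (simp_all add: minus_add)

lemma faces_scale:
  "r \<in> carrier A \<Longrightarrow> (\<And>l. c l \<in> carrier A) \<Longrightarrow>
     faces (\<lambda>l. r \<otimes> c l) g l = r \<otimes> faces c g l"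
  by (induction l arbitrary: c g) (simp_all add: r_minus r_distr)

lemma faces_cong:
  "(\<And>l. l \<in> lists (carrier G) \<Longrightarrow> c l = e l) \<Longrightarrow> g \<in> carrier G \<Longrightarrow> l \<in> lists (carrier G) \<Longrightarrow>
     faces c g l = faces e g l"
proof (induction l arbitrary: c e g)
  case (Cons h l)
  then have "faces (\<lambda>m. c (g # m)) h l = faces (\<lambda>m. e (g # m)) h l"
    by (intro Cons.IH) auto
  then show ?case using Cons.prems by simp
qed simp

text \<open>
  What remains of \<open>d \<circ> d = 0\<close> once the terms that drop the first argument have been split off. In the induction
  the two ways to multiply three neighbours agree by associativity in \<open>G\<close>, and all other terms cancel in pairs.
\<close>

lemma faces_faces:
  "(\<And>l. c l \<in> carrier A) \<Longrightarrow> g \<in> carrier G \<Longrightarrow> h \<in> carrier G \<Longrightarrow> l \<in> lists (carrier G) \<Longrightarrow>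
     faces (faces c g) h l = \<ominus> faces c (g \<otimes>\<^bsub>G\<^esub> h) l"
proof (induction l arbitrary: c g h)
  case (Cons k l)
  have eq: "faces (\<lambda>m. faces c g (h # m)) k l
      = faces (\<lambda>m. \<ominus> c ((g \<otimes>\<^bsub>G\<^esub> h) # m)) k l \<oplus> \<ominus> faces (faces (\<lambda>m. c (g # m)) h) k l"
    using Cons.prems by (simp add: faces_add faces_neg)
  have *: "x \<oplus> y \<oplus> (z \<oplus> \<ominus> y) = x \<oplus> z"
    if "x \<in> carrier A" "y \<in> carrier A" "z \<in> carrier A" for x y z
    using that by algebra
  show ?case
    using Cons.prems
    by (simp add: eq[simplified] Cons.IH faces_neg G.m_assoc minus_add *)
qed simp

lemma d_d:
  assumes c: "\<And>l. c l \<in> carrier A" and l: "l \<in> lists (carrier G)"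
  shows "d (d c) l = \<zero>"
proof (cases l rule: remdups_adj.cases)
  case (3 g h m)
  have 1: "faces (\<lambda>m. d c (g # m)) h m = faces c h m \<oplus> \<ominus> faces c (g \<otimes>\<^bsub>G\<^esub> h) m"
    using c l 3 by (simp add: faces_add faces_faces)
  have *: "(x \<oplus> y) \<oplus> (\<ominus> (x \<oplus> z) \<oplus> \<ominus> (y \<oplus> \<ominus> z)) = \<zero>"
    if "x \<in> carrier A" "y \<in> carrier A" "z \<in> carrier A" for x y z
    using that by algebra
  show ?thesis using c l by (simp add: 3 1[simplified] *)
qed (use c in \<open>simp_all add: d_def\<close>)

lemma cup_add_left:
  "(\<And>l. a l \<in> carrier A) \<Longrightarrow> (\<And>l. a' l \<in> carrier A) \<Longrightarrow> (\<And>l. b l \<in> carrier A) \<Longrightarrow>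
     cup (\<lambda>l. a l \<oplus> a' l) b l = cup a b l \<oplus> cup a' b l"
proof (induction l arbitrary: a a')
  case (Cons g l)
  show ?case using Cons.prems by (simp add: Cons.IH l_distr r_distr minus_add a_ac)
qed (simp add: l_distr)

lemma cup_add_right:
  "(\<And>l. a l \<in> carrier A) \<Longrightarrow> (\<And>l. b l \<in> carrier A) \<Longrightarrow> (\<And>l. b' l \<in> carrier A) \<Longrightarrow>
     cup a (\<lambda>l. b l \<oplus> b' l) l = cup a b l \<oplus> cup a b' l"
proof (induction l arbitrary: a)
  case (Cons g l)
  show ?case using Cons.prems by (simp add: Cons.IH l_distr r_distr minus_add a_ac)
qed (simp add: r_distr)

lemma cup_neg_left:
  "(\<And>l. a l \<in> carrier A) \<Longrightarrow> (\<And>l. b l \<in> carrier A) \<Longrightarrow>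
     cup (\<lambda>l. \<ominus> a l) b l = \<ominus> cup a b l"
  by (induction l arbitrary: a) (simp_all add: l_minus minus_add)

lemma cup_scale_left:
  "r \<in> carrier A \<Longrightarrow> (\<And>l. a l \<in> carrier A) \<Longrightarrow> (\<And>l. b l \<in> carrier A) \<Longrightarrow>
     cup (\<lambda>l. r \<otimes> a l) b l = r \<otimes> cup a b l"
  by (induction l arbitrary: a) (simp_all add: r_distr m_assoc)

lemma cup_assoc:
  "(\<And>l. a l \<in> carrier A) \<Longrightarrow> (\<And>l. b l \<in> carrier A) \<Longrightarrow> (\<And>l. c l \<in> carrier A) \<Longrightarrow>
     cup (cup a b) c l = cup a (cup b c) l"
proof (induction l arbitrary: a)
  case (Cons g l)
  show ?case using Cons.prems
    by (simp add: Cons.IH cup_add_left cup_scale_left r_distr m_assoc a_assoc)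
qed (simp add: m_assoc)

text \<open>
  The Leibniz rule with the leading term \<open>cup a b l\<close> removed from both sides, which is the form that an
  induction on the list preserves.
\<close>

lemma faces_cup:
  "(\<And>l. a l \<in> carrier A) \<Longrightarrow> (\<And>l. b l \<in> carrier A) \<Longrightarrow>
     faces (cup a b) g l
       = cup (faces a g) b l \<oplus> a [] \<otimes> d b (g # l) \<oplus> \<ominus> cup (sign (\<lambda>m. a (g # m))) (d b) l"
proof (induction l arbitrary: a g)
  case Nil
  show ?case using Nil by (simp add: l_minus r_neg)
next
  case (Cons h l)
  have 1: "faces (\<lambda>m. cup a b (g # m)) h l
     = a [] \<otimes> faces (\<lambda>m. b (g # m)) h l \<oplus> faces (cup (\<lambda>m. a (g # m)) b) h l"
    using Cons.prems by (simp add: faces_add faces_scale)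
  have 2: "cup (\<lambda>m. faces a g (h # m)) b l
     = \<ominus> cup (\<lambda>m. a ((g \<otimes>\<^bsub>G\<^esub> h) # m)) b l \<oplus> \<ominus> cup (faces (\<lambda>m. a (g # m)) h) b l"
    using Cons.prems by (simp add: cup_add_left cup_neg_left)
  have 3: "cup (\<lambda>m. sign (\<lambda>m. a (g # m)) (h # m)) (d b) l
     = \<ominus> cup (sign (\<lambda>m. a (g # h # m))) (d b) l"
    using Cons.prems by (simp add: cup_neg_left)
  have *: "\<ominus> (a0 \<otimes> bgh \<oplus> x) \<oplus> \<ominus> (a0 \<otimes> F \<oplus> (Y \<oplus> ag \<otimes> Z \<oplus> \<ominus> W))
      = (\<ominus> a0 \<otimes> b1 \<oplus> (\<ominus> x \<oplus> \<ominus> Y)) \<oplus> a0 \<otimes> (b1 \<oplus> (\<ominus> bgh \<oplus> \<ominus> F)) \<oplus> \<ominus> (ag \<otimes> Z \<oplus> \<ominus> W)"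
    if "a0 \<in> carrier A" "bgh \<in> carrier A" "x \<in> carrier A" "F \<in> carrier A" "Y \<in> carrier A"
      "ag \<in> carrier A" "Z \<in> carrier A" "W \<in> carrier A" "b1 \<in> carrier A"
    for a0 bgh x F Y ag Z W b1
    using that by algebra
  show ?case using Cons.prems
    apply (simp add: Cons.IH 1[simplified] 2[simplified] cup_neg_left)
    apply (rule *)
    apply simp_all
    done
qed

lemma d_cup:
  "(\<And>l. a l \<in> carrier A) \<Longrightarrow> (\<And>l. b l \<in> carrier A) \<Longrightarrow>
     d (cup a b) l = cup (d a) b l \<oplus> cup (sign a) (d b) l"
  by (cases l) (simp_all add: faces_cup cup_add_left cup_neg_left a_ac)


lemma blocks_add_left:
  "(\<And>l. c l \<in> carrier A) \<Longrightarrow> (\<And>l. e l \<in> carrier A) \<Longrightarrow> (\<And>l. v l \<in> carrier A) \<Longrightarrow>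
     blocks (\<lambda>l. c l \<oplus> e l) v k l = blocks c v k l \<oplus> blocks e v k l"
  by (induction l arbitrary: v k) (simp_all add: l_distr a_ac)

lemma blocks_add_right:
  "(\<And>l. c l \<in> carrier A) \<Longrightarrow> (\<And>l. v l \<in> carrier A) \<Longrightarrow> (\<And>l. w l \<in> carrier A) \<Longrightarrow>
     blocks c (\<lambda>l. v l \<oplus> w l) k l = blocks c v k l \<oplus> blocks c w k l"
  by (induction l arbitrary: v w k) (simp_all add: r_distr a_ac)

lemma blocks_neg_left:
  "(\<And>l. c l \<in> carrier A) \<Longrightarrow> (\<And>l. v l \<in> carrier A) \<Longrightarrow>
     blocks (\<lambda>l. \<ominus> c l) v k l = \<ominus> blocks c v k l"
  by (induction l arbitrary: v k) (simp_all add: l_minus minus_add)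

lemma blocks_neg_right:
  "(\<And>l. c l \<in> carrier A) \<Longrightarrow> (\<And>l. v l \<in> carrier A) \<Longrightarrow>
     blocks c (\<lambda>l. \<ominus> v l) k l = \<ominus> blocks c v k l"
  by (induction l arbitrary: v k) (simp_all add: r_minus minus_add)

lemma blocks_cong:
  "(\<And>k m. k \<in> carrier G \<Longrightarrow> m \<in> lists (carrier G) \<Longrightarrow> c (k # m) = e (k # m)) \<Longrightarrow>
   (\<And>m. m \<in> lists (carrier G) \<Longrightarrow> v m = w m) \<Longrightarrow>
     k \<in> carrier G \<Longrightarrow> l \<in> lists (carrier G) \<Longrightarrow> blocks c v k l = blocks e w k l"
proof (induction l arbitrary: v w k)
  case (Cons h l)
  then have "blocks c (\<lambda>m. v (h # m)) (k \<otimes>\<^bsub>G\<^esub> h) l = blocks e (\<lambda>m. w (h # m)) (k \<otimes>\<^bsub>G\<^esub> h) l"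
    by (intro Cons.IH) auto
  then show ?case using Cons.prems by simp
qed simp

lemma blocks_shift:
  "h \<in> carrier G \<Longrightarrow> k \<in> carrier G \<Longrightarrow> l \<in> lists (carrier G) \<Longrightarrow>
     blocks (\<lambda>m. case m of [] \<Rightarrow> x | j # m \<Rightarrow> c ((h \<otimes>\<^bsub>G\<^esub> j) # m)) v k l = blocks c v (h \<otimes>\<^bsub>G\<^esub> k) l"
  by (induction l arbitrary: v k) (simp_all add: G.m_assoc)

lemma cup_eq_blocks:
  "(\<And>l. c l \<in> carrier A) \<Longrightarrow> (\<And>l. v l \<in> carrier A) \<Longrightarrow>
     cup v c l = blocks (\<lambda>m. c (tl m)) v k l"
  by (induction l arbitrary: v k) (simp_all add: m_comm)

text \<open>
  \<open>faces\<close> as a function of a single list, so that it can be substituted into \<open>blocks\<close>.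
\<close>

definition lead_faces :: "('g list \<Rightarrow> 'a) \<Rightarrow> 'g list \<Rightarrow> 'a" where
  "lead_faces c l = (case l of [] \<Rightarrow> \<zero> | g # m \<Rightarrow> faces c g m)"

lemma lead_faces_simps [simp]: "lead_faces c [] = \<zero>" "lead_faces c (g # m) = faces c g m"
  by (simp_all add: lead_faces_def)

lemma lead_faces_closed [simp]: "(\<And>l. c l \<in> carrier A) \<Longrightarrow> lead_faces c l \<in> carrier A"
  by (cases l) simp_all

text \<open>
  A face of the list \<open>y @ z\<close> lies inside the block \<open>y\<close> or inside the rest \<open>z\<close>. The first kind is counted by
  \<open>faces v h\<close>, the second by \<open>lead_faces c\<close> with a sign for the length of \<open>y\<close>. Both also contain the terms in which the
  block absorbs the next entry, with opposite signs. For the block that is the whole list, \<open>lead_faces c\<close> contains a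
  term with \<open>c []\<close> that has no counterpart, and the last summand takes it away again.
\<close>

lemma faces_blocks:
  "(\<And>l. c l \<in> carrier A) \<Longrightarrow> (\<And>l. v l \<in> carrier A) \<Longrightarrow>
   k \<in> carrier G \<Longrightarrow> h \<in> carrier G \<Longrightarrow> l \<in> lists (carrier G) \<Longrightarrow>
     faces (blocks c v k) h l
       = blocks c (faces v h) (k \<otimes>\<^bsub>G\<^esub> h) l
           \<oplus> (\<ominus> blocks (lead_faces c) (sign v) k (h # l) \<oplus> \<ominus> (sign v (h # l) \<otimes> c []))"
proof (induction l arbitrary: v k h)
  case Nil
  show ?case using Nil
    apply (simp add: l_minus r_minus l_distr minus_add a_ac)
    apply (simp add: m_comm[of "v [h]" "c []"] r_neg r_neg2)
    done
next
  case (Cons j l)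
  have 1: "faces (\<lambda>m. blocks c v k (h # m)) j l
     = v [] \<otimes> faces (\<lambda>m. c (k # h # m)) j l
       \<oplus> faces (blocks c (\<lambda>m. v (h # m)) (k \<otimes>\<^bsub>G\<^esub> h)) j l"
    using Cons.prems by (simp add: faces_add faces_scale m_comm[of _ "v []"])
  have 2: "blocks c (\<lambda>m. faces v h (j # m)) (k \<otimes>\<^bsub>G\<^esub> h \<otimes>\<^bsub>G\<^esub> j) l
     = \<ominus> blocks c (\<lambda>m. v ((h \<otimes>\<^bsub>G\<^esub> j) # m)) (k \<otimes>\<^bsub>G\<^esub> h \<otimes>\<^bsub>G\<^esub> j) l
       \<oplus> \<ominus> blocks c (faces (\<lambda>m. v (h # m)) j) (k \<otimes>\<^bsub>G\<^esub> h \<otimes>\<^bsub>G\<^esub> j) l"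
    using Cons.prems by (simp add: blocks_add_right blocks_neg_right)
  have 3: "blocks (lead_faces c) (\<lambda>m. sign v (h # m)) (k \<otimes>\<^bsub>G\<^esub> h) (j # l)
    = \<ominus> blocks (lead_faces c) (sign (\<lambda>m. v (h # m))) (k \<otimes>\<^bsub>G\<^esub> h) (j # l)"
    using Cons.prems by (simp add: blocks_neg_right del: blocks.simps)
  have *: "\<ominus> (ckhj \<otimes> v0 \<oplus> B1) \<oplus> \<ominus> (v0 \<otimes> F \<oplus> (B2 \<oplus> (\<ominus> L \<oplus> \<ominus> (S \<otimes> c0))))
     = ckh \<otimes> \<ominus> v0 \<oplus> (\<ominus> B1 \<oplus> \<ominus> B2)
        \<oplus> (\<ominus> ((\<ominus> ckh \<oplus> \<ominus> (\<ominus> ckhj \<oplus> \<ominus> F)) \<otimes> v0 \<oplus> \<ominus> L) \<oplus> \<ominus> (\<ominus> S \<otimes> c0))"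
    if "ckhj \<in> carrier A" "v0 \<in> carrier A" "B1 \<in> carrier A" "F \<in> carrier A" "B2 \<in> carrier A"
      "L \<in> carrier A" "S \<in> carrier A" "c0 \<in> carrier A" "ckh \<in> carrier A"
    for ckhj v0 B1 F B2 L S c0 ckh
    using that by algebra
  have lhs: "faces (blocks c v k) h (j # l) = \<ominus> (c (k # (h \<otimes>\<^bsub>G\<^esub> j) # l) \<otimes> v []
       \<oplus> blocks c (\<lambda>m. v ((h \<otimes>\<^bsub>G\<^esub> j) # m)) (k \<otimes>\<^bsub>G\<^esub> h \<otimes>\<^bsub>G\<^esub> j) l)
      \<oplus> \<ominus> (v [] \<otimes> faces (\<lambda>m. c (k # h # m)) j l \<oplus> (blocks c (faces (\<lambda>m. v (h # m)) j) (k \<otimes>\<^bsub>G\<^esub> h \<otimes>\<^bsub>G\<^esub> j) l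
       \<oplus> (\<ominus> blocks (lead_faces c) (sign (\<lambda>m. v (h # m))) (k \<otimes>\<^bsub>G\<^esub> h) (j # l)
       \<oplus> \<ominus> (sign (\<lambda>m. v (h # m)) (j # l) \<otimes> c []))))"
    unfolding faces.simps 1
    using Cons.prems by (subst Cons.IH) (simp_all add: G.m_assoc)
  have rhs1: "blocks c (faces v h) (k \<otimes>\<^bsub>G\<^esub> h) (j # l) = c ((k \<otimes>\<^bsub>G\<^esub> h) # j # l) \<otimes> \<ominus> v []
      \<oplus> (\<ominus> blocks c (\<lambda>m. v ((h \<otimes>\<^bsub>G\<^esub> j) # m)) (k \<otimes>\<^bsub>G\<^esub> h \<otimes>\<^bsub>G\<^esub> j) l
       \<oplus> \<ominus> blocks c (faces (\<lambda>m. v (h # m)) j) (k \<otimes>\<^bsub>G\<^esub> h \<otimes>\<^bsub>G\<^esub> j) l)"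
    using 2 by simp
  have rhs2: "blocks (lead_faces c) (sign v) k (h # j # l)
     = (\<ominus> c ((k \<otimes>\<^bsub>G\<^esub> h) # j # l) \<oplus> \<ominus> (\<ominus> c (k # (h \<otimes>\<^bsub>G\<^esub> j) # l) \<oplus> \<ominus> faces (\<lambda>m. c (k # h # m)) j l)) \<otimes> v []
       \<oplus> \<ominus> blocks (lead_faces c) (sign (\<lambda>m. v (h # m))) (k \<otimes>\<^bsub>G\<^esub> h) (j # l)"
    unfolding blocks.simps(2)[of _ _ _ h] 3 by simp
  have rhs3: "sign v (h # j # l) = \<ominus> sign (\<lambda>m. v (h # m)) (j # l)"
    using Cons.prems(2) by (rule sign_simps(2))
  show ?case
    unfolding lhs rhs1 rhs2 rhs3
    by (rule *; use Cons.prems in \<open>simp del: sign_simps blocks.simps\<close>)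
qed

lemma cup_one_add_left:
  "(\<And>l. c l \<in> carrier A) \<Longrightarrow> (\<And>l. e l \<in> carrier A) \<Longrightarrow> (\<And>l. u l \<in> carrier A) \<Longrightarrow>
     cup_one (\<lambda>l. c l \<oplus> e l) u l = cup_one c u l \<oplus> cup_one e u l"
  by (induction l arbitrary: c e) (simp_all add: blocks_add_left a_ac)

lemma cup_one_neg_left:
  "(\<And>l. c l \<in> carrier A) \<Longrightarrow> (\<And>l. u l \<in> carrier A) \<Longrightarrow>
     cup_one (\<lambda>l. \<ominus> c l) u l = \<ominus> cup_one c u l"
  by (induction l arbitrary: c) (simp_all add: blocks_neg_left minus_add)

text \<open>
  The inductive form of the cup-one formula: the terms of \<open>d (cup_one c u)\<close> that do not drop the first
  argument. In the induction step the faces inside the first block are combined by the cocycle condition on \<open>u\<close>.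
\<close>

lemma faces_cup_one:
  assumes u: "\<And>l. u l \<in> carrier A" "\<And>l. even (length l) \<Longrightarrow> u l = \<zero>"
    and du: "\<And>l. l \<in> lists (carrier G) \<Longrightarrow> d u l = \<zero>"
  shows "(\<And>l. c l \<in> carrier A) \<Longrightarrow> g \<in> carrier G \<Longrightarrow> l \<in> lists (carrier G) \<Longrightarrow>
     faces (cup_one c u) g l
       = blocks (lead_faces c) (\<lambda>m. u (g # m)) g l \<oplus> (cup_one (faces c g) u l
           \<oplus> (c [] \<otimes> u (g # l) \<oplus> \<ominus> cup (sign (\<lambda>m. c (g # m))) u l))"
proof (induction l arbitrary: c g)
  case Nil
  have [simp]: "u [] = \<zero>" using u by simp
  show ?case using Nil u(1) by (simp add: l_minus l_neg)
next
  case (Cons h l)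
  let ?gh = "g \<otimes>\<^bsub>G\<^esub> h"
  have u0 [simp]: "u [] = \<zero>" using u by simp
  have sg: "sign (\<lambda>m. u (g # m)) m = u (g # m)" for m
    using u by (simp add: sign_def)
  then have sg': "sign (\<lambda>m. u (g # m)) = (\<lambda>m. u (g # m))" by auto
  have 1: "faces (\<lambda>m. cup_one c u (g # m)) h l
     = faces (blocks c (\<lambda>m. u (g # m)) g) h l \<oplus> faces (cup_one (\<lambda>m. c (g # m)) u) h l"
    using Cons.prems u(1) by (simp add: faces_add)
  have cocycle: "u (h # m) = u (?gh # m) \<oplus> faces (\<lambda>m. u (g # m)) h m" if "m \<in> lists (carrier G)" for m
  proof -
    have *: "x = y \<oplus> z" if "x \<oplus> (\<ominus> y \<oplus> \<ominus> z) = \<zero>" "x \<in> carrier A" "y \<in> carrier A" "z \<in> carrier A" for x y z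
      using that by (metis a_closed local.minus_add minus_equality minus_minus a_inv_closed a_comm)
    show ?thesis
      using du[of "g # h # m"] that Cons.prems u(1) by (intro *) auto
  qed
  have B: "blocks c (\<lambda>m. u (h # m)) ?gh l = blocks c (\<lambda>m. u (?gh # m)) ?gh l
      \<oplus> blocks c (faces (\<lambda>m. u (g # m)) h) ?gh l"
    using Cons.prems u(1) by (subst blocks_add_right[symmetric]) (auto intro!: blocks_cong cocycle)
  have 2: "blocks (faces c g) (\<lambda>m. u (h # m)) h l
      = \<ominus> blocks c (\<lambda>m. u (h # m)) ?gh l \<oplus> \<ominus> blocks (lead_faces (\<lambda>m. c (g # m))) (\<lambda>m. u (h # m)) h l"
  proof -
    have "blocks (faces c g) (\<lambda>m. u (h # m)) h l
      = blocks (\<lambda>m. \<ominus> (case m of [] \<Rightarrow> \<zero> | j # m \<Rightarrow> c ((g \<otimes>\<^bsub>G\<^esub> j) # m)) \<oplus> \<ominus> lead_faces (\<lambda>m. c (g # m)) m) (\<lambda>m. u (h # m)) h l"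
      using Cons.prems by (intro blocks_cong) auto
    also have "\<dots> = blocks (\<lambda>m. \<ominus> (case m of [] \<Rightarrow> \<zero> | j # m \<Rightarrow> c ((g \<otimes>\<^bsub>G\<^esub> j) # m))) (\<lambda>m. u (h # m)) h l
       \<oplus> blocks (\<lambda>m. \<ominus> lead_faces (\<lambda>m. c (g # m)) m) (\<lambda>m. u (h # m)) h l"
      using Cons.prems u(1) by (intro blocks_add_left) (auto split: list.split)
    also have "\<dots> = \<ominus> blocks c (\<lambda>m. u (h # m)) ?gh l
       \<oplus> \<ominus> blocks (lead_faces (\<lambda>m. c (g # m))) (\<lambda>m. u (h # m)) h l"
      using Cons.prems u(1)
      by (subst (1 2) blocks_neg_left) (auto simp: blocks_shift split: list.split)
    finally show ?thesis .
  qed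
  have 3: "cup_one (\<lambda>m. faces c g (h # m)) u l
     = \<ominus> cup_one (\<lambda>m. c (?gh # m)) u l \<oplus> \<ominus> cup_one (faces (\<lambda>m. c (g # m)) h) u l"
    using Cons.prems u(1) by (simp add: cup_one_add_left cup_one_neg_left)
  have 4: "cup (sign (\<lambda>m. c (g # m))) u (h # l) = c [g] \<otimes> u (h # l) \<oplus> \<ominus> cup (sign (\<lambda>m. c (g # h # m))) u l"
    using Cons.prems u(1) by (simp add: cup_neg_left)
  have *: "\<ominus> (x1 \<oplus> x2) \<oplus> \<ominus> ((x3 \<oplus> (\<ominus> Y \<oplus> \<ominus> (\<ominus> s \<otimes> c0))) \<oplus> (Z1 \<oplus> (Z2 \<oplus> (cg \<otimes> uh \<oplus> \<ominus> Z3))))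
     = Y \<oplus> ((\<ominus> (x1 \<oplus> x3) \<oplus> \<ominus> Z1 \<oplus> (\<ominus> x2 \<oplus> \<ominus> Z2)) \<oplus> (c0 \<otimes> \<ominus> s \<oplus> \<ominus> (cg \<otimes> uh \<oplus> \<ominus> Z3)))"
    if "x1 \<in> carrier A" "x2 \<in> carrier A" "x3 \<in> carrier A" "Y \<in> carrier A" "s \<in> carrier A" "c0 \<in> carrier A"
      "Z1 \<in> carrier A" "Z2 \<in> carrier A" "Z3 \<in> carrier A" "cg \<in> carrier A" "uh \<in> carrier A"
    for x1 x2 x3 Y s c0 Z1 Z2 Z3 cg uh
    using that by algebra
  have lhs: "faces (cup_one c u) g (h # l)
     = \<ominus> (blocks c (\<lambda>m. u (?gh # m)) ?gh l \<oplus> cup_one (\<lambda>m. c (?gh # m)) u l)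
       \<oplus> \<ominus> ((blocks c (faces (\<lambda>m. u (g # m)) h) ?gh l
            \<oplus> (\<ominus> blocks (lead_faces c) (\<lambda>m. u (g # m)) g (h # l) \<oplus> \<ominus> (\<ominus> (\<ominus> u (g # h # l)) \<otimes> c [])))
          \<oplus> (blocks (lead_faces (\<lambda>m. c (g # m))) (\<lambda>m. u (h # m)) h l
            \<oplus> (cup_one (faces (\<lambda>m. c (g # m)) h) u l
            \<oplus> (c [g] \<otimes> u (h # l) \<oplus> \<ominus> cup (sign (\<lambda>m. c (g # h # m))) u l))))"
    unfolding faces.simps 1
    using Cons.prems u(1) by (subst Cons.IH) (simp_all add: faces_blocks sg' sg del: sign_simps blocks.simps)
  have r2: "cup_one (faces c g) u (h # l)
     = \<ominus> (blocks c (\<lambda>m. u (?gh # m)) ?gh l \<oplus> blocks c (faces (\<lambda>m. u (g # m)) h) ?gh l)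
        \<oplus> \<ominus> blocks (lead_faces (\<lambda>m. c (g # m))) (\<lambda>m. u (h # m)) h l
        \<oplus> (\<ominus> cup_one (\<lambda>m. c (?gh # m)) u l \<oplus> \<ominus> cup_one (faces (\<lambda>m. c (g # m)) h) u l)"
    unfolding cup_one.simps 2 3 B ..
  have r3: "c [] \<otimes> u (g # h # l) = c [] \<otimes> \<ominus> (\<ominus> u (g # h # l))" using u(1) by simp
  show ?case
    unfolding lhs r2 r3 4
    by (rule *; use Cons.prems u(1) in \<open>simp del: sign_simps blocks.simps\<close>)
qed

text \<open>
  Homotopy commutativity. By the cocycle condition, the faces inside a block \<open>y\<close> turn into the terms in which
  an entry next to a shorter block is multiplied onto the product of that block. Together with the faces outside
  the blocks, these are all the terms of \<open>cup_one (d c) u\<close> except those that delete the product of the block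
  at the beginning or at the end of the list. The exceptions are the two cup products.
\<close>

lemma d_cup_one:
  assumes u: "\<And>l. u l \<in> carrier A" "\<And>l. even (length l) \<Longrightarrow> u l = \<zero>"
    and du: "\<And>l. l \<in> lists (carrier G) \<Longrightarrow> d u l = \<zero>"
    and c: "\<And>l. c l \<in> carrier A" and l: "l \<in> lists (carrier G)"
  shows "d (cup_one c u) l = cup_one (d c) u l \<oplus> (\<ominus> cup u c l \<oplus> cup (sign c) u l)"
proof (cases l)
  case Nil
  show ?thesis using Nil u c by simp
next
  case (Cons g m)
  have u0 [simp]: "u [] = \<zero>" using u by simp
  have 1: "blocks (d c) (\<lambda>m. u (g # m)) g m
     = cup (\<lambda>m. u (g # m)) c m \<oplus> blocks (lead_faces c) (\<lambda>m. u (g # m)) g m"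
  proof -
    have "blocks (d c) (\<lambda>m. u (g # m)) g m
        = blocks (\<lambda>m. c (tl m) \<oplus> lead_faces c m) (\<lambda>m. u (g # m)) g m"
      using Cons l by (intro blocks_cong) auto
    then show ?thesis
      using u c by (simp add: blocks_add_left cup_eq_blocks[of c _ m g])
  qed
  have 2: "cup_one (\<lambda>m. d c (g # m)) u m = cup_one c u m \<oplus> cup_one (faces c g) u m"
    using u c by (simp add: cup_one_add_left)
  have 3: "cup (\<lambda>m. sign c (g # m)) u m = \<ominus> cup (sign (\<lambda>m. c (g # m))) u m"
    using u c by (simp add: cup_neg_left)
  have *: "x \<oplus> (y \<oplus> (z \<oplus> w)) = (v \<oplus> y) \<oplus> (x \<oplus> z) \<oplus> (\<ominus> v \<oplus> w)"
    if "x \<in> carrier A" "y \<in> carrier A" "z \<in> carrier A" "w \<in> carrier A" "v \<in> carrier A" for x y z w v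
    using that by algebra
  show ?thesis
    unfolding Cons using l u c Cons
    apply (simp add: faces_cup_one[OF u du] 1 2[simplified] 3[simplified] del: sign_simps(2))
    apply (rule *; simp)
    done
qed

end

section \<open>The cochain ring and its differential\<close>

context cochain_algebra
begin

lemma sign_power_scale:
  "x \<in> carrier A \<Longrightarrow> add_pow A ((- 1 :: int) ^ n) x = (if even n then x else \<ominus> x)"
proof -
  assume "x \<in> carrier A"
  then have "add_pow A (- 1 :: int) x = \<ominus> x" "add_pow A (1 :: int) x = x"
    using add.int_pow_neg[of x 1] by (simp_all add: add_pow_def a_inv_def int_pow_def nat_pow_def)
  then show ?thesis by simp
qed

lemma finsum_lessThan_Suc_shift:
  assumes "\<And>i. f i \<in> carrier A"
  shows "(\<Oplus>i\<in>{..<Suc n}. f i) = f 0 \<oplus> (\<Oplus>i\<in>{..<n}. f (Suc i))"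
  using assms by (simp add: lessThan_Suc_eq_insert_0 finsum_insert finsum_reindex Pi_def)

lemma finsum_neg:
  assumes "finite S" "\<And>i. f i \<in> carrier A"
  shows "(\<Oplus>i\<in>S. \<ominus> f i) = \<ominus> (\<Oplus>i\<in>S. f i)"
  using assms by (induction S rule: finite_induct) (simp_all add: Pi_def minus_add)

lemma faces_eq_sum:
  assumes "\<And>l. c l \<in> carrier A"
  shows "faces c g l =
    (\<Oplus>i\<in>{..<length l}. if even i
        then \<ominus> c (take i (g # l) @ ((g # l) ! i \<otimes>\<^bsub>G\<^esub> l ! i) # drop (Suc i) l)
        else c (take i (g # l) @ ((g # l) ! i \<otimes>\<^bsub>G\<^esub> l ! i) # drop (Suc i) l))
     \<oplus> (if even (length l) then \<ominus> c (butlast (g # l)) else c (butlast (g # l)))"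
  using assms
proof (induction l arbitrary: c g)
  case Nil
  then show ?case by simp
next
  case (Cons h l)
  let ?t = "\<lambda>i. c (g # take i (h # l) @ ((h # l) ! i \<otimes>\<^bsub>G\<^esub> l ! i) # drop (Suc i) l)"
  have 1: "faces (\<lambda>m. c (g # m)) h l = (\<Oplus>i\<in>{..<length l}. (if even i then \<ominus> ?t i else ?t i))
      \<oplus> (if even (length l) then \<ominus> c (g # butlast (h # l)) else c (g # butlast (h # l)))"
    using Cons.prems by (rule Cons.IH)
  have 2: "(\<Oplus>i\<in>{..<length l}. if even (Suc i)
        then \<ominus> c (take (Suc i) (g # h # l) @ ((g # h # l) ! Suc i \<otimes>\<^bsub>G\<^esub> (h # l) ! Suc i) # drop (Suc (Suc i)) (h # l))
        else c (take (Suc i) (g # h # l) @ ((g # h # l) ! Suc i \<otimes>\<^bsub>G\<^esub> (h # l) ! Suc i) # drop (Suc (Suc i)) (h # l)))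
     = \<ominus> (\<Oplus>i\<in>{..<length l}. (if even i then \<ominus> ?t i else ?t i))"
    using Cons.prems by (subst finsum_neg[symmetric]) (auto intro!: arg_cong[where f = "\<lambda>f. finsum A f _"])
  have 3: "(\<Oplus>i\<in>{..<length l}. (if even i then \<ominus> ?t i else ?t i)) \<in> carrier A"
    using Cons.prems by (intro finsum_closed) auto
  show ?case
    unfolding faces.simps(2) 1 length_Cons
    using Cons.prems 3
    by (subst finsum_lessThan_Suc_shift, simp, subst 2)
       (simp_all add: minus_add a_assoc del: butlast.simps add: butlast.simps(2)[of g])
qed

lemma coboundary_eq:
  assumes "\<And>l. c l \<in> carrier A"
  shows "coboundary G A c = (\<lambda>l. if l \<in> lists (carrier G) then d c l else \<zero>)"
proof
  fix l
  show "coboundary G A c l = (if l \<in> lists (carrier G) then d c l else \<zero>)"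
  proof (cases l)
    case (Cons g m)
    have 1: "(\<Oplus>i\<in>{..<length l - 1}. add_pow A ((- 1 :: int) ^ (i + 1))
                  (c (take i l @ (l ! i \<otimes>\<^bsub>G\<^esub> l ! (i + 1)) # drop (i + 2) l)))
       = (\<Oplus>i\<in>{..<length m}. if even i
        then \<ominus> c (take i (g # m) @ ((g # m) ! i \<otimes>\<^bsub>G\<^esub> m ! i) # drop (Suc i) m)
        else c (take i (g # m) @ ((g # m) ! i \<otimes>\<^bsub>G\<^esub> m ! i) # drop (Suc i) m))" (is "_ = ?S")
      unfolding Cons
      by (simp only: sign_power_scale assms)
         (intro arg_cong2[where f = "finsum A"] ext, simp_all)
    have 2: "?S \<in> carrier A" using assms by (intro finsum_closed) auto
    show ?thesis
      unfolding coboundary_def 1 using 2 assms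
      by (simp only: sign_power_scale) (simp add: Cons a_assoc faces_eq_sum[of c g m] del: butlast.simps)
  qed (simp add: coboundary_def)
qed

lemma cup_eq_sum:
  assumes "\<And>l. a l \<in> carrier A" "\<And>l. b l \<in> carrier A"
  shows "(\<Oplus>i\<in>{..length l}. a (take i l) \<otimes> b (drop i l)) = cup a b l"
  using assms(1)
proof (induction l arbitrary: a)
  case (Cons g l)
  then have "cup (\<lambda>m. a (g # m)) b l = (\<Oplus>i\<in>{..length l}. a (g # take i l) \<otimes> b (drop i l))"
    by (intro Cons.IH[symmetric])
  then show ?case using Cons.prems assms(2)
    by (simp add: finsum_Suc2 del: finsum_Suc) (simp add: a_comm)
qed (use assms in simp)

lemma cup_eq_zero:
  assumes "\<And>x y. l = x @ y \<Longrightarrow> a x = \<zero> \<or> b y = \<zero>"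
    and "\<And>l. a l \<in> carrier A" "\<And>l. b l \<in> carrier A"
  shows "cup a b l = \<zero>"
  using assms(1,2)
proof (induction l arbitrary: a)
  case (Cons g l)
  have "cup (\<lambda>m. a (g # m)) b l = \<zero>"
    using Cons.prems(1)[of "g # _"] Cons.prems(2) by (intro Cons.IH) simp_all
  then show ?case using Cons.prems(1)[of "[]"] Cons.prems(2) assms(3) by auto
qed (use assms in auto)

lemma blocks_eq_zero:
  assumes "\<And>y z k. l = y @ z \<Longrightarrow> v y = \<zero> \<or> c (k # z) = \<zero>"
    and "\<And>l. c l \<in> carrier A" "\<And>l. v l \<in> carrier A"
  shows "blocks c v k l = \<zero>"
  using assms(1,3)
proof (induction l arbitrary: v k)
  case Nil
  then have "v [] = \<zero> \<or> c [k] = \<zero>" by simp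
  then show ?case using Nil.prems(2) assms(2) by auto
next
  case (Cons g l)
  have "blocks c (\<lambda>m. v (g # m)) (k \<otimes>\<^bsub>G\<^esub> g) l = \<zero>"
    using Cons.prems(1)[of "g # _"] Cons.prems(2) by (intro Cons.IH) simp_all
  then show ?case using Cons.prems(1)[of "[]" _ k] Cons.prems(2) assms(2) by auto
qed

lemma cup_one_eq_zero:
  assumes "\<And>x y z k. l = x @ y @ z \<Longrightarrow> u y = \<zero> \<or> c (x @ k # z) = \<zero>"
    and "\<And>l. c l \<in> carrier A" "\<And>l. u l \<in> carrier A"
  shows "cup_one c u l = \<zero>"
  using assms(1,2)
proof (induction l arbitrary: c)
  case (Cons g l)
  have "cup_one (\<lambda>m. c (g # m)) u l = \<zero>"
    using Cons.prems(1)[of "g # _"] Cons.prems(2) by (intro Cons.IH) simp_all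
  moreover have "blocks c (\<lambda>m. u (g # m)) g l = \<zero>"
    using Cons.prems(1)[of "[]" "g # _"] Cons.prems(2) assms(3) by (intro blocks_eq_zero) simp_all
  ultimately show ?case by simp
qed simp

lemma cup_one_add_right:
  "(\<And>l. c l \<in> carrier A) \<Longrightarrow> (\<And>l. u l \<in> carrier A) \<Longrightarrow> (\<And>l. w l \<in> carrier A) \<Longrightarrow>
     cup_one c (\<lambda>l. u l \<oplus> w l) l = cup_one c u l \<oplus> cup_one c w l"
  by (induction l arbitrary: c) (simp_all add: blocks_add_right a_ac)

lemma cochainsI:
  "(\<And>l. c l \<in> carrier A) \<Longrightarrow> (\<And>l. l \<notin> lists (carrier G) \<Longrightarrow> c l = \<zero>) \<Longrightarrow>
   (\<And>l. N < length l \<Longrightarrow> c l = \<zero>) \<Longrightarrow> c \<in> cochains G A"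
  unfolding cochains_def by blast

lemma cochains_closed [simp]: "c \<in> cochains G A \<Longrightarrow> c l \<in> carrier A"
  by (simp add: cochains_def)

lemma cochains_outside: "c \<in> cochains G A \<Longrightarrow> l \<notin> lists (carrier G) \<Longrightarrow> c l = \<zero>"
  unfolding cochains_def by blast

lemma cochains_bounded: "c \<in> cochains G A \<Longrightarrow> \<exists>N. \<forall>l. N < length l \<longrightarrow> c l = \<zero>"
  unfolding cochains_def by blast

lemma zero_cochain: "(\<lambda>l. \<zero>) \<in> cochains G A"
  by (rule cochainsI) auto

lemma add_cochain:
  assumes "a \<in> cochains G A" "b \<in> cochains G A"
  shows "(\<lambda>l. a l \<oplus> b l) \<in> cochains G A"
proof -
  obtain N K where "\<forall>l. N < length l \<longrightarrow> a l = \<zero>" "\<forall>l. K < length l \<longrightarrow> b l = \<zero>"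
    using assms[THEN cochains_bounded] by blast
  then show ?thesis
    using assms by (intro cochainsI[where N = "max N K"]) (auto simp: assms[THEN cochains_outside])
qed

lemma neg_cochain:
  assumes "a \<in> cochains G A"
  shows "(\<lambda>l. \<ominus> a l) \<in> cochains G A"
proof -
  obtain N where "\<forall>l. N < length l \<longrightarrow> a l = \<zero>"
    using assms[THEN cochains_bounded] by blast
  then show ?thesis
    using assms by (intro cochainsI[where N = N]) (auto simp: assms[THEN cochains_outside])
qed

lemma sign_cochain:
  assumes "a \<in> cochains G A"
  shows "sign a \<in> cochains G A"
proof -
  obtain N where "\<forall>l. N < length l \<longrightarrow> a l = \<zero>"
    using assms[THEN cochains_bounded] by blast
  then show ?thesis
    using assms by (intro cochainsI[where N = N]) (auto simp: assms[THEN cochains_outside] sign_def)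
qed

lemma cup_cochain:
  assumes "a \<in> cochains G A" "b \<in> cochains G A"
  shows "cup a b \<in> cochains G A"
proof -
  obtain N K where *: "\<forall>l. N < length l \<longrightarrow> a l = \<zero>" "\<forall>l. K < length l \<longrightarrow> b l = \<zero>"
    using assms[THEN cochains_bounded] by blast
  show ?thesis
  proof (rule cochainsI[where N = "N + K"])
    show "cup a b l \<in> carrier A" for l using assms by simp
    show "cup a b l = \<zero>" if "l \<notin> lists (carrier G)" for l
    proof (rule cup_eq_zero)
      fix x y assume "l = x @ y"
      with that have "x \<notin> lists (carrier G) \<or> y \<notin> lists (carrier G)" by auto
      then show "a x = \<zero> \<or> b y = \<zero>" using assms[THEN cochains_outside] by blast
    qed (use assms in auto)
    show "cup a b l = \<zero>" if "N + K < length l" for l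
    proof (rule cup_eq_zero)
      fix x y assume "l = x @ y"
      with that have "N < length x \<or> K < length y" by auto
      then show "a x = \<zero> \<or> b y = \<zero>" using * by auto
    qed (use assms in auto)
  qed
qed

lemma cup_one_cochain:
  assumes "c \<in> cochains G A" "u \<in> cochains G A"
  shows "cup_one c u \<in> cochains G A"
proof -
  obtain N K where *: "\<forall>l. N < length l \<longrightarrow> c l = \<zero>" "\<forall>l. K < length l \<longrightarrow> u l = \<zero>"
    using assms[THEN cochains_bounded] by blast
  show ?thesis
  proof (rule cochainsI[where N = "N + K"])
    show "cup_one c u l \<in> carrier A" for l using assms by simp
    show "cup_one c u l = \<zero>" if "l \<notin> lists (carrier G)" for l
    proof (rule cup_one_eq_zero)
      fix x y z k assume "l = x @ y @ z"
      with that have "y \<notin> lists (carrier G) \<or> x @ k # z \<notin> lists (carrier G)" by auto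
      then show "u y = \<zero> \<or> c (x @ k # z) = \<zero>" using assms[THEN cochains_outside] by blast
    qed (use assms in auto)
    show "cup_one c u l = \<zero>" if "N + K < length l" for l
    proof (rule cup_one_eq_zero)
      fix x y z k assume "l = x @ y @ z"
      with that have "K < length y \<or> N < length (x @ k # z)" by auto
      then show "u y = \<zero> \<or> c (x @ k # z) = \<zero>" using * by blast
    qed (use assms in auto)
  qed
qed

lemma faces_outside_bound:
  assumes "\<And>l. N < length l \<Longrightarrow> c l = \<zero>" "N < length l"
  shows "faces c g l = \<zero>"
  using assms
proof (induction l arbitrary: c g N)
  case (Cons h l)
  have "faces (\<lambda>m. c (g # m)) h l = \<zero>"
  proof (cases N)
    case 0
    have z: "(\<lambda>m. c (g # m)) = (\<lambda>m. \<zero>)" using Cons.prems 0 by auto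
    have "faces (\<lambda>m. \<zero>) h l = \<zero>" for h by (induction l arbitrary: h) simp_all
    then show ?thesis unfolding z .
  next
    case (Suc M)
    then show ?thesis using Cons.prems by (intro Cons.IH[of M]) auto
  qed
  then show ?case using Cons.prems by auto
qed simp

lemma coboundary_cochain:
  assumes "c \<in> cochains G A"
  shows "coboundary G A c \<in> cochains G A"
proof -
  obtain N where *: "\<forall>l. N < length l \<longrightarrow> c l = \<zero>"
    using assms[THEN cochains_bounded] by blast
  have "d c l = \<zero>" if "Suc N < length l" for l
    using that * faces_outside_bound[of N c] by (cases l) auto
  then show ?thesis
    using assms by (intro cochainsI[where N = "Suc N"]) (auto simp: coboundary_eq)
qed

abbreviation C where "C \<equiv> cochain_ring G A"
abbreviation \<delta> where "\<delta> \<equiv> coboundary G A"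

lemma carrier_C: "carrier C = cochains G A" and zero_C: "\<zero>\<^bsub>C\<^esub> = (\<lambda>l. \<zero>)"
  and one_C: "\<one>\<^bsub>C\<^esub> = (\<lambda>l. if l = [] then \<one> else \<zero>)"
  and add_C: "a \<oplus>\<^bsub>C\<^esub> b = (\<lambda>l. a l \<oplus> b l)"
  by (simp_all add: cochain_ring_def)

lemma mult_C: "a \<in> cochains G A \<Longrightarrow> b \<in> cochains G A \<Longrightarrow> a \<otimes>\<^bsub>C\<^esub> b = cup a b"
  by (simp add: cochain_ring_def cup_eq_sum)

lemma one_cochain: "(\<lambda>l. if l = [] then r else \<zero>) \<in> cochains G A" if "r \<in> carrier A"
  using that by (intro cochainsI[where N = 0]) auto

lemma cup_zero_left: "(\<And>l. b l \<in> carrier A) \<Longrightarrow> cup (\<lambda>l. \<zero>) b l = \<zero>"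
  by (rule cup_eq_zero) auto

lemma cup_const_left:
  assumes "r \<in> carrier A" "\<And>l. b l \<in> carrier A"
  shows "cup (\<lambda>l. if l = [] then r else \<zero>) b l = r \<otimes> b l"
  using assms by (cases l) (simp_all add: cup_zero_left)

lemma cup_const_right:
  assumes "r \<in> carrier A" "\<And>l. b l \<in> carrier A"
  shows "cup b (\<lambda>l. if l = [] then r else \<zero>) l = r \<otimes> b l"
  using assms(2) by (induction l arbitrary: b) (simp_all add: assms(1) m_comm)

lemma ring_C: "ring C"
proof (rule ringI)
  show "abelian_group C"
  proof (rule abelian_groupI)
    fix x assume "x \<in> carrier C"
    then show "\<exists>y\<in>carrier C. y \<oplus>\<^bsub>C\<^esub> x = \<zero>\<^bsub>C\<^esub>"
      by (intro bexI[of _ "\<lambda>l. \<ominus> x l"]) (simp_all add: carrier_C neg_cochain add_C zero_C l_neg)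
  qed (auto simp: carrier_C zero_C add_C zero_cochain add_cochain a_ac)
  show "monoid C"
  proof (rule monoidI)
    fix x y z assume "x \<in> carrier C" "y \<in> carrier C" "z \<in> carrier C"
    then show "x \<otimes>\<^bsub>C\<^esub> y \<otimes>\<^bsub>C\<^esub> z = x \<otimes>\<^bsub>C\<^esub> (y \<otimes>\<^bsub>C\<^esub> z)"
      by (auto simp: carrier_C mult_C cup_cochain cup_assoc)
  qed (auto simp: carrier_C mult_C cup_cochain one_C one_cochain cup_const_left cup_const_right)
qed (auto simp: carrier_C mult_C add_C cup_add_left cup_add_right add_cochain)

sublocale C: ring C by (rule ring_C)

lemma neg_C: "a \<in> cochains G A \<Longrightarrow> \<ominus>\<^bsub>C\<^esub> a = (\<lambda>l. \<ominus> a l)"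
  by (intro C.minus_equality) (simp_all add: carrier_C neg_cochain add_C zero_C l_neg)

lemma nat_scale_C: "a \<in> cochains G A \<Longrightarrow> add_pow C (n::nat) a l = add_pow A n (a l)"
  by (induction n) (simp_all add: add_pow_def nat_pow_def cochain_ring_def)

lemma \<delta>_closed [simp]: "a \<in> carrier C \<Longrightarrow> \<delta> a \<in> carrier C"
  by (simp add: carrier_C coboundary_cochain)

lemma \<delta>_add: "a \<in> carrier C \<Longrightarrow> b \<in> carrier C \<Longrightarrow> \<delta> (a \<oplus>\<^bsub>C\<^esub> b) = \<delta> a \<oplus>\<^bsub>C\<^esub> \<delta> b"
proof -
  assume *: "a \<in> carrier C" "b \<in> carrier C"
  then have "d (\<lambda>l. a l \<oplus> b l) l = d a l \<oplus> d b l" for l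
    by (cases l) (simp_all add: faces_add carrier_C a_ac)
  with * show ?thesis by (auto simp: carrier_C add_C coboundary_eq fun_eq_iff)
qed

lemma \<delta>_\<delta>: "a \<in> carrier C \<Longrightarrow> \<delta> (\<delta> a) = \<zero>\<^bsub>C\<^esub>"
proof -
  assume a: "a \<in> carrier C"
  have "d (\<lambda>l. if l \<in> lists (carrier G) then d a l else \<zero>) l = d (d a) l" if "l \<in> lists (carrier G)" for l
    using that by (cases l) (auto intro!: faces_cong arg_cong2[where f = "add A"])
  with a show ?thesis
    by (auto simp: coboundary_eq carrier_C zero_C fun_eq_iff d_d)
qed

lemma cup_cong:
  "(\<And>m. m \<in> lists (carrier G) \<Longrightarrow> a m = a' m) \<Longrightarrow> (\<And>m. m \<in> lists (carrier G) \<Longrightarrow> b m = b' m) \<Longrightarrow>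
     l \<in> lists (carrier G) \<Longrightarrow> cup a b l = cup a' b' l"
proof (induction l arbitrary: a a')
  case (Cons g l)
  then have "cup (\<lambda>m. a (g # m)) b l = cup (\<lambda>m. a' (g # m)) b' l"
    by (intro Cons.IH) auto
  then show ?case using Cons.prems by simp
qed simp

lemma sign_C [simp]: "a \<in> carrier C \<Longrightarrow> sign a \<in> carrier C"
  by (simp add: carrier_C sign_cochain)

lemma \<delta>_mult:
  assumes "a \<in> carrier C" "b \<in> carrier C"
  shows "\<delta> (a \<otimes>\<^bsub>C\<^esub> b) = \<delta> a \<otimes>\<^bsub>C\<^esub> b \<oplus>\<^bsub>C\<^esub> sign a \<otimes>\<^bsub>C\<^esub> \<delta> b"
proof
  fix l
  have ab: "a \<in> cochains G A" "b \<in> cochains G A" using assms by (simp_all add: carrier_C)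
  have "\<delta> (a \<otimes>\<^bsub>C\<^esub> b) l = cup (\<delta> a) b l \<oplus> cup (sign a) (\<delta> b) l"
  proof (cases "l \<in> lists (carrier G)")
    case True
    have "cup (\<delta> a) b l = cup (d a) b l" "cup (sign a) (\<delta> b) l = cup (sign a) (d b) l"
      using True ab by (auto intro!: cup_cong simp: coboundary_eq)
    then show ?thesis using True ab by (simp add: mult_C coboundary_eq d_cup)
  next
    case False
    have "cup (\<delta> a) b l = \<zero>" "cup (sign a) (\<delta> b) l = \<zero>"
      using False ab by (auto intro!: cochains_outside cup_cochain sign_cochain coboundary_cochain)
    then show ?thesis using False ab by (simp add: mult_C coboundary_eq)
  qed
  then show "\<delta> (a \<otimes>\<^bsub>C\<^esub> b) l = (\<delta> a \<otimes>\<^bsub>C\<^esub> b \<oplus>\<^bsub>C\<^esub> sign a \<otimes>\<^bsub>C\<^esub> \<delta> b) l"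
    using ab by (simp add: mult_C add_C sign_cochain coboundary_cochain)
qed

lemma \<delta>_sign: "a \<in> carrier C \<Longrightarrow> \<delta> (sign a) = \<ominus>\<^bsub>C\<^esub> sign (\<delta> a)"
proof -
  assume a: "a \<in> carrier C"
  have f: "faces (sign c) g l = sign (faces c g) l" if "\<And>l. c l \<in> carrier A" for c g l
    using that
  proof (induction l arbitrary: c g)
    case (Cons h l)
    have "faces (\<lambda>m. sign c (g # m)) h l = \<ominus> faces (sign (\<lambda>m. c (g # m))) h l"
      using Cons.prems by (simp add: faces_neg)
    then show ?case using Cons.prems by (simp add: Cons.IH) (simp add: sign_def minus_add)
  qed simp
  have "d (sign a) l = \<ominus> sign (d a) l" for l
    using a by (cases l) (auto simp: carrier_C f sign_def minus_add)
  moreover have sd: "sign (\<delta> a) \<in> cochains G A"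
    using a by (simp add: carrier_C sign_cochain coboundary_cochain)
  ultimately have "\<delta> (sign a) l = (\<ominus>\<^bsub>C\<^esub> sign (\<delta> a)) l" for l
    unfolding neg_C[OF sd] using a
    by (cases "l \<in> lists (carrier G)") (simp_all add: coboundary_eq carrier_C sign_def)
  then show ?thesis by (rule ext)
qed

end

section \<open>Even and odd cochains\<close>

context cochain_algebra
begin

abbreviation scale (infixr "\<star>" 72) where "n \<star> x \<equiv> add_pow C (n::nat) x"

definition Even where "Even = {c \<in> carrier C. \<forall>l. odd (length l) \<longrightarrow> c l = \<zero>}"
definition Odd where "Odd = {c \<in> carrier C. \<forall>l. even (length l) \<longrightarrow> c l = \<zero>}"

lemma EvenD: "c \<in> Even \<Longrightarrow> c \<in> carrier C" "c \<in> Even \<Longrightarrow> odd (length l) \<Longrightarrow> c l = \<zero>"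
  by (auto simp: Even_def)
lemma OddD: "c \<in> Odd \<Longrightarrow> c \<in> carrier C" "c \<in> Odd \<Longrightarrow> even (length l) \<Longrightarrow> c l = \<zero>"
  by (auto simp: Odd_def)

lemma carrier_closed: "c \<in> carrier C \<Longrightarrow> c l \<in> carrier A"
  by (simp add: carrier_C)

lemma sign_Even: "c \<in> Even \<Longrightarrow> sign c = c"
  by (auto simp: sign_def fun_eq_iff EvenD(2))

lemma sign_Odd: "c \<in> Odd \<Longrightarrow> sign c = \<ominus>\<^bsub>C\<^esub> c"
  using OddD(1)[of c] OddD(2)[of c] by (auto simp: sign_def fun_eq_iff neg_C carrier_C)

lemma scale_apply: "a \<in> carrier C \<Longrightarrow> (n \<star> a) l = add_pow A n (a l)"
  by (simp add: carrier_C nat_scale_C)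

lemma zero_Even: "\<zero>\<^bsub>C\<^esub> \<in> Even"
  by (simp add: Even_def zero_C del: C.zero_closed) (use C.zero_closed in \<open>simp add: zero_C\<close>)

lemma one_Even: "\<one>\<^bsub>C\<^esub> \<in> Even"
  unfolding Even_def using C.one_closed by (auto simp: one_C)

lemma add_Even: "a \<in> Even \<Longrightarrow> b \<in> Even \<Longrightarrow> a \<oplus>\<^bsub>C\<^esub> b \<in> Even"
  unfolding Even_def using C.a_closed[of a b] by (auto simp: add_C)

lemma neg_Even: "a \<in> Even \<Longrightarrow> \<ominus>\<^bsub>C\<^esub> a \<in> Even"
  unfolding Even_def using C.a_inv_closed[of a] by (auto simp: neg_C carrier_C)

lemma mult_Even: "a \<in> Even \<Longrightarrow> b \<in> Even \<Longrightarrow> a \<otimes>\<^bsub>C\<^esub> b \<in> Even"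
proof -
  assume *: "a \<in> Even" "b \<in> Even"
  have "cup a b l = \<zero>" if "odd (length l)" for l
  proof (rule cup_eq_zero)
    fix x y assume "l = x @ y"
    with that have "odd (length x) \<or> odd (length y)" by auto
    with * show "a x = \<zero> \<or> b y = \<zero>" by (auto simp: EvenD(2))
  qed (use * EvenD(1) in \<open>simp_all add: carrier_closed\<close>)
  then show ?thesis unfolding Even_def using * EvenD(1) C.m_closed[of a b]
    by (auto simp: mult_C carrier_C)
qed

lemma mult_Odd_Odd: "a \<in> Odd \<Longrightarrow> b \<in> Odd \<Longrightarrow> a \<otimes>\<^bsub>C\<^esub> b \<in> Even"
proof -
  assume *: "a \<in> Odd" "b \<in> Odd"
  have "cup a b l = \<zero>" if "odd (length l)" for l
  proof (rule cup_eq_zero)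
    fix x y assume "l = x @ y"
    with that have "even (length x) \<or> even (length y)" by auto
    with * show "a x = \<zero> \<or> b y = \<zero>" by (auto simp: OddD(2))
  qed (use * OddD(1) in \<open>simp_all add: carrier_closed\<close>)
  then show ?thesis unfolding Even_def using * OddD(1) C.m_closed[of a b]
    by (auto simp: mult_C carrier_C)
qed

lemma pow_Even: "a \<in> Even \<Longrightarrow> a [^]\<^bsub>C\<^esub> (n::nat) \<in> Even"
  by (induction n) (simp_all add: one_Even mult_Even)

lemma scale_Even: "a \<in> Even \<Longrightarrow> n \<star> a \<in> Even"
  unfolding Even_def by (auto simp: scale_apply)

lemma cup_one_C: "a \<in> carrier C \<Longrightarrow> b \<in> carrier C \<Longrightarrow> cup_one a b \<in> carrier C"
  by (simp add: carrier_C cup_one_cochain)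

lemma cup_one_Even: "c \<in> Even \<Longrightarrow> u \<in> Odd \<Longrightarrow> cup_one c u \<in> Even"
proof -
  assume *: "c \<in> Even" "u \<in> Odd"
  have "cup_one c u l = \<zero>" if "odd (length l)" for l
  proof (rule cup_one_eq_zero)
    fix x y z k assume "l = x @ y @ z"
    with that have "even (length y) \<or> odd (length (x @ k # z))" by auto
    with * show "u y = \<zero> \<or> c (x @ k # z) = \<zero>" using OddD(2) EvenD(2) by blast
  qed (use * OddD(1) EvenD(1) in \<open>simp_all add: carrier_closed\<close>)
  then show ?thesis unfolding Even_def using * OddD(1) EvenD(1) cup_one_C[of c u] by auto
qed

lemma faces_parity:
  "(\<And>l. even (length l) = P \<Longrightarrow> c l = \<zero>) \<Longrightarrow> (\<And>l. c l \<in> carrier A) \<Longrightarrow> even (length l) = P \<Longrightarrow>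
     faces c g l = \<zero>"
proof (induction l arbitrary: c g P)
  case (Cons h l)
  have "faces (\<lambda>m. c (g # m)) h l = \<zero>"
    using Cons.prems by (intro Cons.IH[of "\<not> P"]) auto
  then show ?case using Cons.prems by simp
qed simp

lemma \<delta>_Even: "c \<in> Even \<Longrightarrow> \<delta> c \<in> Odd"
proof -
  assume c: "c \<in> Even"
  have "d c l = \<zero>" if "even (length l)" for l
    using that EvenD(2)[OF c] carrier_closed[OF EvenD(1)[OF c]] faces_parity[of False c]
    by (cases l) auto
  then show ?thesis
    using c EvenD(1)[OF c] \<delta>_closed[of c] unfolding Odd_def by (auto simp: coboundary_eq carrier_closed)
qed

lemma \<delta>_Odd: "c \<in> Odd \<Longrightarrow> \<delta> c \<in> Even"
proof -
  assume c: "c \<in> Odd"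
  have "d c l = \<zero>" if "odd (length l)" for l
    using that OddD(2)[OF c] carrier_closed[OF OddD(1)[OF c]] faces_parity[of True c]
    by (cases l) auto
  then show ?thesis
    using c OddD(1)[OF c] \<delta>_closed[of c] unfolding Even_def by (auto simp: coboundary_eq carrier_closed)
qed

definition even_part where "even_part c = (\<lambda>l. if even (length l) then c l else \<zero>)"
definition odd_part where "odd_part c = (\<lambda>l. if odd (length l) then c l else \<zero>)"

lemma part_cochain: "c \<in> cochains G A \<Longrightarrow> (\<lambda>l. if P l then c l else \<zero>) \<in> cochains G A"
proof -
  assume c: "c \<in> cochains G A"
  obtain N where "\<forall>l. N < length l \<longrightarrow> c l = \<zero>"
    using c[THEN cochains_bounded] by blast
  then show ?thesis
    using c by (intro cochainsI[where N = N]) (auto simp: c[THEN cochains_outside])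
qed

lemma even_part_Even: "c \<in> carrier C \<Longrightarrow> even_part c \<in> Even"
  by (simp add: Even_def carrier_C even_part_def part_cochain)

lemma odd_part_Odd: "c \<in> carrier C \<Longrightarrow> odd_part c \<in> Odd"
  by (simp add: Odd_def carrier_C odd_part_def part_cochain)

lemma even_plus_odd_part: "c \<in> carrier C \<Longrightarrow> c = even_part c \<oplus>\<^bsub>C\<^esub> odd_part c"
  by (auto simp: even_part_def odd_part_def add_C fun_eq_iff carrier_C)

lemma Even_Odd_unique:
  assumes "a \<in> Even" "b \<in> Odd" "a \<oplus>\<^bsub>C\<^esub> b = \<zero>\<^bsub>C\<^esub>"
  shows "a = \<zero>\<^bsub>C\<^esub>" "b = \<zero>\<^bsub>C\<^esub>"
proof -
  have *: "a l \<oplus> b l = \<zero>" for l using fun_cong[OF assms(3), of l] by (simp add: add_C zero_C)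
  have "a l = \<zero> \<and> b l = \<zero>" for l
    using *[of l] EvenD[OF assms(1)] OddD[OF assms(2)] carrier_closed by (cases "even (length l)") auto
  then show "a = \<zero>\<^bsub>C\<^esub>" "b = \<zero>\<^bsub>C\<^esub>" by (auto simp: zero_C)
qed

lemma odd_divisor:
  assumes "a \<in> Odd" "e \<in> carrier C" "a = n \<star> e"
  shows "a = n \<star> odd_part e"
proof
  fix l show "a l = (n \<star> odd_part e) l"
    using assms OddD(2)[OF assms(1), of l] odd_part_Odd[OF assms(2)]
    by (auto simp: scale_apply Odd_def odd_part_def)
qed

lemma \<delta>_zero: "\<delta> \<zero>\<^bsub>C\<^esub> = \<zero>\<^bsub>C\<^esub>"
  using \<delta>_add[of "\<zero>\<^bsub>C\<^esub>" "\<zero>\<^bsub>C\<^esub>"] C.zero_closed \<delta>_closed by (metis C.add.r_cancel_one' C.l_zero)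

lemma \<delta>_neg: "a \<in> carrier C \<Longrightarrow> \<delta> (\<ominus>\<^bsub>C\<^esub> a) = \<ominus>\<^bsub>C\<^esub> \<delta> a"
  using \<delta>_add[of "\<ominus>\<^bsub>C\<^esub> a" a] by (metis C.a_inv_closed C.l_neg C.minus_equality \<delta>_closed \<delta>_zero)

lemma \<delta>_scale: "a \<in> carrier C \<Longrightarrow> \<delta> (n \<star> a) = n \<star> \<delta> a"
  by (induction n) (simp_all add: \<delta>_zero \<delta>_add)

lemma cup_one_scale_right:
  assumes "c \<in> carrier C" "u \<in> carrier C"
  shows "cup_one c (n \<star> u) = n \<star> cup_one c u"
proof (induction n)
  case 0
  have "cup_one c \<zero>\<^bsub>C\<^esub> l = \<zero>" for l
    using assms by (intro cup_one_eq_zero) (auto simp: zero_C carrier_closed)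
  then show ?case by (auto simp: zero_C)
next
  case (Suc n)
  have "cup_one c (n \<star> u \<oplus>\<^bsub>C\<^esub> u) l = cup_one c (n \<star> u) l \<oplus> cup_one c u l" for l
    using assms unfolding add_C
    by (intro cup_one_add_right) (simp_all add: carrier_closed)
  then show ?case by (simp add: Suc.IH[symmetric]) (simp add: add_C)
qed

lemma cup_one_scale_left:
  assumes "c \<in> carrier C" "u \<in> carrier C"
  shows "cup_one (n \<star> c) u = n \<star> cup_one c u"
proof (induction n)
  case 0
  have "cup_one \<zero>\<^bsub>C\<^esub> u l = \<zero>" for l
    using assms by (intro cup_one_eq_zero) (auto simp: zero_C carrier_closed)
  then show ?case by (auto simp: zero_C)
next
  case (Suc n)
  have "cup_one (n \<star> c \<oplus>\<^bsub>C\<^esub> c) u l = cup_one (n \<star> c) u l \<oplus> cup_one c u l" for l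
    using assms unfolding add_C
    by (intro cup_one_add_left) (simp_all add: carrier_closed)
  then show ?case by (simp add: Suc.IH[symmetric]) (simp add: add_C)
qed

lemma cup_one_cong:
  "(\<And>m. m \<in> lists (carrier G) \<Longrightarrow> c m = e m) \<Longrightarrow> l \<in> lists (carrier G) \<Longrightarrow> cup_one c u l = cup_one e u l"
proof (induction l arbitrary: c e)
  case (Cons g l)
  then have "cup_one (\<lambda>m. c (g # m)) u l = cup_one (\<lambda>m. e (g # m)) u l"
    by (intro Cons.IH) auto
  moreover have "blocks c (\<lambda>m. u (g # m)) g l = blocks e (\<lambda>m. u (g # m)) g l"
    using Cons.prems by (intro blocks_cong) auto
  ultimately show ?case by simp
qed simp

lemma \<delta>_cup_one:
  assumes c: "c \<in> carrier C" and u: "u \<in> Odd" and du: "\<delta> u = \<zero>\<^bsub>C\<^esub>"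
  shows "\<delta> (cup_one c u) = cup_one (\<delta> c) u \<oplus>\<^bsub>C\<^esub> (\<ominus>\<^bsub>C\<^esub> (u \<otimes>\<^bsub>C\<^esub> c) \<oplus>\<^bsub>C\<^esub> sign c \<otimes>\<^bsub>C\<^esub> u)"
proof
  fix l
  note cl = carrier_closed[OF c] carrier_closed[OF OddD(1)[OF u]]
  have in_C: "c \<in> cochains G A" "u \<in> cochains G A" "sign c \<in> cochains G A" "cup u c \<in> cochains G A"
    using c OddD(1)[OF u] by (simp_all add: carrier_C sign_cochain cup_cochain)
  have d0: "d u l = \<zero>" if "l \<in> lists (carrier G)" for l
    using fun_cong[OF du, of l] that cl by (simp add: coboundary_eq zero_C)
  have rhs: "(cup_one (\<delta> c) u \<oplus>\<^bsub>C\<^esub> (\<ominus>\<^bsub>C\<^esub> (u \<otimes>\<^bsub>C\<^esub> c) \<oplus>\<^bsub>C\<^esub> sign c \<otimes>\<^bsub>C\<^esub> u)) l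
     = cup_one (\<delta> c) u l \<oplus> (\<ominus> cup u c l \<oplus> cup (sign c) u l)"
    by (simp add: mult_C in_C neg_C add_C)
  show "\<delta> (cup_one c u) l = (cup_one (\<delta> c) u \<oplus>\<^bsub>C\<^esub> (\<ominus>\<^bsub>C\<^esub> (u \<otimes>\<^bsub>C\<^esub> c) \<oplus>\<^bsub>C\<^esub> sign c \<otimes>\<^bsub>C\<^esub> u)) l"
  proof (cases "l \<in> lists (carrier G)")
    case True
    have "cup_one (\<delta> c) u l = cup_one (d c) u l"
      using True by (intro cup_one_cong) (simp_all add: coboundary_eq cl)
    then show ?thesis unfolding rhs
      using True d_cup_one[OF cl(2) OddD(2)[OF u] d0 cl(1) True] by (simp add: coboundary_eq cl)
  next
    case False
    then have "\<delta> (cup_one c u) l = \<zero>" by (simp add: coboundary_eq cl)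
    moreover have "cup_one (\<delta> c) u l = \<zero>" "cup u c l = \<zero>" "cup (sign c) u l = \<zero>"
      using False in_C
      by (auto intro!: cochains_outside[OF cup_one_cochain] cochains_outside[OF cup_cochain] coboundary_cochain)
    ultimately show ?thesis unfolding rhs by simp
  qed
qed

text \<open>
  Summation over the last argument is a contracting homotopy up to sign and up to the order of \<open>G\<close>.
\<close>

definition sum_last where "sum_last c l = (\<Oplus>x\<in>carrier G. c (l @ [x]))"

lemma sum_last_closed [simp]: "(\<And>l. c l \<in> carrier A) \<Longrightarrow> sum_last c l \<in> carrier A"
  unfolding sum_last_def by (intro finsum_closed) auto

text \<open>
  The faces that do not involve the last entry \<open>x\<close> commute with the sum over \<open>x\<close>. The one that multiplies \<open>x\<close> by its
  neighbour also gives a face of \<open>sum_last c\<close>, as translation permutes \<open>G\<close>, and the one that deletes \<open>x\<close> is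
  independent of \<open>x\<close> and contributes the order of \<open>G\<close>.
\<close>

lemma faces_sum_last:
  assumes fin: "finite (carrier G)"
  shows "(\<And>l. c l \<in> carrier A) \<Longrightarrow> g \<in> carrier G \<Longrightarrow> l \<in> lists (carrier G) \<Longrightarrow>
     (\<Oplus>x\<in>carrier G. faces c g (l @ [x]))
       = faces (sum_last c) g l \<oplus> \<ominus> add_pow A (card (carrier G)) (sign c (g # l))"
proof (induction l arbitrary: c g)
  case Nil
  have "(\<Oplus>x\<in>carrier G. faces c g ([] @ [x])) = (\<Oplus>x\<in>carrier G. \<ominus> c [g \<otimes>\<^bsub>G\<^esub> x]) \<oplus> (\<Oplus>x\<in>carrier G. c [g])"
    using Nil fin by (simp add: finsum_addf)
  also have "(\<Oplus>x\<in>carrier G. \<ominus> c [g \<otimes>\<^bsub>G\<^esub> x]) = \<ominus> (\<Oplus>x\<in>carrier G. c [g \<otimes>\<^bsub>G\<^esub> x])"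
    using Nil fin by (intro finsum_neg)
  also have "(\<Oplus>x\<in>carrier G. c [g \<otimes>\<^bsub>G\<^esub> x]) = (\<Oplus>x\<in>(\<lambda>x. g \<otimes>\<^bsub>G\<^esub> x) ` carrier G. c [x])"
    using Nil by (intro finsum_reindex[symmetric]) (auto intro!: inj_onI)
  also have "(\<lambda>x. g \<otimes>\<^bsub>G\<^esub> x) ` carrier G = carrier G"
    using Nil by (intro G.surj_const_mult)
  also have "(\<Oplus>x\<in>carrier G. c [g]) = add_pow A (card (carrier G)) (c [g])"
    using Nil by (simp add: add.finprod_const)
  finally show ?case using Nil
    by (simp add: sum_last_def sign_def add_pow_neg)
next
  case (Cons h l)
  have "(\<Oplus>x\<in>carrier G. faces c g ((h # l) @ [x]))
     = (\<Oplus>x\<in>carrier G. \<ominus> c ((g \<otimes>\<^bsub>G\<^esub> h) # l @ [x])) \<oplus> (\<Oplus>x\<in>carrier G. \<ominus> faces (\<lambda>m. c (g # m)) h (l @ [x]))"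
    using Cons.prems by (simp add: finsum_addf Pi_def)
  also have "\<dots> = \<ominus> sum_last c ((g \<otimes>\<^bsub>G\<^esub> h) # l) \<oplus> \<ominus> (\<Oplus>x\<in>carrier G. faces (\<lambda>m. c (g # m)) h (l @ [x]))"
    using Cons.prems fin by (simp add: finsum_neg sum_last_def)
  also have "(\<Oplus>x\<in>carrier G. faces (\<lambda>m. c (g # m)) h (l @ [x]))
     = faces (sum_last (\<lambda>m. c (g # m))) h l \<oplus> \<ominus> add_pow A (card (carrier G)) (sign (\<lambda>m. c (g # m)) (h # l))"
    using Cons.prems by (intro Cons.IH) auto
  also have "sum_last (\<lambda>m. c (g # m)) = (\<lambda>m. sum_last c (g # m))"
    by (simp add: sum_last_def fun_eq_iff)
  finally show ?case using Cons.prems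
    by (simp add: minus_add a_assoc del: sign_simps)
       (simp add: sign_simps(2)[of c g] add_pow_neg)
qed

text \<open>
  The order of a finite group kills its cohomology in positive degrees. Odd cochains have no component in
  degree zero, where this would fail, and the sign in \<open>faces_sum_last\<close> is the same for all their components.
\<close>

lemma order_kills_odd:
  assumes fin: "finite (carrier G)" and c: "c \<in> Odd" and dc: "\<delta> c = \<zero>\<^bsub>C\<^esub>"
  shows "\<exists>f\<in>carrier C. card (carrier G) \<star> c = \<delta> f"
proof -
  note cl = carrier_closed[OF OddD(1)[OF c]]
  define f where "f = (\<lambda>l. if l \<in> lists (carrier G) then sum_last c l else \<zero>)"
  have cC: "c \<in> cochains G A" using OddD(1)[OF c] by (simp add: carrier_C)
  obtain N where N: "\<forall>l. N < length l \<longrightarrow> c l = \<zero>"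
    using cC[THEN cochains_bounded] by blast
  have f: "f \<in> carrier C"
    unfolding carrier_C
  proof (rule cochainsI[where N = N])
    show "f l \<in> carrier A" for l using cl by (simp add: f_def)
    show "f l = \<zero>" if "l \<notin> lists (carrier G)" for l using that by (simp add: f_def)
    show "f l = \<zero>" if "N < length l" for l using that N by (simp add: f_def sum_last_def)
  qed
  have "(card (carrier G) \<star> c) l = (\<ominus>\<^bsub>C\<^esub> \<delta> f) l" for l
  proof (cases "l \<in> lists (carrier G) \<and> l \<noteq> []")
    case True
    then obtain g m where l: "l = g # m" "g \<in> carrier G" "m \<in> lists (carrier G)" by (cases l) auto
    have "(\<Oplus>x\<in>carrier G. d c (l @ [x])) = (\<Oplus>x\<in>carrier G. \<zero>)"
    proof (rule finsum_cong')
      fix x assume "x \<in> carrier G"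
      then show "d c (l @ [x]) = \<zero>"
        using fun_cong[OF dc, of "l @ [x]"] True cl by (simp add: coboundary_eq zero_C)
    qed auto
    also have "(\<Oplus>x\<in>carrier G. d c (l @ [x])) = sum_last c m \<oplus> (\<Oplus>x\<in>carrier G. faces c g (m @ [x]))"
      using cl by (simp add: l finsum_addf Pi_def sum_last_def)
    finally have 1: "sum_last c m \<oplus> (faces (sum_last c) g m \<oplus> \<ominus> add_pow A (card (carrier G)) (sign c (g # m))) = \<zero>"
      using faces_sum_last[OF fin cl l(2,3)] by simp
    have "faces (sum_last c) g m = faces f g m" "sum_last c m = f m"
      using l by (auto intro!: faces_cong simp: f_def)
    moreover have "\<ominus> add_pow A (card (carrier G)) (sign c (g # m)) = add_pow A (card (carrier G)) (c l)"
      using fun_cong[OF sign_Odd[OF c], of l] cl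
      by (simp add: neg_C cC l add_pow_neg del: sign_simps)
    ultimately have "f m \<oplus> faces f g m \<oplus> add_pow A (card (carrier G)) (c l) = \<zero>"
      using 1 carrier_closed[OF f] cl by (simp add: a_assoc)
    then have "add_pow A (card (carrier G)) (c l) = \<ominus> (f m \<oplus> faces f g m)"
      using carrier_closed[OF f] cl by (metis a_closed faces_closed minus_equality minus_minus add.nat_pow_closed sum_zero_eq_neg)
    moreover have "\<delta> f l = f m \<oplus> faces f g m"
      using carrier_closed[OF f] l by (simp add: coboundary_eq)
    moreover have "(\<ominus>\<^bsub>C\<^esub> \<delta> f) l = \<ominus> (\<delta> f l)"
      using f by (simp add: neg_C carrier_C coboundary_cochain)
    ultimately show ?thesis
      using OddD(1)[OF c] l by (simp add: scale_apply)
  next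
    case False
    then have "c l = \<zero>" "\<delta> f l = \<zero>"
      using OddD(2)[OF c, of "[]"] cochains_outside[OF cC, of l] carrier_closed[OF f] by (auto simp: coboundary_eq)
    then show ?thesis using f OddD(1)[OF c] by (simp add: scale_apply neg_C carrier_C coboundary_cochain)
  qed
  then have "card (carrier G) \<star> c = \<delta> (\<ominus>\<^bsub>C\<^esub> f)" using f by (simp add: \<delta>_neg fun_eq_iff)
  then show ?thesis using f by blast
qed

end

section \<open>Lifting powers of even cochains\<close>

context cochain_algebra
begin

text \<open>
  The error terms that can be tolerated in the coboundary of a \<open>p\<close>-th power: \<open>q \<star> \<delta> w\<close> is removed by subtracting
  \<open>q \<star> w\<close> from the power, which then stays even, and \<open>(q * p) \<star> v\<close> has the required divisibility already.
\<close>

definition negligible where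
  "negligible p q = {q \<star> \<delta> w \<oplus>\<^bsub>C\<^esub> (q * p) \<star> v | w v. w \<in> Even \<and> v \<in> carrier C}"

lemma negligibleI: "w \<in> Even \<Longrightarrow> v \<in> carrier C \<Longrightarrow> q \<star> \<delta> w \<oplus>\<^bsub>C\<^esub> (q * p) \<star> v \<in> negligible p q"
  unfolding negligible_def by blast

lemma negligible_carrier: "x \<in> negligible p q \<Longrightarrow> x \<in> carrier C"
  unfolding negligible_def by (auto dest: EvenD(1))

lemma negligible_scale: "v \<in> carrier C \<Longrightarrow> (q * p) \<star> v \<in> negligible p q"
  using negligibleI[OF zero_Even, of v q p] by (simp add: \<delta>_zero)

lemma negligible_zero: "\<zero>\<^bsub>C\<^esub> \<in> negligible p q"
  using negligible_scale[OF C.zero_closed] by simp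

lemma negligible_coboundary: "w \<in> Even \<Longrightarrow> q \<star> \<delta> w \<in> negligible p q"
  using negligibleI[of w "\<zero>\<^bsub>C\<^esub>" q p] EvenD(1) by simp

lemma negligible_add:
  assumes "x \<in> negligible p q" "y \<in> negligible p q"
  shows "x \<oplus>\<^bsub>C\<^esub> y \<in> negligible p q"
proof -
  obtain w v w' v' where *: "x = q \<star> \<delta> w \<oplus>\<^bsub>C\<^esub> (q * p) \<star> v" "w \<in> Even" "v \<in> carrier C"
      "y = q \<star> \<delta> w' \<oplus>\<^bsub>C\<^esub> (q * p) \<star> v'" "w' \<in> Even" "v' \<in> carrier C"
    using assms unfolding negligible_def by blast
  have "x \<oplus>\<^bsub>C\<^esub> y = q \<star> \<delta> (w \<oplus>\<^bsub>C\<^esub> w') \<oplus>\<^bsub>C\<^esub> (q * p) \<star> (v \<oplus>\<^bsub>C\<^esub> v')"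
    using * EvenD(1) by (simp add: \<delta>_add C.add.nat_pow_distrib C.a_ac)
  then show ?thesis using * by (auto intro: negligibleI add_Even)
qed

lemma negligible_neg:
  assumes "x \<in> negligible p q"
  shows "\<ominus>\<^bsub>C\<^esub> x \<in> negligible p q"
proof -
  obtain w v where *: "x = q \<star> \<delta> w \<oplus>\<^bsub>C\<^esub> (q * p) \<star> v" "w \<in> Even" "v \<in> carrier C"
    using assms unfolding negligible_def by blast
  have "\<ominus>\<^bsub>C\<^esub> x = q \<star> \<delta> (\<ominus>\<^bsub>C\<^esub> w) \<oplus>\<^bsub>C\<^esub> (q * p) \<star> (\<ominus>\<^bsub>C\<^esub> v)"
    using * EvenD(1) by (simp add: \<delta>_neg C.minus_add C.add_pow_neg)
  then show ?thesis using * by (auto intro: negligibleI neg_Even)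
qed

lemma negligible_nat_scale: "x \<in> negligible p q \<Longrightarrow> k \<star> x \<in> negligible p q"
  by (induction k) (simp_all add: negligible_zero negligible_add)

lemma scale_scale: "x \<in> carrier C \<Longrightarrow> n \<star> m \<star> x = (n * m) \<star> x"
  by (simp add: C.add.nat_pow_pow mult.commute)

lemma \<delta>_pow_divisible:
  assumes c: "c \<in> Even" and e: "e \<in> carrier C" "\<delta> c = q \<star> e"
  shows "\<exists>v\<in>carrier C. \<delta> (c [^]\<^bsub>C\<^esub> (k::nat)) = q \<star> v"
proof (induction k)
  case 0
  have "\<delta> \<one>\<^bsub>C\<^esub> = \<delta> \<one>\<^bsub>C\<^esub> \<oplus>\<^bsub>C\<^esub> \<delta> \<one>\<^bsub>C\<^esub>"
    using \<delta>_mult[of "\<one>\<^bsub>C\<^esub>" "\<one>\<^bsub>C\<^esub>"] sign_Even[OF one_Even] by simp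
  then have "\<delta> \<one>\<^bsub>C\<^esub> = \<zero>\<^bsub>C\<^esub>"
    by (metis C.add.r_cancel_one' C.one_closed \<delta>_closed)
  then show ?case using C.zero_closed by (intro bexI[of _ "\<zero>\<^bsub>C\<^esub>"]) simp_all
next
  case (Suc k)
  then obtain v where v: "v \<in> carrier C" "\<delta> (c [^]\<^bsub>C\<^esub> k) = q \<star> v" by blast
  have cC: "c \<in> carrier C" using c by (rule EvenD)
  have "\<delta> (c [^]\<^bsub>C\<^esub> Suc k) = q \<star> (v \<otimes>\<^bsub>C\<^esub> c) \<oplus>\<^bsub>C\<^esub> q \<star> (c [^]\<^bsub>C\<^esub> k \<otimes>\<^bsub>C\<^esub> e)"
    using cC v e by (simp add: \<delta>_mult sign_Even pow_Even c C.add_pow_ldistr C.add_pow_rdistr)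
  then show ?case using cC v e by (intro bexI[of _ "v \<otimes>\<^bsub>C\<^esub> c \<oplus>\<^bsub>C\<^esub> c [^]\<^bsub>C\<^esub> k \<otimes>\<^bsub>C\<^esub> e"]) (simp_all add: C.add.nat_pow_distrib)
qed

text \<open>
  Modulo \<open>q * p\<close>, multiplication by \<open>c\<close> commutes with \<open>q \<star> \<delta>\<close>: the Leibniz rule leaves a term with
  \<open>q \<star> \<delta> c\<close>, which is a multiple of \<open>q * q\<close>, hence of \<open>q * p\<close>.
\<close>

lemma negligible_mult_right:
  assumes x: "x \<in> negligible p q" and pq: "p dvd q"
    and c: "c \<in> Even" and e: "e \<in> carrier C" "\<delta> c = q \<star> e"
  shows "x \<otimes>\<^bsub>C\<^esub> c \<in> negligible p q"
proof -
  obtain w v where *: "x = q \<star> \<delta> w \<oplus>\<^bsub>C\<^esub> (q * p) \<star> v" "w \<in> Even" "v \<in> carrier C"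
    using x unfolding negligible_def by blast
  obtain r where r: "q = p * r" using pq by blast
  note C = EvenD(1)[OF c] EvenD(1)[OF *(2)]
  have "\<delta> (w \<otimes>\<^bsub>C\<^esub> c) = \<delta> w \<otimes>\<^bsub>C\<^esub> c \<oplus>\<^bsub>C\<^esub> q \<star> (w \<otimes>\<^bsub>C\<^esub> e)"
    using C e by (simp add: \<delta>_mult sign_Even * C.add_pow_rdistr)
  then have "\<delta> w \<otimes>\<^bsub>C\<^esub> c = \<delta> (w \<otimes>\<^bsub>C\<^esub> c) \<oplus>\<^bsub>C\<^esub> \<ominus>\<^bsub>C\<^esub> (q \<star> (w \<otimes>\<^bsub>C\<^esub> e))"
    using C e by (simp add: C.a_assoc C.r_neg)
  then have "q \<star> (\<delta> w \<otimes>\<^bsub>C\<^esub> c) = q \<star> \<delta> (w \<otimes>\<^bsub>C\<^esub> c) \<oplus>\<^bsub>C\<^esub> \<ominus>\<^bsub>C\<^esub> ((q * p) \<star> r \<star> (w \<otimes>\<^bsub>C\<^esub> e))"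
    using C e by (simp add: C.add.nat_pow_distrib scale_scale r mult_ac C.add_pow_neg)
  moreover have "x \<otimes>\<^bsub>C\<^esub> c = q \<star> (\<delta> w \<otimes>\<^bsub>C\<^esub> c) \<oplus>\<^bsub>C\<^esub> (q * p) \<star> (v \<otimes>\<^bsub>C\<^esub> c)"
    using * C by (simp add: C.l_distr C.add_pow_ldistr)
  ultimately show ?thesis
    using C c e * by (auto intro!: negligible_add negligible_neg negligible_scale negligible_coboundary mult_Even)
qed

lemma negligible_mult_left:
  assumes x: "x \<in> negligible p q" and pq: "p dvd q"
    and c: "c \<in> Even" and e: "e \<in> carrier C" "\<delta> c = q \<star> e"
  shows "c \<otimes>\<^bsub>C\<^esub> x \<in> negligible p q"
proof -
  obtain w v where *: "x = q \<star> \<delta> w \<oplus>\<^bsub>C\<^esub> (q * p) \<star> v" "w \<in> Even" "v \<in> carrier C"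
    using x unfolding negligible_def by blast
  obtain r where r: "q = p * r" using pq by blast
  note C = EvenD(1)[OF c] EvenD(1)[OF *(2)]
  have "\<delta> (c \<otimes>\<^bsub>C\<^esub> w) = q \<star> (e \<otimes>\<^bsub>C\<^esub> w) \<oplus>\<^bsub>C\<^esub> c \<otimes>\<^bsub>C\<^esub> \<delta> w"
    using C e by (simp add: \<delta>_mult sign_Even c C.add_pow_ldistr)
  then have "c \<otimes>\<^bsub>C\<^esub> \<delta> w = \<delta> (c \<otimes>\<^bsub>C\<^esub> w) \<oplus>\<^bsub>C\<^esub> \<ominus>\<^bsub>C\<^esub> (q \<star> (e \<otimes>\<^bsub>C\<^esub> w))"
    using C e by (simp add: C.add_minus_cancel_left C.a_assoc)
  then have "q \<star> (c \<otimes>\<^bsub>C\<^esub> \<delta> w) = q \<star> \<delta> (c \<otimes>\<^bsub>C\<^esub> w) \<oplus>\<^bsub>C\<^esub> \<ominus>\<^bsub>C\<^esub> ((q * p) \<star> r \<star> (e \<otimes>\<^bsub>C\<^esub> w))"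
    using C e by (simp add: C.add.nat_pow_distrib scale_scale r mult_ac C.add_pow_neg)
  moreover have "c \<otimes>\<^bsub>C\<^esub> x = q \<star> (c \<otimes>\<^bsub>C\<^esub> \<delta> w) \<oplus>\<^bsub>C\<^esub> (q * p) \<star> (c \<otimes>\<^bsub>C\<^esub> v)"
    using * C by (simp add: C.r_distr C.add_pow_rdistr)
  ultimately show ?thesis
    using C c e * by (auto intro!: negligible_add negligible_neg negligible_scale negligible_coboundary mult_Even)
qed

text \<open>
  The cup-one formula for \<open>c\<close> and the odd cocycle \<open>\<delta> c\<close>. As the cup-one product is biadditive,
  that of \<open>c\<close> with \<open>\<delta> c\<close> is a multiple of \<open>q\<close>, and that of \<open>\<delta> c\<close> with itself is a multiple of \<open>q * q\<close>.
\<close>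

lemma commutator_negligible:
  assumes pq: "p dvd q" and c: "c \<in> Even" and e: "e \<in> Odd" "\<delta> c = q \<star> e"
  shows "\<delta> c \<otimes>\<^bsub>C\<^esub> c \<oplus>\<^bsub>C\<^esub> \<ominus>\<^bsub>C\<^esub> (c \<otimes>\<^bsub>C\<^esub> \<delta> c) \<in> negligible p q"
proof -
  obtain r where r: "q = p * r" using pq by blast
  note C = EvenD(1)[OF c] OddD(1)[OF e(1)]
  have "\<delta> (cup_one c (\<delta> c)) = cup_one (\<delta> c) (\<delta> c) \<oplus>\<^bsub>C\<^esub> (\<ominus>\<^bsub>C\<^esub> (\<delta> c \<otimes>\<^bsub>C\<^esub> c) \<oplus>\<^bsub>C\<^esub> c \<otimes>\<^bsub>C\<^esub> \<delta> c)"
    using \<delta>_cup_one[OF C(1) \<delta>_Even[OF c] \<delta>_\<delta>[OF C(1)]] sign_Even[OF c] by simp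
  then have "\<delta> c \<otimes>\<^bsub>C\<^esub> c \<oplus>\<^bsub>C\<^esub> \<ominus>\<^bsub>C\<^esub> (c \<otimes>\<^bsub>C\<^esub> \<delta> c)
      = cup_one (\<delta> c) (\<delta> c) \<oplus>\<^bsub>C\<^esub> \<ominus>\<^bsub>C\<^esub> \<delta> (cup_one c (\<delta> c))"
    by (rule C.add_minus_eqI) (use C in \<open>simp_all add: cup_one_C\<close>)
  also have "cup_one (\<delta> c) (\<delta> c) = (q * p) \<star> r \<star> cup_one e e"
    unfolding e(2) using C by (simp add: cup_one_scale_left cup_one_scale_right scale_scale cup_one_C r mult_ac)
  also have "\<delta> (cup_one c (\<delta> c)) = q \<star> \<delta> (cup_one c e)"
    unfolding e(2) using C by (simp add: cup_one_scale_right cup_one_C \<delta>_scale)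
  finally show ?thesis
    using C c e(1) by (auto intro!: negligible_add negligible_neg negligible_scale negligible_coboundary cup_one_Even cup_one_C)
qed

text \<open>
  The derivation rule for powers, as in a commutative ring, holds modulo negligible terms: the commutators
  of \<open>c\<close> and \<open>\<delta> c\<close> are negligible, and so are their products with powers of \<open>c\<close>.
\<close>

lemma \<delta>_power_mod_negligible:
  assumes pq: "p dvd q" and c: "c \<in> Even" and e: "e \<in> Odd" "\<delta> c = q \<star> e"
  shows "\<exists>x\<in>negligible p q. \<delta> (c [^]\<^bsub>C\<^esub> Suc k) = Suc k \<star> (c [^]\<^bsub>C\<^esub> k \<otimes>\<^bsub>C\<^esub> \<delta> c) \<oplus>\<^bsub>C\<^esub> x"
proof (induction k)
  case 0
  then show ?case using negligible_zero EvenD(1)[OF c] by (intro bexI[of _ "\<zero>\<^bsub>C\<^esub>"]) simp_all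
next
  case (Suc k)
  note C = EvenD(1)[OF c] OddD(1)[OF e(1)]
  let ?P = "c [^]\<^bsub>C\<^esub> k"
  obtain x where x: "x \<in> negligible p q" "\<delta> (c [^]\<^bsub>C\<^esub> Suc k) = Suc k \<star> (?P \<otimes>\<^bsub>C\<^esub> \<delta> c) \<oplus>\<^bsub>C\<^esub> x"
    using Suc by blast
  define s where "s = \<delta> c \<otimes>\<^bsub>C\<^esub> c \<oplus>\<^bsub>C\<^esub> \<ominus>\<^bsub>C\<^esub> (c \<otimes>\<^bsub>C\<^esub> \<delta> c)"
  have s: "s \<in> negligible p q" unfolding s_def by (rule commutator_negligible[OF pq c e])
  obtain v where v: "v \<in> carrier C" "\<delta> ?P = q \<star> v"
    using \<delta>_pow_divisible[OF c C(2) e(2)] by blast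
  have dc: "\<delta> c \<otimes>\<^bsub>C\<^esub> c = c \<otimes>\<^bsub>C\<^esub> \<delta> c \<oplus>\<^bsub>C\<^esub> s"
    unfolding s_def using C by (intro C.add_minus_cancel_left[symmetric]) simp_all
  have "\<delta> (c [^]\<^bsub>C\<^esub> Suc (Suc k)) = \<delta> (c [^]\<^bsub>C\<^esub> Suc k) \<otimes>\<^bsub>C\<^esub> c \<oplus>\<^bsub>C\<^esub> c [^]\<^bsub>C\<^esub> Suc k \<otimes>\<^bsub>C\<^esub> \<delta> c"
    using C \<delta>_mult[of "c [^]\<^bsub>C\<^esub> Suc k" c] sign_Even[OF pow_Even[OF c, of "Suc k"]] by simp
  also have "\<delta> (c [^]\<^bsub>C\<^esub> Suc k) \<otimes>\<^bsub>C\<^esub> c = Suc k \<star> (?P \<otimes>\<^bsub>C\<^esub> (\<delta> c \<otimes>\<^bsub>C\<^esub> c)) \<oplus>\<^bsub>C\<^esub> x \<otimes>\<^bsub>C\<^esub> c"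
    unfolding x(2) using C negligible_carrier[OF x(1)]
    by (simp add: C.l_distr C.add_pow_ldistr C.m_assoc del: C.add.nat_pow_Suc)
  also have "?P \<otimes>\<^bsub>C\<^esub> (\<delta> c \<otimes>\<^bsub>C\<^esub> c) = c [^]\<^bsub>C\<^esub> Suc k \<otimes>\<^bsub>C\<^esub> \<delta> c \<oplus>\<^bsub>C\<^esub> ?P \<otimes>\<^bsub>C\<^esub> s"
    unfolding dc using C negligible_carrier[OF s] by (simp add: C.r_distr C.m_assoc)
  also have "(Suc k \<star> (c [^]\<^bsub>C\<^esub> Suc k \<otimes>\<^bsub>C\<^esub> \<delta> c \<oplus>\<^bsub>C\<^esub> ?P \<otimes>\<^bsub>C\<^esub> s) \<oplus>\<^bsub>C\<^esub> x \<otimes>\<^bsub>C\<^esub> c) \<oplus>\<^bsub>C\<^esub> c [^]\<^bsub>C\<^esub> Suc k \<otimes>\<^bsub>C\<^esub> \<delta> c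
     = Suc (Suc k) \<star> (c [^]\<^bsub>C\<^esub> Suc k \<otimes>\<^bsub>C\<^esub> \<delta> c) \<oplus>\<^bsub>C\<^esub> (Suc k \<star> (?P \<otimes>\<^bsub>C\<^esub> s) \<oplus>\<^bsub>C\<^esub> x \<otimes>\<^bsub>C\<^esub> c)"
    using C negligible_carrier[OF s] negligible_carrier[OF x(1)]
    by (simp add: C.add.nat_pow_distrib C.a_ac del: C.nat_pow_Suc)
  finally have eq: "\<delta> (c [^]\<^bsub>C\<^esub> Suc (Suc k))
     = Suc (Suc k) \<star> (c [^]\<^bsub>C\<^esub> Suc k \<otimes>\<^bsub>C\<^esub> \<delta> c) \<oplus>\<^bsub>C\<^esub> (Suc k \<star> (?P \<otimes>\<^bsub>C\<^esub> s) \<oplus>\<^bsub>C\<^esub> x \<otimes>\<^bsub>C\<^esub> c)" .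
  have "Suc k \<star> (?P \<otimes>\<^bsub>C\<^esub> s) \<oplus>\<^bsub>C\<^esub> x \<otimes>\<^bsub>C\<^esub> c \<in> negligible p q"
    by (intro negligible_add negligible_nat_scale negligible_mult_right[OF x(1) pq c C(2) e(2)]
        negligible_mult_left[OF s pq pow_Even[OF c] v])
  with eq show ?case by blast
qed

text \<open>
  The multiple \<open>p \<star> (c [^] (p - 1) \<otimes> \<delta> c)\<close> in the derivation rule supplies the additional factor \<open>p\<close>.
\<close>

lemma lift_step:
  assumes pq: "p dvd q" and p: "0 < p" and c: "c \<in> Even" and e: "e \<in> carrier C" "\<delta> c = q \<star> e"
  shows "\<exists>w\<in>Even. \<exists>e'\<in>carrier C. \<delta> (c [^]\<^bsub>C\<^esub> p \<oplus>\<^bsub>C\<^esub> q \<star> w) = (q * p) \<star> e'"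
proof -
  \<comment> \<open>Only the odd part of \<open>e\<close> matters since \<open>\<delta> c\<close> is odd, and \<open>commutator_negligible\<close> needs an odd quotient to
    produce an even correction term.\<close>
  define e0 where "e0 = odd_part e"
  have e0: "e0 \<in> Odd" "\<delta> c = q \<star> e0"
    unfolding e0_def using odd_part_Odd[OF e(1)] odd_divisor[OF \<delta>_Even[OF c] e] by auto
  obtain k where k: "p = Suc k" using p by (cases p) auto
  obtain w v where wv: "\<delta> (c [^]\<^bsub>C\<^esub> p) = p \<star> (c [^]\<^bsub>C\<^esub> k \<otimes>\<^bsub>C\<^esub> \<delta> c) \<oplus>\<^bsub>C\<^esub> (q \<star> \<delta> w \<oplus>\<^bsub>C\<^esub> (q * p) \<star> v)"
     "w \<in> Even" "v \<in> carrier C"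
    using \<delta>_power_mod_negligible[OF pq c e0, of k] unfolding negligible_def k by blast
  note C = EvenD(1)[OF c] EvenD(1)[OF wv(2)] OddD(1)[OF e0(1)]
  have "\<delta> (c [^]\<^bsub>C\<^esub> p \<oplus>\<^bsub>C\<^esub> q \<star> (\<ominus>\<^bsub>C\<^esub> w)) = \<delta> (c [^]\<^bsub>C\<^esub> p) \<oplus>\<^bsub>C\<^esub> \<ominus>\<^bsub>C\<^esub> (q \<star> \<delta> w)"
    using C by (simp add: \<delta>_add \<delta>_scale \<delta>_neg C.add_pow_neg)
  also have "\<dots> = p \<star> (c [^]\<^bsub>C\<^esub> k \<otimes>\<^bsub>C\<^esub> \<delta> c) \<oplus>\<^bsub>C\<^esub> (q * p) \<star> v"
    unfolding wv(1) using C wv(3) by (simp add: C.a_ac C.r_neg C.r_neg1 C.r_neg2)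
  also have "p \<star> (c [^]\<^bsub>C\<^esub> k \<otimes>\<^bsub>C\<^esub> \<delta> c) = (q * p) \<star> (c [^]\<^bsub>C\<^esub> k \<otimes>\<^bsub>C\<^esub> e0)"
    unfolding e0(2) using C by (simp add: C.add_pow_rdistr scale_scale mult.commute)
  also have "(q * p) \<star> (c [^]\<^bsub>C\<^esub> k \<otimes>\<^bsub>C\<^esub> e0) \<oplus>\<^bsub>C\<^esub> (q * p) \<star> v = (q * p) \<star> (c [^]\<^bsub>C\<^esub> k \<otimes>\<^bsub>C\<^esub> e0 \<oplus>\<^bsub>C\<^esub> v)"
    using C wv(3) by (simp add: C.add.nat_pow_distrib)
  finally show ?thesis
    using C wv(2,3) by (intro bexI[of _ "\<ominus>\<^bsub>C\<^esub> w"] bexI[of _ "c [^]\<^bsub>C\<^esub> k \<otimes>\<^bsub>C\<^esub> e0 \<oplus>\<^bsub>C\<^esub> v"]) (simp_all add: neg_Even)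
qed

lemma pow_cong_mod:
  assumes "a \<in> carrier C" "b \<in> carrier C"
  shows "\<exists>v\<in>carrier C. (a \<oplus>\<^bsub>C\<^esub> p \<star> b) [^]\<^bsub>C\<^esub> (k::nat) = a [^]\<^bsub>C\<^esub> k \<oplus>\<^bsub>C\<^esub> p \<star> v"
proof (induction k)
  case 0
  then show ?case using C.zero_closed by (intro bexI[of _ "\<zero>\<^bsub>C\<^esub>"]) simp_all
next
  case (Suc k)
  then obtain v where v: "v \<in> carrier C" "(a \<oplus>\<^bsub>C\<^esub> p \<star> b) [^]\<^bsub>C\<^esub> k = a [^]\<^bsub>C\<^esub> k \<oplus>\<^bsub>C\<^esub> p \<star> v" by blast
  have "(a \<oplus>\<^bsub>C\<^esub> p \<star> b) [^]\<^bsub>C\<^esub> Suc k = a [^]\<^bsub>C\<^esub> Suc k \<oplus>\<^bsub>C\<^esub> p \<star> (a [^]\<^bsub>C\<^esub> k \<otimes>\<^bsub>C\<^esub> b \<oplus>\<^bsub>C\<^esub> (v \<otimes>\<^bsub>C\<^esub> a \<oplus>\<^bsub>C\<^esub> v \<otimes>\<^bsub>C\<^esub> (p \<star> b)))"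
    using assms v by (simp add: C.l_distr C.r_distr C.add_pow_ldistr C.add_pow_rdistr C.add.nat_pow_distrib C.a_ac)
  then show ?case using assms v(1)
    by (intro bexI[of _ "a [^]\<^bsub>C\<^esub> k \<otimes>\<^bsub>C\<^esub> b \<oplus>\<^bsub>C\<^esub> (v \<otimes>\<^bsub>C\<^esub> a \<oplus>\<^bsub>C\<^esub> v \<otimes>\<^bsub>C\<^esub> (p \<star> b))"]) simp_all
qed

lemma lift_high:
  assumes p: "0 < p" and c: "c \<in> Even" and e: "e \<in> carrier C" "\<delta> c = p \<star> e"
  shows "\<exists>c'\<in>Even. \<exists>e'\<in>carrier C. \<exists>w\<in>carrier C.
     \<delta> c' = p ^ Suc n \<star> e' \<and> c' = c [^]\<^bsub>C\<^esub> (p ^ n) \<oplus>\<^bsub>C\<^esub> p \<star> w"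
proof (induction n)
  case 0
  show ?case using c e EvenD(1)[OF c] C.zero_closed
    by (intro bexI[of _ c] bexI[of _ e] bexI[of _ "\<zero>\<^bsub>C\<^esub>"]) simp_all
next
  case (Suc n)
  then obtain c' e' w where *: "c' \<in> Even" "e' \<in> carrier C" "w \<in> carrier C"
    "\<delta> c' = p ^ Suc n \<star> e'" "c' = c [^]\<^bsub>C\<^esub> (p ^ n) \<oplus>\<^bsub>C\<^esub> p \<star> w" by blast
  have cC: "c \<in> carrier C" using c by (rule EvenD)
  obtain w' e'' where w': "w' \<in> Even" "e'' \<in> carrier C"
    "\<delta> (c' [^]\<^bsub>C\<^esub> p \<oplus>\<^bsub>C\<^esub> p ^ Suc n \<star> w') = (p ^ Suc n * p) \<star> e''"
    using lift_step[OF _ p *(1,2,4)] by (auto simp: dvd_def)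
  obtain v where v: "v \<in> carrier C" "c' [^]\<^bsub>C\<^esub> p = (c [^]\<^bsub>C\<^esub> (p ^ n)) [^]\<^bsub>C\<^esub> p \<oplus>\<^bsub>C\<^esub> p \<star> v"
    unfolding *(5) using pow_cong_mod[of "c [^]\<^bsub>C\<^esub> (p ^ n)" w p p] *(3) cC by auto
  have "c' [^]\<^bsub>C\<^esub> p \<oplus>\<^bsub>C\<^esub> p ^ Suc n \<star> w' = c [^]\<^bsub>C\<^esub> (p ^ Suc n) \<oplus>\<^bsub>C\<^esub> p \<star> (v \<oplus>\<^bsub>C\<^esub> p ^ n \<star> w')"
    unfolding v(2) using cC v(1) EvenD(1)[OF w'(1)]
    by (simp add: C.nat_pow_pow C.add.nat_pow_distrib scale_scale C.a_assoc mult.commute)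
  moreover have "p ^ Suc n * p = p ^ Suc (Suc n)" by simp
  moreover have "c' [^]\<^bsub>C\<^esub> p \<oplus>\<^bsub>C\<^esub> p ^ Suc n \<star> w' \<in> Even"
    using *(1) w'(1) by (intro add_Even pow_Even scale_Even)
  moreover have "v \<oplus>\<^bsub>C\<^esub> p ^ n \<star> w' \<in> carrier C"
    using v(1) EvenD(1)[OF w'(1)] by simp
  ultimately show ?case using w'(2,3) by metis
qed

lemma scale_cancel_torsion:
  assumes tors: "\<And>n r. r \<in> carrier A \<Longrightarrow> add_pow A (p ^ n :: nat) r = \<zero> \<Longrightarrow> add_pow A (p ^ k :: nat) r = \<zero>"
    and x: "x \<in> carrier C" "p ^ n \<star> x = \<zero>\<^bsub>C\<^esub>"
  shows "p ^ k \<star> x = \<zero>\<^bsub>C\<^esub>"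
proof
  fix l
  have "add_pow A (p ^ n) (x l) = \<zero>" using fun_cong[OF x(2), of l] x(1) by (simp add: scale_apply zero_C)
  then have "add_pow A (p ^ k) (x l) = \<zero>" using tors carrier_closed[OF x(1)] by blast
  then show "(p ^ k \<star> x) l = \<zero>\<^bsub>C\<^esub> l" using x(1) by (simp add: scale_apply zero_C)
qed

text \<open>
  Taking \<open>p\<close>-th powers makes the coboundary divisible by a power of \<open>p\<close> that is large enough to absorb both
  the torsion of \<open>A\<close> and the \<open>p\<close>-part of the order of \<open>G\<close>; then it is \<open>p\<close> times a coboundary, up to a factor
  prime to \<open>p\<close>.
\<close>

lemma power_lifts_to_cocycle:
  assumes fin: "finite (carrier G)" and p: "Factorial_Ring.prime p"
    and tors: "\<And>n r. r \<in> carrier A \<Longrightarrow> add_pow A (p ^ n :: nat) r = \<zero> \<Longrightarrow> add_pow A (p ^ k :: nat) r = \<zero>"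
    and c: "c \<in> Even" and e: "e \<in> carrier C" "\<delta> c = p \<star> e"
  shows "\<exists>n. \<exists>w\<in>carrier C. \<delta> (c [^]\<^bsub>C\<^esub> (p ^ n) \<oplus>\<^bsub>C\<^esub> p \<star> w) = \<zero>\<^bsub>C\<^esub>"
proof -
  define g where "g = card (carrier G)"
  have "g \<noteq> 0" unfolding g_def using fin G.one_closed by (auto simp: card_eq_0_iff)
  moreover have "\<not> is_unit p" using prime_gt_1_nat[OF p] by simp
  ultimately obtain m v where m: "g = p ^ v * m" "\<not> p dvd m"
    by (rule multiplicity_decompose'[of g p]) (auto simp: mult.commute)
  have p0: "0 < p" using p by (simp add: prime_gt_0_nat)
  have cC: "c \<in> carrier C" using c by (rule EvenD)
  \<comment> \<open>The exponent \<open>Suc n\<close> reached below pays for the torsion (\<open>k\<close>), for the order of \<open>G\<close> (\<open>v\<close>) and for one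
    remaining factor \<open>p\<close>.\<close>
  define n where "n = k + v"
  obtain c' e' w where *: "c' \<in> Even" "e' \<in> carrier C" "w \<in> carrier C"
    "\<delta> c' = p ^ Suc n \<star> e'" "c' = c [^]\<^bsub>C\<^esub> (p ^ n) \<oplus>\<^bsub>C\<^esub> p \<star> w"
    using lift_high[OF p0 c e, of n] by blast
  define e0 where "e0 = p ^ k \<star> odd_part e'"
  have e1: "odd_part e' \<in> Odd" "\<delta> c' = p ^ Suc n \<star> odd_part e'"
    using odd_part_Odd[OF *(2)] odd_divisor[OF \<delta>_Even[OF *(1)] *(2,4)] by auto
  note C = EvenD(1)[OF *(1)] OddD(1)[OF e1(1)]
  have "p ^ Suc n \<star> \<delta> (odd_part e') = \<zero>\<^bsub>C\<^esub>"
    using \<delta>_\<delta>[OF C(1)] C unfolding e1(2) by (simp add: \<delta>_scale)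
  then have "p ^ k \<star> \<delta> (odd_part e') = \<zero>\<^bsub>C\<^esub>"
    by (rule scale_cancel_torsion[where n = "Suc n", rotated 2]) (use C in \<open>auto intro: tors\<close>)
  then have "\<delta> e0 = \<zero>\<^bsub>C\<^esub>" using C by (simp add: e0_def \<delta>_scale)
  moreover have e0: "e0 \<in> Odd"
    using e1(1) C unfolding Odd_def e0_def by (auto simp: scale_apply)
  ultimately obtain f where f: "f \<in> carrier C" "g \<star> e0 = \<delta> f"
    unfolding g_def using order_kills_odd[OF fin] by blast
  have "coprime m p" using m(2) p by (metis coprime_commute prime_imp_coprime)
  then obtain m' s where ms: "m * m' = p * s + 1"
    using bezout_nat[of m p] m p0 \<open>g \<noteq> 0\<close> by (auto simp: coprime_iff_gcd_eq_1)
  \<comment> \<open>A cocycle congruent to \<open>m \<star> c'\<close>; multiplying it by an inverse \<open>m'\<close> of \<open>m\<close> modulo \<open>p\<close> gives one congruent to \<open>c'\<close>.\<close>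
  define z where "z = m \<star> c' \<oplus>\<^bsub>C\<^esub> \<ominus>\<^bsub>C\<^esub> (p \<star> f)"
  have z: "z \<in> carrier C" unfolding z_def using C f by simp
  have "m \<star> p ^ Suc n \<star> odd_part e' = p \<star> g \<star> e0"
    using C unfolding e0_def by (simp add: scale_scale m n_def power_add mult_ac)
  then have "m \<star> \<delta> c' = p \<star> \<delta> f" unfolding e1(2) f(2) .
  moreover have "\<delta> z = m \<star> \<delta> c' \<oplus>\<^bsub>C\<^esub> \<ominus>\<^bsub>C\<^esub> (p \<star> \<delta> f)"
    unfolding z_def using C f(1) by (simp add: \<delta>_add \<delta>_neg \<delta>_scale)
  ultimately have "\<delta> z = \<zero>\<^bsub>C\<^esub>" using f(1) by (simp add: C.r_neg)
  then have "\<delta> (m' \<star> z) = \<zero>\<^bsub>C\<^esub>" using z by (simp add: \<delta>_scale)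
  moreover have "m' \<star> z = c' \<oplus>\<^bsub>C\<^esub> p \<star> (s \<star> c' \<oplus>\<^bsub>C\<^esub> \<ominus>\<^bsub>C\<^esub> (m' \<star> f))"
  proof -
    have "m' \<star> z = (m * m') \<star> c' \<oplus>\<^bsub>C\<^esub> \<ominus>\<^bsub>C\<^esub> ((p * m') \<star> f)"
      unfolding z_def using C f by (simp add: C.add.nat_pow_distrib scale_scale mult_ac C.add_pow_neg)
    also have "(m * m') \<star> c' = c' \<oplus>\<^bsub>C\<^esub> p \<star> s \<star> c'"
      unfolding ms using C by (simp add: scale_scale C.a_comm)
    finally show ?thesis
      using C f by (simp add: C.add.nat_pow_distrib scale_scale C.add_pow_neg C.a_assoc)
  qed
  also have "\<dots> = c [^]\<^bsub>C\<^esub> (p ^ n) \<oplus>\<^bsub>C\<^esub> p \<star> (w \<oplus>\<^bsub>C\<^esub> (s \<star> c' \<oplus>\<^bsub>C\<^esub> \<ominus>\<^bsub>C\<^esub> (m' \<star> f)))"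
    unfolding *(5) using cC *(3) C f by (simp add: C.add.nat_pow_distrib C.a_assoc)
  ultimately show ?thesis
    using *(3) C f by (intro exI[of _ n] bexI[of _ "w \<oplus>\<^bsub>C\<^esub> (s \<star> c' \<oplus>\<^bsub>C\<^esub> \<ominus>\<^bsub>C\<^esub> (m' \<star> f))"]) simp_all
qed

end

section \<open>Maps out of quotient rings\<close>

text \<open>
  Both \<open>cohomology_map\<close> and \<open>tensor_lift\<close> are defined by the unique value of a function on a coset; this
  and \<open>quotient_lift_hom\<close> are the common reason that they are well defined and multiplicative.
\<close>

lemma the_elem_coset:
  assumes I: "ideal I S" and T: "ring T" and h: "h \<in> ring_hom S T"
    and kill: "\<And>i. i \<in> I \<Longrightarrow> h i = \<zero>\<^bsub>T\<^esub>" and x: "x \<in> carrier S"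
  shows "the_elem (h ` (I +>\<^bsub>S\<^esub> x)) = h x"
proof -
  interpret I: ideal I S by fact
  interpret T: ring T by fact
  have "h (i \<oplus>\<^bsub>S\<^esub> x) = h x" if "i \<in> I" for i
    using that x I.Icarr[OF that] kill h by (simp add: ring_hom_add ring_hom_closed)
  then have "h ` (I +>\<^bsub>S\<^esub> x) \<subseteq> {h x}"
    unfolding a_r_coset_def' by auto
  moreover have "x \<in> I +>\<^bsub>S\<^esub> x" using x by (rule I.a_rcos_self)
  ultimately have "h ` (I +>\<^bsub>S\<^esub> x) = {h x}" by blast
  then show ?thesis by simp
qed

lemma quotient_carrierE:
  assumes "ideal I S" "Y \<in> carrier (S Quot I)"
  obtains x where "x \<in> carrier S" "Y = I +>\<^bsub>S\<^esub> x"
  using assms(2) unfolding FactRing_def A_RCOSETS_def' by auto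

lemma quotient_lift_hom:
  assumes I: "ideal I S" and T: "ring T" and h: "h \<in> ring_hom S T"
    and kill: "\<And>i. i \<in> I \<Longrightarrow> h i = \<zero>\<^bsub>T\<^esub>"
  shows "ring_hom_ring (S Quot I) T (\<lambda>Y. the_elem (h ` Y))"
proof -
  interpret I: ideal I S by fact
  note q = ring_hom_closed[OF I.rcos_ring_hom] ring_hom_add[OF I.rcos_ring_hom, symmetric]
    ring_hom_mult[OF I.rcos_ring_hom, symmetric]
  note [simp] = the_elem_coset[OF I T h kill]
  show ?thesis
  proof (rule ring_hom_ringI2[OF I.quotient_is_ring T], rule ring_hom_memI)
    fix Y assume "Y \<in> carrier (S Quot I)"
    then show "the_elem (h ` Y) \<in> carrier T"
      by (rule quotient_carrierE[OF I]) (simp add: ring_hom_closed[OF h])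
  next
    fix Y Y' assume "Y \<in> carrier (S Quot I)" "Y' \<in> carrier (S Quot I)"
    then obtain x x' where *: "x \<in> carrier S" "Y = I +>\<^bsub>S\<^esub> x" "x' \<in> carrier S" "Y' = I +>\<^bsub>S\<^esub> x'"
      by (metis quotient_carrierE[OF I])
    then show "the_elem (h ` (Y \<otimes>\<^bsub>S Quot I\<^esub> Y')) = the_elem (h ` Y) \<otimes>\<^bsub>T\<^esub> the_elem (h ` Y')"
      and "the_elem (h ` (Y \<oplus>\<^bsub>S Quot I\<^esub> Y')) = the_elem (h ` Y) \<oplus>\<^bsub>T\<^esub> the_elem (h ` Y')"
      by (simp_all add: q ring_hom_mult[OF h] ring_hom_add[OF h])
  next
    show "the_elem (h ` \<one>\<^bsub>S Quot I\<^esub>) = \<one>\<^bsub>T\<^esub>"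
      by (simp add: ring_hom_one[OF I.rcos_ring_hom, symmetric] ring_hom_one[OF h])
  qed
qed

section \<open>Monoid rings\<close>

lemma frag_extend_add_fun:
  "frag_extend (\<lambda>x. f x + g x) c = frag_extend f c + frag_extend g c"
  using subset_UNIV[of "Poly_Mapping.keys c"]
  by (induction c rule: frag_induction) (auto simp: frag_extend_diff)

lemma frag_extend_diff_fun:
  "frag_extend (\<lambda>x. f x - g x) c = frag_extend f c - frag_extend g c"
  using subset_UNIV[of "Poly_Mapping.keys c"]
  by (induction c rule: frag_induction) (auto simp: frag_extend_diff)

lemma frag_extend_zero_fun: "frag_extend (\<lambda>x. 0) c = 0"
  using subset_UNIV[of "Poly_Mapping.keys c"]
  by (induction c rule: frag_induction) (auto simp: frag_extend_diff)

lemma monoid_ring_simps: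
  "x \<oplus>\<^bsub>monoid_ring M\<^esub> y = x + y" "\<zero>\<^bsub>monoid_ring M\<^esub> = 0"
  "\<one>\<^bsub>monoid_ring M\<^esub> = frag_of \<one>\<^bsub>M\<^esub>"
  "x \<in> carrier (monoid_ring M) \<longleftrightarrow> Poly_Mapping.keys x \<subseteq> carrier M"
  by (simp_all add: monoid_ring_def)

lemma monoid_ring_mult:
  "frag_of x \<otimes>\<^bsub>monoid_ring M\<^esub> frag_of y = frag_of (x \<otimes>\<^bsub>M\<^esub> y)"
  "(a + b) \<otimes>\<^bsub>monoid_ring M\<^esub> c = a \<otimes>\<^bsub>monoid_ring M\<^esub> c + b \<otimes>\<^bsub>monoid_ring M\<^esub> c"
  "(a - b) \<otimes>\<^bsub>monoid_ring M\<^esub> c = a \<otimes>\<^bsub>monoid_ring M\<^esub> c - b \<otimes>\<^bsub>monoid_ring M\<^esub> c"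
  "c \<otimes>\<^bsub>monoid_ring M\<^esub> (a + b) = c \<otimes>\<^bsub>monoid_ring M\<^esub> a + c \<otimes>\<^bsub>monoid_ring M\<^esub> b"
  "c \<otimes>\<^bsub>monoid_ring M\<^esub> (a - b) = c \<otimes>\<^bsub>monoid_ring M\<^esub> a - c \<otimes>\<^bsub>monoid_ring M\<^esub> b"
  "0 \<otimes>\<^bsub>monoid_ring M\<^esub> c = 0" "c \<otimes>\<^bsub>monoid_ring M\<^esub> 0 = 0"
  by (simp_all add: monoid_ring_def frag_extend_add frag_extend_diff frag_extend_add_fun
      frag_extend_diff_fun frag_extend_zero_fun)

lemma keys_diff_subset: "Poly_Mapping.keys x \<subseteq> S \<Longrightarrow> Poly_Mapping.keys y \<subseteq> S \<Longrightarrow> Poly_Mapping.keys (x - y) \<subseteq> S"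
  for x y :: "'a \<Rightarrow>\<^sub>0 int"
  using keys_diff[of x y] by blast

lemma monoid_ring_induct [consumes 1, case_names zero diff of]:
  assumes "x \<in> carrier (monoid_ring M)" "P 0"
    "\<And>x y. x \<in> carrier (monoid_ring M) \<Longrightarrow> y \<in> carrier (monoid_ring M) \<Longrightarrow> P x \<Longrightarrow> P y \<Longrightarrow> P (x - y)"
    "\<And>a. a \<in> carrier M \<Longrightarrow> P (frag_of a)"
  shows "P x"
  using assms unfolding monoid_ring_simps by (rule free_Abelian_group_induct)

lemma monoid_ring_of_closed: "a \<in> carrier M \<Longrightarrow> frag_of a \<in> carrier (monoid_ring M)"
  by (simp add: monoid_ring_simps)

lemma monoid_ring_diff_closed:
  "x \<in> carrier (monoid_ring M) \<Longrightarrow> y \<in> carrier (monoid_ring M) \<Longrightarrow> x - y \<in> carrier (monoid_ring M)"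
  by (simp add: monoid_ring_simps keys_diff_subset)

lemma ring_monoid_ring:
  assumes "Group.monoid M"
  shows "ring (monoid_ring M)"
proof -
  interpret Group.monoid M by fact
  let ?R = "monoid_ring M"
  have neg: "- x \<in> carrier ?R" if "x \<in> carrier ?R" for x
    using that by (simp add: monoid_ring_simps)
  have add: "x + y \<in> carrier ?R" if "x \<in> carrier ?R" "y \<in> carrier ?R" for x y
    using monoid_ring_diff_closed[OF that(1) neg[OF that(2)]] by simp
  have mult: "x \<otimes>\<^bsub>?R\<^esub> y \<in> carrier ?R" if x: "x \<in> carrier ?R" and y: "y \<in> carrier ?R" for x y
    using x
  proof (induction x rule: monoid_ring_induct)
    case (of a)
    show ?case using y
      by (induction y rule: monoid_ring_induct)
         (use of in \<open>simp_all add: monoid_ring_mult monoid_ring_of_closed monoid_ring_diff_closed monoid_ring_simps(4)[of 0]\<close>)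
  qed (simp_all add: monoid_ring_mult monoid_ring_diff_closed monoid_ring_simps(4)[of 0])
  have assoc: "x \<otimes>\<^bsub>?R\<^esub> y \<otimes>\<^bsub>?R\<^esub> z = x \<otimes>\<^bsub>?R\<^esub> (y \<otimes>\<^bsub>?R\<^esub> z)"
    if x: "x \<in> carrier ?R" and y: "y \<in> carrier ?R" and z: "z \<in> carrier ?R" for x y z
    using x
  proof (induction x rule: monoid_ring_induct)
    case a: (of a)
    show ?case using y
    proof (induction y rule: monoid_ring_induct)
      case b: (of b)
      show ?case using z
        by (induction z rule: monoid_ring_induct) (use a b in \<open>simp_all add: monoid_ring_mult m_assoc\<close>)
    qed (simp_all add: monoid_ring_mult)
  qed (simp_all add: monoid_ring_mult)
  show ?thesis
  proof (rule ringI)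
    show "abelian_group ?R"
    proof (rule abelian_groupI)
      show "\<exists>y\<in>carrier ?R. y \<oplus>\<^bsub>?R\<^esub> x = \<zero>\<^bsub>?R\<^esub>" if "x \<in> carrier ?R" for x
        using neg[OF that] by (intro bexI[of _ "- x"]) (simp_all add: monoid_ring_simps)
    qed (simp_all add: monoid_ring_simps(1,2) add, simp_all add: monoid_ring_simps)
    show "Group.monoid ?R"
    proof (rule monoidI)
      show "\<one>\<^bsub>?R\<^esub> \<in> carrier ?R" by (simp add: monoid_ring_simps)
      show "\<one>\<^bsub>?R\<^esub> \<otimes>\<^bsub>?R\<^esub> x = x" if "x \<in> carrier ?R" for x
        using that by (induction x rule: monoid_ring_induct) (simp_all add: monoid_ring_simps(3) monoid_ring_mult)
      show "x \<otimes>\<^bsub>?R\<^esub> \<one>\<^bsub>?R\<^esub> = x" if "x \<in> carrier ?R" for x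
        using that by (induction x rule: monoid_ring_induct) (simp_all add: monoid_ring_simps(3) monoid_ring_mult)
    qed (simp_all add: mult assoc)
  qed (simp_all add: monoid_ring_simps(1) monoid_ring_mult)
qed

text \<open>
  The supports of \<open>c\<close>, \<open>e\<close> and \<open>c + e\<close> may differ because of cancellation, so the three sums are compared over the
  union of the first two supports.
\<close>

lemma (in abelian_group) int_combination_add:
  assumes k: "\<And>z. z \<in> S \<Longrightarrow> k z \<in> carrier G"
    and c: "Poly_Mapping.keys c \<subseteq> S" and e: "Poly_Mapping.keys e \<subseteq> S"
  shows "(\<Oplus>z\<in>Poly_Mapping.keys (c + e). add_pow G (Poly_Mapping.lookup (c + e) z :: int) (k z))
    = (\<Oplus>z\<in>Poly_Mapping.keys c. add_pow G (Poly_Mapping.lookup c z) (k z))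
     \<oplus> (\<Oplus>z\<in>Poly_Mapping.keys e. add_pow G (Poly_Mapping.lookup e z) (k z))"
proof -
  let ?F = "Poly_Mapping.keys c \<union> Poly_Mapping.keys e"
  have cl: "add_pow G (n :: int) (k z) \<in> carrier G" if "z \<in> S" for n z
    using k[OF that] by (simp add: add_pow_def group.int_pow_closed[OF a_group, simplified])
  have ext: "(\<Oplus>z\<in>Poly_Mapping.keys b. add_pow G (Poly_Mapping.lookup b z) (k z))
     = (\<Oplus>z\<in>?F. add_pow G (Poly_Mapping.lookup b z) (k z))" if "Poly_Mapping.keys b \<subseteq> ?F" for b :: "_ \<Rightarrow>\<^sub>0 int"
  proof -
    have "add_pow G (Poly_Mapping.lookup b i) (k i) = \<zero>" if "i \<notin> Poly_Mapping.keys b" for i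
      using that by (simp add: in_keys_iff add_pow_def)
    then show ?thesis
      using that c e cl by (intro add.finprod_mono_neutral_cong_left) auto
  qed
  have "add_pow G (Poly_Mapping.lookup (c + e) z) (k z)
    = add_pow G (Poly_Mapping.lookup c z) (k z) \<oplus> add_pow G (Poly_Mapping.lookup e z) (k z)" if "z \<in> S" for z
    using k[OF that] group.int_pow_mult[OF a_group, of "k z"] by (simp add: add_pow_def lookup_add)
  then have "(\<Oplus>z\<in>?F. add_pow G (Poly_Mapping.lookup (c + e) z) (k z))
    = (\<Oplus>z\<in>?F. add_pow G (Poly_Mapping.lookup c z) (k z) \<oplus> add_pow G (Poly_Mapping.lookup e z) (k z))"
    using c e cl by (intro finsum_cong') auto
  also have "\<dots> = (\<Oplus>z\<in>?F. add_pow G (Poly_Mapping.lookup c z) (k z)) \<oplus> (\<Oplus>z\<in>?F. add_pow G (Poly_Mapping.lookup e z) (k z))"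
    using c e cl by (intro finsum_addf) auto
  finally show ?thesis
    using ext[of "c + e"] ext[of c] ext[of e] keys_add[of c e] by simp
qed

lemma monoid_ring_eval_hom:
  assumes M: "Group.monoid M" and T: "ring T"
    and k: "\<And>z. z \<in> carrier M \<Longrightarrow> k z \<in> carrier T"
    and one: "k \<one>\<^bsub>M\<^esub> = \<one>\<^bsub>T\<^esub>"
    and mult: "\<And>x y. x \<in> carrier M \<Longrightarrow> y \<in> carrier M \<Longrightarrow> k (x \<otimes>\<^bsub>M\<^esub> y) = k x \<otimes>\<^bsub>T\<^esub> k y"
  defines "E \<equiv> \<lambda>c. \<Oplus>\<^bsub>T\<^esub>z\<in>Poly_Mapping.keys c. add_pow T (Poly_Mapping.lookup c z :: int) (k z)"
  shows "E \<in> ring_hom (monoid_ring M) T" "\<And>z. z \<in> carrier M \<Longrightarrow> E (frag_of z) = k z"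
    "\<And>x y. x \<in> carrier (monoid_ring M) \<Longrightarrow> y \<in> carrier (monoid_ring M) \<Longrightarrow> E (x - y) = E x \<ominus>\<^bsub>T\<^esub> E y"
proof -
  interpret M: Group.monoid M by fact
  interpret T: ring T by fact
  interpret R: ring "monoid_ring M" by (rule ring_monoid_ring[OF M])
  let ?R = "monoid_ring M"
  have cl: "add_pow T (n :: int) (k z) \<in> carrier T" if "z \<in> carrier M" for n z
    using k[OF that] by (simp add: add_pow_def group.int_pow_closed[OF T.a_group, simplified])
  have E_closed: "E c \<in> carrier T" if "c \<in> carrier ?R" for c
    unfolding E_def using that cl by (intro T.finsum_closed) (auto simp: monoid_ring_simps)
  have E_add: "E (x + y) = E x \<oplus>\<^bsub>T\<^esub> E y" if "x \<in> carrier ?R" "y \<in> carrier ?R" for x y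
    unfolding E_def using that k by (intro T.int_combination_add[of "carrier M"]) (auto simp: monoid_ring_simps)
  have E_zero: "E 0 = \<zero>\<^bsub>T\<^esub>" by (simp add: E_def)
  show E_of: "E (frag_of z) = k z" if "z \<in> carrier M" for z
    using k[OF that] group.int_pow_1[OF T.a_group, of "k z"] unfolding E_def by (simp add: keys_frag_of add_pow_def)
  show E_diff: "E (x - y) = E x \<ominus>\<^bsub>T\<^esub> E y" if "x \<in> carrier ?R" "y \<in> carrier ?R" for x y
  proof -
    have "E x = E (x - y) \<oplus>\<^bsub>T\<^esub> E y"
      using E_add[OF monoid_ring_diff_closed[OF that] that(2)] by simp
    then show ?thesis using E_closed that monoid_ring_diff_closed[OF that]
      by (simp add: a_minus_def T.a_assoc T.r_neg)
  qed
  show "E \<in> ring_hom ?R T"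
  proof (rule ring_hom_memI)
    show "E (x \<otimes>\<^bsub>?R\<^esub> y) = E x \<otimes>\<^bsub>T\<^esub> E y" if x: "x \<in> carrier ?R" and y: "y \<in> carrier ?R" for x y
      using x
    proof (induction x rule: monoid_ring_induct)
      case zero
      then show ?case using E_closed[OF y] by (simp add: monoid_ring_mult E_zero)
    next
      case (diff x x')
      then show ?case using E_closed y R.m_closed
        by (simp add: monoid_ring_mult E_diff a_minus_def T.l_distr T.l_minus)
    next
      case a: (of a)
      show ?case using y
      proof (induction y rule: monoid_ring_induct)
        case zero
        then show ?case using k[OF a] by (simp add: monoid_ring_mult E_zero E_of[OF a])
      next
        case (diff x x')
        then show ?case using E_closed R.m_closed monoid_ring_of_closed[OF a]
          by (simp add: monoid_ring_mult E_diff a_minus_def T.r_distr T.r_minus)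
      next
        case (of b)
        then show ?case using a by (simp add: monoid_ring_mult E_of mult)
      qed
    qed
  qed (simp_all add: E_closed monoid_ring_simps(1,3) E_add E_of one)
qed

section \<open>Tensor products\<close>

locale tensor_product =
  R: cring R + A: ring A + B: ring B
  for R :: "('r, 'k) ring_scheme" and A :: "('a, 'm) ring_scheme" and B :: "('b, 'n) ring_scheme" +
  fixes \<phi> :: "'r \<Rightarrow> 'a" and \<psi> :: "'r \<Rightarrow> 'b"
  assumes \<phi>: "\<And>r. r \<in> carrier R \<Longrightarrow> \<phi> r \<in> carrier A" and \<psi>: "\<And>r. r \<in> carrier R \<Longrightarrow> \<psi> r \<in> carrier B"
    and \<phi>_central: "\<And>r a. r \<in> carrier R \<Longrightarrow> a \<in> carrier A \<Longrightarrow> \<phi> r \<otimes>\<^bsub>A\<^esub> a = a \<otimes>\<^bsub>A\<^esub> \<phi> r"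
    and \<psi>_central: "\<And>r b. r \<in> carrier R \<Longrightarrow> b \<in> carrier B \<Longrightarrow> \<psi> r \<otimes>\<^bsub>B\<^esub> b = b \<otimes>\<^bsub>B\<^esub> \<psi> r"
begin

abbreviation "F \<equiv> monoid_ring (A \<times>\<times> B)"
abbreviation "rel \<equiv> tensor_relations R A B \<phi> \<psi>"
definition "N = generate (add_monoid F) rel"
abbreviation "S \<equiv> tensor_algebra R A B \<phi> \<psi>"

lemma monoid_AB: "Group.monoid (A \<times>\<times> B)"
  by (rule DirProd_monoid) (rule A.monoid_axioms B.monoid_axioms)+

sublocale F: ring F by (rule ring_monoid_ring[OF monoid_AB])

lemma of_closed: "a \<in> carrier A \<Longrightarrow> b \<in> carrier B \<Longrightarrow> frag_of (a, b) \<in> carrier F"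
  by (rule monoid_ring_of_closed) simp

lemma F_minus: "x \<in> carrier F \<Longrightarrow> y \<in> carrier F \<Longrightarrow> x \<ominus>\<^bsub>F\<^esub> y = x - y"
proof -
  assume *: "x \<in> carrier F" "y \<in> carrier F"
  have "\<ominus>\<^bsub>F\<^esub> y = - y"
    by (rule F.minus_equality) (use * in \<open>simp_all add: monoid_ring_simps\<close>)
  then show ?thesis by (simp add: a_minus_def monoid_ring_simps)
qed

lemma rel_carrier: "rel \<subseteq> carrier F"
  unfolding tensor_relations_def
  by (auto intro!: monoid_ring_diff_closed of_closed simp: \<phi> \<psi>)

lemma N_incl: "x \<in> rel \<Longrightarrow> x \<in> N"
  unfolding N_def by (rule generate.incl)

lemma N_subgroup: "subgroup N (add_monoid F)"
  unfolding N_def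
  using F.add.generate_is_subgroup rel_carrier by simp

lemma N_carrier: "x \<in> N \<Longrightarrow> x \<in> carrier F"
  using subgroup.mem_carrier[OF N_subgroup] by simp

lemma N_diff: "x \<in> N \<Longrightarrow> y \<in> N \<Longrightarrow> x - y \<in> N"
proof -
  assume *: "x \<in> N" "y \<in> N"
  have "inv\<^bsub>add_monoid F\<^esub> y \<in> N" using subgroup.m_inv_closed[OF N_subgroup *(2)] .
  then have "x \<ominus>\<^bsub>F\<^esub> y \<in> N"
    using subgroup.m_closed[OF N_subgroup *(1)] by (simp add: a_minus_def a_inv_def)
  then show ?thesis using * N_carrier by (simp add: F_minus)
qed

lemma N_zero: "0 \<in> N"
  using subgroup.one_closed[OF N_subgroup] by (simp add: monoid_ring_simps)

lemma N_induct [consumes 1]: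
  assumes "h \<in> N" "P 0" "\<And>x y. x \<in> N \<Longrightarrow> y \<in> N \<Longrightarrow> P x \<Longrightarrow> P y \<Longrightarrow> P (x - y)" "\<And>x. x \<in> rel \<Longrightarrow> P x"
  shows "P h"
  using assms(1) unfolding N_def
proof (induction h rule: generate.induct)
  case one
  then show ?case using assms(2) by (simp add: monoid_ring_simps)
next
  case (incl h)
  then show ?case by (rule assms(4))
next
  case (inv h)
  have h: "h \<in> N" using inv by (rule N_incl)
  have "P (0 - h)" by (rule assms(3)[OF N_zero h assms(2) assms(4)[OF inv]])
  moreover have "inv\<^bsub>add_monoid F\<^esub> h = 0 - h"
    using F_minus[of 0 h] N_carrier[OF h] F.zero_closed F.a_inv_closed
    by (simp add: monoid_ring_simps(1,2) a_minus_def a_inv_def)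
  ultimately show ?case by simp
next
  case (eng x y)
  have xy: "x \<in> N" "y \<in> N" using eng by (simp_all add: N_def)
  have "P (0 - y)" by (rule assms(3)[OF N_zero xy(2) assms(2) eng(4)])
  then have "P (x - (0 - y))" by (rule assms(3)[OF xy(1) N_diff[OF N_zero xy(2)] eng(3)])
  then show ?case by (simp add: monoid_ring_simps(1))
qed

text \<open>
  Multiplying a relation by a pure tensor gives a relation again. For the third kind this is where the
  structure maps must land in the centres.
\<close>

lemma rel_mult:
  assumes h: "h \<in> rel" and x: "x \<in> carrier A" "y \<in> carrier B"
  shows "frag_of (x, y) \<otimes>\<^bsub>F\<^esub> h \<in> N" "h \<otimes>\<^bsub>F\<^esub> frag_of (x, y) \<in> N"
proof -
  have N1: "frag_of (a \<oplus>\<^bsub>A\<^esub> a', b) - frag_of (a, b) - frag_of (a', b) \<in> N"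
    if "a \<in> carrier A" "a' \<in> carrier A" "b \<in> carrier B" for a a' b
    using that by (intro N_incl) (auto simp: tensor_relations_def)
  have N2: "frag_of (a, b \<oplus>\<^bsub>B\<^esub> b') - frag_of (a, b) - frag_of (a, b') \<in> N"
    if "a \<in> carrier A" "b \<in> carrier B" "b' \<in> carrier B" for a b b'
    using that by (intro N_incl) (auto simp: tensor_relations_def)
  have N3: "frag_of (\<phi> r \<otimes>\<^bsub>A\<^esub> a, b) - frag_of (a, \<psi> r \<otimes>\<^bsub>B\<^esub> b) \<in> N"
    if "r \<in> carrier R" "a \<in> carrier A" "b \<in> carrier B" for r a b
    using that by (intro N_incl) (auto simp: tensor_relations_def)
  have N3': "frag_of (x \<otimes>\<^bsub>A\<^esub> (\<phi> r \<otimes>\<^bsub>A\<^esub> a), y \<otimes>\<^bsub>B\<^esub> b) - frag_of (x \<otimes>\<^bsub>A\<^esub> a, y \<otimes>\<^bsub>B\<^esub> (\<psi> r \<otimes>\<^bsub>B\<^esub> b)) \<in> N"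
    if "r \<in> carrier R" "a \<in> carrier A" "b \<in> carrier B" for r a b
  proof -
    have "x \<otimes>\<^bsub>A\<^esub> (\<phi> r \<otimes>\<^bsub>A\<^esub> a) = \<phi> r \<otimes>\<^bsub>A\<^esub> (x \<otimes>\<^bsub>A\<^esub> a)"
      using that x \<phi> by (simp add: A.m_assoc[symmetric] \<phi>_central[of r x])
    moreover have "y \<otimes>\<^bsub>B\<^esub> (\<psi> r \<otimes>\<^bsub>B\<^esub> b) = \<psi> r \<otimes>\<^bsub>B\<^esub> (y \<otimes>\<^bsub>B\<^esub> b)"
      using that x \<psi> by (simp add: B.m_assoc[symmetric] \<psi>_central[of r y])
    ultimately show ?thesis using N3[of r "x \<otimes>\<^bsub>A\<^esub> a" "y \<otimes>\<^bsub>B\<^esub> b"] that x by simp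
  qed
  show "frag_of (x, y) \<otimes>\<^bsub>F\<^esub> h \<in> N" "h \<otimes>\<^bsub>F\<^esub> frag_of (x, y) \<in> N"
    using h x unfolding tensor_relations_def
    by (auto simp: monoid_ring_mult A.r_distr A.l_distr B.r_distr B.l_distr A.m_assoc B.m_assoc \<phi> \<psi>
        intro!: N1 N2 N3 N3')
qed

lemma N_ideal: "ideal N F"
proof (rule idealI)
  have of: "frag_of (x, y) \<otimes>\<^bsub>F\<^esub> h \<in> N \<and> h \<otimes>\<^bsub>F\<^esub> frag_of (x, y) \<in> N"
    if "h \<in> N" "x \<in> carrier A" "y \<in> carrier B" for h x y
    using that(1)
    by (induction h rule: N_induct)
       (use that(2,3) in \<open>auto simp: monoid_ring_mult N_zero intro: N_diff rel_mult\<close>)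
  have *: "x \<otimes>\<^bsub>F\<^esub> h \<in> N \<and> h \<otimes>\<^bsub>F\<^esub> x \<in> N" if "x \<in> carrier F" "h \<in> N" for x h
    using that(1)
    by (induction x rule: monoid_ring_induct)
       (use that(2) of in \<open>auto simp: monoid_ring_mult N_zero intro: N_diff\<close>)
  show "x \<otimes>\<^bsub>F\<^esub> h \<in> N" "h \<otimes>\<^bsub>F\<^esub> x \<in> N" if "h \<in> N" "x \<in> carrier F" for x h
    using * that by auto
qed (rule F.ring_axioms N_subgroup)+

sublocale N: ideal N F by (rule N_ideal)

lemma S_eq: "S = F Quot N"
  by (simp add: tensor_algebra_def N_def)

sublocale S: ring S
  unfolding S_eq by (rule N.quotient_is_ring)

definition pure where "pure a b = N +>\<^bsub>F\<^esub> frag_of (a, b)"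

lemma class_hom: "(+>\<^bsub>F\<^esub>) N \<in> ring_hom F S"
  unfolding S_eq by (rule N.rcos_ring_hom)

lemma pure_closed: "a \<in> carrier A \<Longrightarrow> b \<in> carrier B \<Longrightarrow> pure a b \<in> carrier S"
  unfolding pure_def by (rule ring_hom_closed[OF class_hom]) (rule of_closed)

lemma pure_mult:
  "a \<in> carrier A \<Longrightarrow> b \<in> carrier B \<Longrightarrow> a' \<in> carrier A \<Longrightarrow> b' \<in> carrier B \<Longrightarrow>
    pure a b \<otimes>\<^bsub>S\<^esub> pure a' b' = pure (a \<otimes>\<^bsub>A\<^esub> a') (b \<otimes>\<^bsub>B\<^esub> b')"
  unfolding pure_def by (subst ring_hom_mult[OF class_hom, symmetric]) (simp_all add: of_closed monoid_ring_mult)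

lemma pure_one: "\<one>\<^bsub>S\<^esub> = pure \<one>\<^bsub>A\<^esub> \<one>\<^bsub>B\<^esub>"
  unfolding pure_def using ring_hom_one[OF class_hom] by (simp add: monoid_ring_simps)

lemma class_eqI: "x \<in> carrier F \<Longrightarrow> y \<in> carrier F \<Longrightarrow> x - y \<in> N \<Longrightarrow> N +>\<^bsub>F\<^esub> x = N +>\<^bsub>F\<^esub> y"
  using F.quotient_eq_iff_same_a_r_cos[OF N_ideal, of x y] by (simp add: F_minus)

lemma pure_add_left:
  assumes "a \<in> carrier A" "a' \<in> carrier A" "b \<in> carrier B"
  shows "pure (a \<oplus>\<^bsub>A\<^esub> a') b = pure a b \<oplus>\<^bsub>S\<^esub> pure a' b"
proof -
  have "frag_of (a \<oplus>\<^bsub>A\<^esub> a', b) - frag_of (a, b) - frag_of (a', b) \<in> N"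
    using assms by (intro N_incl) (auto simp: tensor_relations_def)
  then show ?thesis
    unfolding pure_def using assms
    by (subst ring_hom_add[OF class_hom, symmetric]; (intro class_eqI)?)
       (simp_all add: of_closed monoid_ring_simps(1) diff_diff_eq F.a_closed[simplified monoid_ring_simps(1)])
qed

lemma pure_add_right:
  assumes "a \<in> carrier A" "b \<in> carrier B" "b' \<in> carrier B"
  shows "pure a (b \<oplus>\<^bsub>B\<^esub> b') = pure a b \<oplus>\<^bsub>S\<^esub> pure a b'"
proof -
  have "frag_of (a, b \<oplus>\<^bsub>B\<^esub> b') - frag_of (a, b) - frag_of (a, b') \<in> N"
    using assms by (intro N_incl) (auto simp: tensor_relations_def)
  then show ?thesis
    unfolding pure_def using assms
    by (subst ring_hom_add[OF class_hom, symmetric]; (intro class_eqI)?)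
       (simp_all add: of_closed monoid_ring_simps(1) diff_diff_eq F.a_closed[simplified monoid_ring_simps(1)])
qed

lemma pure_scalar:
  assumes "r \<in> carrier R" "a \<in> carrier A" "b \<in> carrier B"
  shows "pure (\<phi> r \<otimes>\<^bsub>A\<^esub> a) b = pure a (\<psi> r \<otimes>\<^bsub>B\<^esub> b)"
  unfolding pure_def
proof (rule class_eqI)
  show "frag_of (\<phi> r \<otimes>\<^bsub>A\<^esub> a, b) - frag_of (a, \<psi> r \<otimes>\<^bsub>B\<^esub> b) \<in> N"
    using assms by (intro N_incl) (auto simp: tensor_relations_def)
qed (use assms \<phi> \<psi> in \<open>simp_all add: of_closed\<close>)

lemma pure_zero_right: "a \<in> carrier A \<Longrightarrow> pure a \<zero>\<^bsub>B\<^esub> = \<zero>\<^bsub>S\<^esub>"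
  using pure_add_right[of a "\<zero>\<^bsub>B\<^esub>" "\<zero>\<^bsub>B\<^esub>"] pure_closed[of a "\<zero>\<^bsub>B\<^esub>"]
  by (simp add: S.add.r_cancel_one')

lemma pure_zero_left: "b \<in> carrier B \<Longrightarrow> pure \<zero>\<^bsub>A\<^esub> b = \<zero>\<^bsub>S\<^esub>"
  using pure_add_left[of "\<zero>\<^bsub>A\<^esub>" "\<zero>\<^bsub>A\<^esub>" b] pure_closed[of "\<zero>\<^bsub>A\<^esub>" b]
  by (simp add: S.add.r_cancel_one')

lemma pure_scale_left:
  "a \<in> carrier A \<Longrightarrow> b \<in> carrier B \<Longrightarrow> pure (add_pow A (n::nat) a) b = add_pow S n (pure a b)"
  by (induction n) (simp_all add: pure_zero_left pure_add_left)

lemma pure_scale_right: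
  "a \<in> carrier A \<Longrightarrow> b \<in> carrier B \<Longrightarrow> pure a (add_pow B (n::nat) b) = add_pow S n (pure a b)"
  by (induction n) (simp_all add: pure_zero_right pure_add_right)

text \<open>
  If \<open>B\<close> is a quotient of \<open>R\<close>, then every second factor can be moved to the left.
\<close>

lemma all_pure:
  assumes surj: "\<psi> ` carrier R = carrier B" and x: "x \<in> carrier S"
  shows "\<exists>a\<in>carrier A. x = pure a \<one>\<^bsub>B\<^esub>"
proof -
  obtain c where c: "c \<in> carrier F" "x = N +>\<^bsub>F\<^esub> c"
    using x unfolding S_eq by (rule quotient_carrierE[OF N_ideal])
  have "\<exists>a\<in>carrier A. N +>\<^bsub>F\<^esub> c = pure a \<one>\<^bsub>B\<^esub>"
    using c(1)
  proof (induction c rule: monoid_ring_induct)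
    case zero
    have "N +>\<^bsub>F\<^esub> 0 = \<zero>\<^bsub>S\<^esub>"
      using ring_hom_zero[OF class_hom F.ring_axioms S.ring_axioms] by (simp add: monoid_ring_simps)
    then show ?case by (intro bexI[of _ "\<zero>\<^bsub>A\<^esub>"]) (simp_all add: pure_zero_left)
  next
    case (diff x y)
    then obtain a b where ab: "a \<in> carrier A" "N +>\<^bsub>F\<^esub> x = pure a \<one>\<^bsub>B\<^esub>" "b \<in> carrier A" "N +>\<^bsub>F\<^esub> y = pure b \<one>\<^bsub>B\<^esub>"
      by blast
    have "(N +>\<^bsub>F\<^esub> (x - y)) \<oplus>\<^bsub>S\<^esub> pure b \<one>\<^bsub>B\<^esub> = pure a \<one>\<^bsub>B\<^esub>"
      unfolding ab(2,4)[symmetric] using diff monoid_ring_diff_closed[OF diff(1,2)]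
      by (subst ring_hom_add[OF class_hom, symmetric]) (simp_all add: monoid_ring_simps(1))
    also have "pure a \<one>\<^bsub>B\<^esub> = pure (a \<ominus>\<^bsub>A\<^esub> b) \<one>\<^bsub>B\<^esub> \<oplus>\<^bsub>S\<^esub> pure b \<one>\<^bsub>B\<^esub>"
      using ab by (subst pure_add_left[symmetric]) (simp_all add: a_minus_def A.a_assoc A.l_neg)
    finally have "N +>\<^bsub>F\<^esub> (x - y) = pure (a \<ominus>\<^bsub>A\<^esub> b) \<one>\<^bsub>B\<^esub>"
      using ab ring_hom_closed[OF class_hom monoid_ring_diff_closed[OF diff(1,2)]]
      by (simp add: pure_closed)
    then show ?case using ab by (intro bexI[of _ "a \<ominus>\<^bsub>A\<^esub> b"]) simp_all
  next
    case (of z)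
    then obtain a b where z: "z = (a, b)" "a \<in> carrier A" "b \<in> carrier B" by auto
    then obtain r where r: "r \<in> carrier R" "b = \<psi> r" using surj by auto
    have "N +>\<^bsub>F\<^esub> frag_of z = pure a (\<psi> r \<otimes>\<^bsub>B\<^esub> \<one>\<^bsub>B\<^esub>)"
      using z r \<psi> by (simp add: pure_def)
    also have "\<dots> = pure (\<phi> r \<otimes>\<^bsub>A\<^esub> a) \<one>\<^bsub>B\<^esub>" using z r by (intro pure_scalar[symmetric]) simp_all
    finally show ?case using z r \<phi> by (intro bexI[of _ "\<phi> r \<otimes>\<^bsub>A\<^esub> a"]) simp_all
  qed
  with c(2) show ?thesis by simp
qed

lemma tensor_lift_hom:
  assumes T: "ring T" and f: "f \<in> ring_hom A T" and g: "g \<in> ring_hom B T"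
    and comm: "\<And>a b. a \<in> carrier A \<Longrightarrow> b \<in> carrier B \<Longrightarrow> f a \<otimes>\<^bsub>T\<^esub> g b = g b \<otimes>\<^bsub>T\<^esub> f a"
    and compat: "\<And>r. r \<in> carrier R \<Longrightarrow> f (\<phi> r) = g (\<psi> r)"
  shows "ring_hom_ring S T (tensor_lift T f g)"
    "\<And>a b. a \<in> carrier A \<Longrightarrow> b \<in> carrier B \<Longrightarrow> tensor_lift T f g (pure a b) = f a \<otimes>\<^bsub>T\<^esub> g b"
proof -
  interpret T: ring T by fact
  define k where "k = (\<lambda>z. f (fst z) \<otimes>\<^bsub>T\<^esub> g (snd z))"
  note fg = ring_hom_closed[OF f] ring_hom_closed[OF g]
  have k: "k z \<in> carrier T" if "z \<in> carrier (A \<times>\<times> B)" for z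
    using that fg by (auto simp: k_def)
  have one: "k \<one>\<^bsub>A \<times>\<times> B\<^esub> = \<one>\<^bsub>T\<^esub>"
    by (simp add: k_def ring_hom_one[OF f] ring_hom_one[OF g])
  have mult: "k (x \<otimes>\<^bsub>A \<times>\<times> B\<^esub> y) = k x \<otimes>\<^bsub>T\<^esub> k y" if "x \<in> carrier (A \<times>\<times> B)" "y \<in> carrier (A \<times>\<times> B)" for x y
  proof -
    obtain a b a' b' where xy: "x = (a, b)" "y = (a', b')" by fastforce
    have ab: "a \<in> carrier A" "b \<in> carrier B" "a' \<in> carrier A" "b' \<in> carrier B" using that xy by auto
    have "f a \<otimes>\<^bsub>T\<^esub> f a' \<otimes>\<^bsub>T\<^esub> (g b \<otimes>\<^bsub>T\<^esub> g b') = f a \<otimes>\<^bsub>T\<^esub> (f a' \<otimes>\<^bsub>T\<^esub> g b) \<otimes>\<^bsub>T\<^esub> g b'"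
      using ab fg by (simp add: T.m_assoc)
    also have "\<dots> = f a \<otimes>\<^bsub>T\<^esub> g b \<otimes>\<^bsub>T\<^esub> (f a' \<otimes>\<^bsub>T\<^esub> g b')"
      unfolding comm[OF ab(3,2)] using ab fg by (simp add: T.m_assoc)
    finally show ?thesis using ab
      by (simp add: xy k_def ring_hom_mult[OF f] ring_hom_mult[OF g])
  qed
  define E where "E = (\<lambda>c. \<Oplus>\<^bsub>T\<^esub>z\<in>Poly_Mapping.keys c. add_pow T (Poly_Mapping.lookup c z :: int) (k z))"
  have E: "E \<in> ring_hom F T" "\<And>z. z \<in> carrier (A \<times>\<times> B) \<Longrightarrow> E (frag_of z) = k z"
    "\<And>x y. x \<in> carrier F \<Longrightarrow> y \<in> carrier F \<Longrightarrow> E (x - y) = E x \<ominus>\<^bsub>T\<^esub> E y"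
    unfolding E_def by (rule monoid_ring_eval_hom[OF monoid_AB T, of k, OF k one mult]; assumption)+
  have cancel: "x \<oplus>\<^bsub>T\<^esub> (y \<oplus>\<^bsub>T\<^esub> (\<ominus>\<^bsub>T\<^esub> x \<oplus>\<^bsub>T\<^esub> \<ominus>\<^bsub>T\<^esub> y)) = \<zero>\<^bsub>T\<^esub>"
    if "x \<in> carrier T" "y \<in> carrier T" for x y
    using that by (simp add: T.minus_add[symmetric] T.a_assoc[symmetric] T.r_neg)
  have rel: "E h = \<zero>\<^bsub>T\<^esub>" if "h \<in> rel" for h
    using that fg unfolding tensor_relations_def
    by (auto simp: E of_closed monoid_ring_diff_closed \<phi> \<psi> k_def ring_hom_add[OF f] ring_hom_add[OF g]
        ring_hom_mult[OF f] ring_hom_mult[OF g] T.l_distr T.r_distr compat comm[symmetric] T.m_assoc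
        a_minus_def T.minus_add T.a_ac T.r_neg cancel)
  have kill: "E h = \<zero>\<^bsub>T\<^esub>" if "h \<in> N" for h
    using that
  proof (induction h rule: N_induct)
    case 1 then show ?case using ring_hom_zero[OF E(1) F.ring_axioms T] by (simp add: monoid_ring_simps)
  next
    case (2 x y) then show ?case by (simp add: E(3) N_carrier a_minus_def)
  qed (rule rel)
  have lift: "tensor_lift T f g = (\<lambda>Y. the_elem (E ` Y))"
    by (simp add: fun_eq_iff tensor_lift_def E_def k_def)
  show "ring_hom_ring S T (tensor_lift T f g)"
    unfolding lift S_eq by (rule quotient_lift_hom[OF N_ideal T E(1) kill])
  show "tensor_lift T f g (pure a b) = f a \<otimes>\<^bsub>T\<^esub> g b" if "a \<in> carrier A" "b \<in> carrier B" for a b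
    unfolding lift pure_def using that
    by (subst the_elem_coset[OF N_ideal T E(1) kill]) (simp_all add: of_closed E(2) k_def)
qed

end

section \<open>The cohomology ring\<close>

context cochain_algebra
begin

abbreviation "Z \<equiv> cocycle_ring G A"
abbreviation "H \<equiv> cohomology_ring G A"
abbreviation "cls \<equiv> cohomology_class G A"

lemma cocycles_iff: "c \<in> cocycles G A \<longleftrightarrow> c \<in> carrier C \<and> \<delta> c = \<zero>\<^bsub>C\<^esub>"
  by (simp add: cocycles_def carrier_C zero_C)

lemma cocycles_closed:
  "\<zero>\<^bsub>C\<^esub> \<in> cocycles G A" "\<one>\<^bsub>C\<^esub> \<in> cocycles G A"
  "a \<in> cocycles G A \<Longrightarrow> \<ominus>\<^bsub>C\<^esub> a \<in> cocycles G A"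
  "a \<in> cocycles G A \<Longrightarrow> b \<in> cocycles G A \<Longrightarrow> a \<oplus>\<^bsub>C\<^esub> b \<in> cocycles G A"
  "a \<in> cocycles G A \<Longrightarrow> b \<in> cocycles G A \<Longrightarrow> a \<otimes>\<^bsub>C\<^esub> b \<in> cocycles G A"
  "a \<in> cocycles G A \<Longrightarrow> n \<star> a \<in> cocycles G A"
proof -
  have "\<delta> \<one>\<^bsub>C\<^esub> = \<delta> \<one>\<^bsub>C\<^esub> \<oplus>\<^bsub>C\<^esub> \<delta> \<one>\<^bsub>C\<^esub>"
    using \<delta>_mult[of "\<one>\<^bsub>C\<^esub>" "\<one>\<^bsub>C\<^esub>"] sign_Even[OF one_Even] by simp
  then show "\<one>\<^bsub>C\<^esub> \<in> cocycles G A"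
    by (metis C.add.r_cancel_one' C.one_closed \<delta>_closed cocycles_iff)
  show "\<ominus>\<^bsub>C\<^esub> a \<in> cocycles G A" if "a \<in> cocycles G A"
    using that \<delta>_neg[of a] C.minus_zero by (simp add: cocycles_iff)
qed (simp_all add: cocycles_iff \<delta>_zero \<delta>_add \<delta>_mult \<delta>_scale)

lemma subring_cocycles: "subring (cocycles G A) C"
  by (rule C.subringI) (auto simp: cocycles_closed, simp add: cocycles_iff)

sublocale Z: ring Z
  using C.subring_is_ring[OF subring_cocycles] .

lemma Z_neg: "a \<in> cocycles G A \<Longrightarrow> \<ominus>\<^bsub>Z\<^esub> a = \<ominus>\<^bsub>C\<^esub> a"
  by (rule Z.minus_equality) (auto simp: C.l_neg cocycles_iff \<delta>_neg C.minus_zero)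

lemma coboundaries_iff: "b \<in> coboundaries G A \<longleftrightarrow> (\<exists>e\<in>carrier C. b = \<delta> e)"
  by (auto simp: coboundaries_def carrier_C)

text \<open>
  By the Leibniz rule, the product of a coboundary \<open>\<delta> e\<close> with a cocycle \<open>x\<close> is \<open>\<delta> (e x)\<close> or \<open>\<delta> (\<plusminus>x e)\<close>.
\<close>

lemma coboundary_ideal: "ideal (coboundaries G A) Z"
proof (rule idealI)
  show "subgroup (coboundaries G A) (add_monoid Z)"
  proof (rule group.subgroupI[OF Z.a_group])
    show "coboundaries G A \<subseteq> carrier (add_monoid Z)"
      by (auto simp: coboundaries_iff cocycles_iff \<delta>_\<delta>)
    show "coboundaries G A \<noteq> {}" using C.zero_closed by (auto simp: coboundaries_def carrier_C)
    fix a assume a: "a \<in> coboundaries G A"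
    then obtain e where e: "e \<in> carrier C" "a = \<delta> e" by (auto simp: coboundaries_iff)
    have "a \<in> cocycles G A" using e by (simp add: cocycles_iff \<delta>_\<delta>)
    then have "\<ominus>\<^bsub>Z\<^esub> a = \<delta> (\<ominus>\<^bsub>C\<^esub> e)"
      using e by (simp add: Z_neg \<delta>_neg)
    then have "inv\<^bsub>add_monoid Z\<^esub> a = \<delta> (\<ominus>\<^bsub>C\<^esub> e)"
      by (simp only: a_inv_def)
    then show "inv\<^bsub>add_monoid Z\<^esub> a \<in> coboundaries G A"
      using e coboundaries_iff C.a_inv_closed by blast
    fix b assume "b \<in> coboundaries G A"
    then obtain e' where e': "e' \<in> carrier C" "b = \<delta> e'" by (auto simp: coboundaries_iff)
    then have "a \<otimes>\<^bsub>add_monoid Z\<^esub> b = \<delta> (e \<oplus>\<^bsub>C\<^esub> e')" using e by (simp add: \<delta>_add)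
    then show "a \<otimes>\<^bsub>add_monoid Z\<^esub> b \<in> coboundaries G A"
      using e e' coboundaries_iff C.a_closed by blast
  qed
  fix b x assume b: "b \<in> coboundaries G A" and x: "x \<in> carrier Z"
  then obtain e where e: "e \<in> carrier C" "b = \<delta> e" by (auto simp: coboundaries_iff)
  have xC: "x \<in> carrier C" "\<delta> x = \<zero>\<^bsub>C\<^esub>" using x by (auto simp: cocycles_iff)
  have "sign (sign x) = x" using xC(1) by (auto simp: sign_def fun_eq_iff carrier_closed)
  moreover have "\<delta> (sign x) = \<zero>\<^bsub>C\<^esub>"
  proof -
    have "sign \<zero>\<^bsub>C\<^esub> = \<zero>\<^bsub>C\<^esub>" by (simp add: sign_Even zero_Even)
    then show ?thesis using \<delta>_sign[OF xC(1)] xC(2) by simp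
  qed
  ultimately have "x \<otimes>\<^bsub>Z\<^esub> b = \<delta> (sign x \<otimes>\<^bsub>C\<^esub> e)" "b \<otimes>\<^bsub>Z\<^esub> x = \<delta> (e \<otimes>\<^bsub>C\<^esub> x)"
    using xC e by (simp_all add: \<delta>_mult)
  then show "x \<otimes>\<^bsub>Z\<^esub> b \<in> coboundaries G A" "b \<otimes>\<^bsub>Z\<^esub> x \<in> coboundaries G A"
    using e xC coboundaries_iff by (metis C.m_closed sign_C)+
qed (rule Z.ring_axioms)

sublocale B: ideal "coboundaries G A" Z by (rule coboundary_ideal)

sublocale H: ring H
  unfolding cohomology_ring_def by (rule B.quotient_is_ring)

lemma cls_hom: "cls \<in> ring_hom Z H"
  unfolding cohomology_ring_def cohomology_class_def[abs_def] by (rule B.rcos_ring_hom)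

lemma cls_simps:
  "a \<in> cocycles G A \<Longrightarrow> cls a \<in> carrier H"
  "a \<in> cocycles G A \<Longrightarrow> b \<in> cocycles G A \<Longrightarrow> cls (a \<oplus>\<^bsub>C\<^esub> b) = cls a \<oplus>\<^bsub>H\<^esub> cls b"
  "a \<in> cocycles G A \<Longrightarrow> b \<in> cocycles G A \<Longrightarrow> cls (a \<otimes>\<^bsub>C\<^esub> b) = cls a \<otimes>\<^bsub>H\<^esub> cls b"
  "cls \<one>\<^bsub>C\<^esub> = \<one>\<^bsub>H\<^esub>" "cls \<zero>\<^bsub>C\<^esub> = \<zero>\<^bsub>H\<^esub>"
  using ring_hom_closed[OF cls_hom, of a] ring_hom_add[OF cls_hom, of a b]
    ring_hom_mult[OF cls_hom, of a b] ring_hom_one[OF cls_hom]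
    ring_hom_zero[OF cls_hom Z.ring_axioms H.ring_axioms] by simp_all

lemma cls_pow: "a \<in> cocycles G A \<Longrightarrow> a [^]\<^bsub>C\<^esub> (n::nat) \<in> cocycles G A \<and> cls (a [^]\<^bsub>C\<^esub> n) = cls a [^]\<^bsub>H\<^esub> n"
  by (induction n) (simp_all add: cls_simps cocycles_closed)

lemma cls_scale: "a \<in> cocycles G A \<Longrightarrow> cls (n \<star> a) = add_pow H n (cls a)"
  by (induction n) (simp_all add: cls_simps cocycles_closed)

lemma cls_neg: "a \<in> cocycles G A \<Longrightarrow> cls (\<ominus>\<^bsub>C\<^esub> a) = \<ominus>\<^bsub>H\<^esub> cls a"
  by (rule H.minus_equality[symmetric])
     (simp_all add: cls_simps(1) cocycles_closed cls_simps(2)[symmetric], simp add: cocycles_iff C.l_neg cls_simps)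

lemma cls_surj: "x \<in> carrier H \<Longrightarrow> \<exists>z\<in>cocycles G A. x = cls z"
  unfolding cohomology_ring_def cohomology_class_def[abs_def]
  by (erule quotient_carrierE[OF coboundary_ideal]) auto

lemma cls_coboundary: "e \<in> carrier C \<Longrightarrow> cls (\<delta> e) = \<zero>\<^bsub>H\<^esub>"
  unfolding cohomology_ring_def cohomology_class_def FactRing_def
  using B.a_rcos_const[of "\<delta> e"] by (simp add: coboundaries_iff) blast

lemma cls_zeroD:
  assumes "z \<in> cocycles G A" "cls z = \<zero>\<^bsub>H\<^esub>"
  shows "\<exists>e\<in>carrier C. z = \<delta> e"
proof -
  have "z \<in> coboundaries G A"
    using assms B.a_rcos_self[of z] by (simp add: cohomology_ring_def cohomology_class_def FactRing_def)
  then show ?thesis by (simp add: coboundaries_iff)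
qed

lemma cls_eqI: "a \<in> cocycles G A \<Longrightarrow> b \<in> cocycles G A \<Longrightarrow> e \<in> carrier C \<Longrightarrow> a = b \<oplus>\<^bsub>C\<^esub> \<delta> e \<Longrightarrow> cls a = cls b"
  by (subgoal_tac "\<delta> e \<in> cocycles G A") (simp_all add: cls_simps cls_coboundary, simp add: cocycles_iff \<delta>_\<delta>)

definition scalar where "scalar r = (\<lambda>l :: 'g list. if l = [] then r else \<zero>)"

lemma scalar_closed: "r \<in> carrier A \<Longrightarrow> scalar r \<in> carrier C"
  unfolding scalar_def by (simp add: carrier_C one_cochain)

lemma scalar_mult:
  assumes "r \<in> carrier A" "a \<in> carrier C"
  shows "scalar r \<otimes>\<^bsub>C\<^esub> a = (\<lambda>l. r \<otimes> a l)" "a \<otimes>\<^bsub>C\<^esub> scalar r = (\<lambda>l. r \<otimes> a l)"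
  using assms scalar_closed[of r]
  by (auto simp: mult_C carrier_C scalar_def cup_const_left cup_const_right)

lemma faces_zero: "faces (\<lambda>m. \<zero>) g l = \<zero>"
  by (induction l arbitrary: g) simp_all

lemma scalar_cocycle: "r \<in> carrier A \<Longrightarrow> scalar r \<in> cocycles G A"
proof -
  assume r: "r \<in> carrier A"
  have "faces (scalar r) g l = (if l = [] then \<ominus> r else \<zero>)" for g l
    using r by (cases l) (auto simp: scalar_def faces_zero)
  then have "d (scalar r) l = \<zero>" for l
    using r by (cases l) (auto simp: scalar_def r_neg)
  then show ?thesis
    using scalar_closed[OF r] r carrier_closed[OF scalar_closed[OF r]] by (auto simp: cocycles_iff coboundary_eq zero_C)
qed

lemma scalar_hom: "(\<lambda>r. cls (scalar r)) \<in> ring_hom A H"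
proof (rule ring_hom_memI)
  show "cls (scalar r) \<in> carrier H" if "r \<in> carrier A" for r
    using that by (simp add: cls_simps scalar_cocycle)
  show "cls (scalar (r \<otimes> s)) = cls (scalar r) \<otimes>\<^bsub>H\<^esub> cls (scalar s)" if "r \<in> carrier A" "s \<in> carrier A" for r s
  proof -
    have "scalar (r \<otimes> s) = scalar r \<otimes>\<^bsub>C\<^esub> scalar s"
      unfolding scalar_mult(1)[OF that(1) scalar_closed[OF that(2)]]
      using that by (auto simp: scalar_def)
    then show ?thesis using that by (simp add: cls_simps scalar_cocycle)
  qed
  show "cls (scalar (r \<oplus> s)) = cls (scalar r) \<oplus>\<^bsub>H\<^esub> cls (scalar s)" if "r \<in> carrier A" "s \<in> carrier A" for r s
  proof -
    have "scalar (r \<oplus> s) = scalar r \<oplus>\<^bsub>C\<^esub> scalar s"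
      using that by (auto simp: add_C scalar_def)
    then show ?thesis using that by (simp add: cls_simps scalar_cocycle)
  qed
  show "cls (scalar \<one>) = \<one>\<^bsub>H\<^esub>"
    using cls_simps(4) by (simp add: scalar_def one_C)
qed

lemma unit_eq: "cohomology_unit G A r = cls (scalar r)"
  by (simp add: cohomology_unit_def scalar_def)

lemma unit_central:
  assumes "r \<in> carrier A" "x \<in> carrier H"
  shows "cohomology_unit G A r \<otimes>\<^bsub>H\<^esub> x = x \<otimes>\<^bsub>H\<^esub> cohomology_unit G A r"
proof -
  obtain z where z: "z \<in> cocycles G A" "x = cls z" using cls_surj[OF assms(2)] by blast
  have "scalar r \<otimes>\<^bsub>C\<^esub> z = z \<otimes>\<^bsub>C\<^esub> scalar r"
    using z(1) assms(1) by (simp add: scalar_mult cocycles_iff)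
  then show ?thesis
    using z assms(1) by (simp add: unit_eq cls_simps(3)[symmetric] scalar_cocycle)
qed

lemma cocycle_parts:
  assumes "z \<in> cocycles G A"
  shows "even_part z \<in> cocycles G A" "odd_part z \<in> cocycles G A"
proof -
  have z: "z \<in> carrier C" "\<delta> z = \<zero>\<^bsub>C\<^esub>" using assms by (simp_all add: cocycles_iff)
  note EO = even_part_Even[OF z(1)] odd_part_Odd[OF z(1)]
  have "\<delta> (odd_part z) \<oplus>\<^bsub>C\<^esub> \<delta> (even_part z) = \<zero>\<^bsub>C\<^esub>"
    using \<delta>_add[OF EvenD(1)[OF EO(1)] OddD(1)[OF EO(2)]] even_plus_odd_part[OF z(1)] z(2) EvenD(1)[OF EO(1)] OddD(1)[OF EO(2)]
    by (simp add: C.a_comm)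
  from Even_Odd_unique[OF \<delta>_Odd[OF EO(2)] \<delta>_Even[OF EO(1)] this]
  show "even_part z \<in> cocycles G A" "odd_part z \<in> cocycles G A"
    using EvenD(1)[OF EO(1)] OddD(1)[OF EO(2)] by (simp_all add: cocycles_iff)
qed

lemma cup_one_zero_left: "u \<in> carrier C \<Longrightarrow> cup_one \<zero>\<^bsub>C\<^esub> u = \<zero>\<^bsub>C\<^esub>"
  using cup_one_scale_left[of "\<zero>\<^bsub>C\<^esub>" u 0] cup_one_C[of "\<zero>\<^bsub>C\<^esub>" u] by simp

text \<open>
  For \<open>c\<close> even this says that \<open>c\<close> and \<open>u\<close> commute in cohomology; for \<open>c = u\<close> it says that the square of
  an odd class is its own negative.
\<close>

lemma cocycle_commute:
  assumes "c \<in> cocycles G A" "u \<in> cocycles G A" "u \<in> Odd"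
  shows "cls u \<otimes>\<^bsub>H\<^esub> cls c = cls (sign c) \<otimes>\<^bsub>H\<^esub> cls u"
proof -
  have cu: "c \<in> carrier C" "u \<in> carrier C" "\<delta> c = \<zero>\<^bsub>C\<^esub>" "\<delta> u = \<zero>\<^bsub>C\<^esub>" using assms by (simp_all add: cocycles_iff)
  have sc: "sign c \<in> cocycles G A"
    using cu sign_Even[OF zero_Even] by (simp add: cocycles_iff \<delta>_sign)
  have "\<delta> (cup_one c u) = \<ominus>\<^bsub>C\<^esub> (u \<otimes>\<^bsub>C\<^esub> c) \<oplus>\<^bsub>C\<^esub> sign c \<otimes>\<^bsub>C\<^esub> u"
    using \<delta>_cup_one[OF cu(1) assms(3) cu(4)] cu by (simp add: cup_one_zero_left)
  then have "sign c \<otimes>\<^bsub>C\<^esub> u = u \<otimes>\<^bsub>C\<^esub> c \<oplus>\<^bsub>C\<^esub> \<delta> (cup_one c u)"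
    using cu by (simp add: C.r_neg2)
  then have "cls (sign c \<otimes>\<^bsub>C\<^esub> u) = cls (u \<otimes>\<^bsub>C\<^esub> c)"
    by (intro cls_eqI[OF cocycles_closed(5)[OF sc assms(2)] cocycles_closed(5)[OF assms(2,1)] cup_one_C[OF cu(1,2)]])
  then show ?thesis using assms sc by (simp add: cls_simps)
qed

text \<open>
  Split a class into its even part \<open>x\<close> and its odd part \<open>y\<close>. They commute and \<open>2 y\<^sup>2 = 0\<close>. For \<open>p = 2\<close> the square is
  \<open>x\<^sup>2 + y\<^sup>2\<close>; for odd \<open>p\<close> one has \<open>y\<^sup>2 = 0\<close>, and the binomial formula leaves \<open>x\<^sup>p + p x\<^sup>p\<^sup>-\<^sup>1 y = x\<^sup>p\<close>.
\<close>

lemma pth_power_even: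
  fixes p :: nat
  assumes p: "Factorial_Ring.prime p" and char: "\<And>a. a \<in> carrier A \<Longrightarrow> add_pow A p a = \<zero>"
    and z: "z \<in> cocycles G A"
  shows "\<exists>y\<in>Even \<inter> cocycles G A. cls z [^]\<^bsub>H\<^esub> p = cls y"
proof -
  have zC: "z \<in> carrier C" using z by (simp add: cocycles_iff)
  note EO = even_part_Even[OF zC] odd_part_Odd[OF zC] and Zp = cocycle_parts[OF z]
  define x y where "x = cls (even_part z)" and "y = cls (odd_part z)"
  have xy: "x \<in> carrier H" "y \<in> carrier H" using Zp by (simp_all add: x_def y_def cls_simps)
  have sum: "cls z = x \<oplus>\<^bsub>H\<^esub> y"
    unfolding x_def y_def using even_plus_odd_part[OF zC] cls_simps(2)[OF Zp] by simp
  have comm: "x \<otimes>\<^bsub>H\<^esub> y = y \<otimes>\<^bsub>H\<^esub> x"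
    using cocycle_commute[OF Zp EO(2)] sign_Even[OF EO(1)] by (simp add: x_def y_def)
  have "y \<otimes>\<^bsub>H\<^esub> y = \<ominus>\<^bsub>H\<^esub> (y \<otimes>\<^bsub>H\<^esub> y)"
    using cocycle_commute[OF Zp(2,2) EO(2)] sign_Odd[OF EO(2)] xy
    by (simp add: y_def cls_neg Zp H.l_minus)
  then have yy2: "y \<otimes>\<^bsub>H\<^esub> y \<oplus>\<^bsub>H\<^esub> y \<otimes>\<^bsub>H\<^esub> y = \<zero>\<^bsub>H\<^esub>"
    using xy by (metis H.m_closed H.r_neg)
  have charH: "add_pow H p w = \<zero>\<^bsub>H\<^esub>" if w: "w \<in> carrier H" for w
  proof -
    obtain v where v: "v \<in> cocycles G A" "w = cls v" using cls_surj[OF w] by blast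
    have "p \<star> v = \<zero>\<^bsub>C\<^esub>"
      using v(1) by (auto simp: cocycles_iff scale_apply zero_C carrier_closed char fun_eq_iff)
    then show ?thesis using v cls_scale[of v p] by (simp add: cls_simps)
  qed
  show ?thesis
  proof (cases "p = 2")
    case True
    have "x \<otimes>\<^bsub>H\<^esub> y \<oplus>\<^bsub>H\<^esub> x \<otimes>\<^bsub>H\<^esub> y = \<zero>\<^bsub>H\<^esub>"
      using charH[of "x \<otimes>\<^bsub>H\<^esub> y"] xy by (simp add: True numeral_2_eq_2)
    moreover have "cls z [^]\<^bsub>H\<^esub> p = (x \<otimes>\<^bsub>H\<^esub> x \<oplus>\<^bsub>H\<^esub> y \<otimes>\<^bsub>H\<^esub> y) \<oplus>\<^bsub>H\<^esub> (x \<otimes>\<^bsub>H\<^esub> y \<oplus>\<^bsub>H\<^esub> x \<otimes>\<^bsub>H\<^esub> y)"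
      using xy by (simp add: True numeral_2_eq_2 sum H.l_distr H.r_distr comm[symmetric] H.a_ac)
    ultimately have "cls z [^]\<^bsub>H\<^esub> p = x \<otimes>\<^bsub>H\<^esub> x \<oplus>\<^bsub>H\<^esub> y \<otimes>\<^bsub>H\<^esub> y" using xy by simp
    also have "\<dots> = cls (even_part z \<otimes>\<^bsub>C\<^esub> even_part z \<oplus>\<^bsub>C\<^esub> odd_part z \<otimes>\<^bsub>C\<^esub> odd_part z)"
      using Zp by (simp add: x_def y_def cls_simps cocycles_closed)
    finally show ?thesis using EO Zp
      by (intro bexI[of _ "even_part z \<otimes>\<^bsub>C\<^esub> even_part z \<oplus>\<^bsub>C\<^esub> odd_part z \<otimes>\<^bsub>C\<^esub> odd_part z"])
         (simp_all add: add_Even[OF mult_Even[OF EO(1,1)] mult_Odd_Odd[OF EO(2,2)]] cocycles_closed)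
  next
    case False
    then have "odd p" using p by (metis prime_odd_nat prime_ge_2_nat le_neq_implies_less)
    then obtain k where k: "p = 2 * k + 1" by (rule oddE)
    have "add_pow H (2 * k) (y \<otimes>\<^bsub>H\<^esub> y) = add_pow H k (add_pow H (2::nat) (y \<otimes>\<^bsub>H\<^esub> y))"
      using xy by (simp add: H.add.nat_pow_pow)
    also have "add_pow H (2::nat) (y \<otimes>\<^bsub>H\<^esub> y) = \<zero>\<^bsub>H\<^esub>" using yy2 xy by (simp add: numeral_2_eq_2)
    finally have "y \<otimes>\<^bsub>H\<^esub> y = \<zero>\<^bsub>H\<^esub>" using charH[of "y \<otimes>\<^bsub>H\<^esub> y"] xy by (simp add: k)
    then have "cls z [^]\<^bsub>H\<^esub> p = x [^]\<^bsub>H\<^esub> p"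
      unfolding sum using H.commuting_pow_add_square_zero[OF xy comm, of "2 * k"] charH[of "x [^]\<^bsub>H\<^esub> (2 * k) \<otimes>\<^bsub>H\<^esub> y"] xy
      by (simp add: k)
    also have "\<dots> = cls (even_part z [^]\<^bsub>C\<^esub> p)" using cls_pow[OF Zp(1), of p] by (simp add: x_def)
    finally show ?thesis using EO(1) cls_pow[OF Zp(1), of p] pow_Even by blast
  qed
qed

end

section \<open>Change and reduction of coefficients\<close>

locale coefficient_map =
  src: cochain_algebra A G + tgt: cochain_algebra B G
  for A :: "('a, 'k) ring_scheme" and B :: "('b, 'l) ring_scheme" and G :: "('g, 'm) monoid_scheme" +
  fixes f :: "'a \<Rightarrow> 'b"
  assumes f: "f \<in> ring_hom A B"
begin

lemma f_simps:
  "a \<in> carrier A \<Longrightarrow> f a \<in> carrier B" "f \<zero>\<^bsub>A\<^esub> = \<zero>\<^bsub>B\<^esub>" "f \<one>\<^bsub>A\<^esub> = \<one>\<^bsub>B\<^esub>"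
  "a \<in> carrier A \<Longrightarrow> a' \<in> carrier A \<Longrightarrow> f (a \<oplus>\<^bsub>A\<^esub> a') = f a \<oplus>\<^bsub>B\<^esub> f a'"
  "a \<in> carrier A \<Longrightarrow> a' \<in> carrier A \<Longrightarrow> f (a \<otimes>\<^bsub>A\<^esub> a') = f a \<otimes>\<^bsub>B\<^esub> f a'"
  "a \<in> carrier A \<Longrightarrow> f (\<ominus>\<^bsub>A\<^esub> a) = \<ominus>\<^bsub>B\<^esub> f a"
proof -
  show z: "f \<zero>\<^bsub>A\<^esub> = \<zero>\<^bsub>B\<^esub>" by (rule ring_hom_zero[OF f src.ring_axioms tgt.ring_axioms])
  show "f (\<ominus>\<^bsub>A\<^esub> a) = \<ominus>\<^bsub>B\<^esub> f a" if "a \<in> carrier A"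
    using that ring_hom_closed[OF f] z
    by (intro tgt.minus_equality[symmetric]) (simp_all add: ring_hom_add[OF f, symmetric] src.l_neg)
qed (simp_all add: ring_hom_closed[OF f] ring_hom_one[OF f] ring_hom_add[OF f] ring_hom_mult[OF f])

definition push :: "('g list \<Rightarrow> 'a) \<Rightarrow> 'g list \<Rightarrow> 'b" where "push c = (\<lambda>l. f (c l))"

lemma push_closed: "c \<in> carrier src.C \<Longrightarrow> push c \<in> carrier tgt.C"
proof -
  assume c: "c \<in> carrier src.C"
  then have cc: "c \<in> cochains G A" by (simp add: src.carrier_C)
  obtain N where N: "\<forall>l. N < length l \<longrightarrow> c l = \<zero>\<^bsub>A\<^esub>" using src.cochains_bounded[OF cc] by blast
  show ?thesis unfolding tgt.carrier_C push_def
    by (rule tgt.cochainsI[where N = N])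
       (simp_all add: f_simps src.carrier_closed[OF c] N src.cochains_outside[OF cc])
qed

lemma push_hom:
  "a \<in> carrier src.C \<Longrightarrow> b \<in> carrier src.C \<Longrightarrow> push (a \<oplus>\<^bsub>src.C\<^esub> b) = push a \<oplus>\<^bsub>tgt.C\<^esub> push b"
  "a \<in> carrier src.C \<Longrightarrow> b \<in> carrier src.C \<Longrightarrow> push (a \<otimes>\<^bsub>src.C\<^esub> b) = push a \<otimes>\<^bsub>tgt.C\<^esub> push b"
  "push \<one>\<^bsub>src.C\<^esub> = \<one>\<^bsub>tgt.C\<^esub>" "push \<zero>\<^bsub>src.C\<^esub> = \<zero>\<^bsub>tgt.C\<^esub>"
proof -
  show "push (a \<oplus>\<^bsub>src.C\<^esub> b) = push a \<oplus>\<^bsub>tgt.C\<^esub> push b"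
    if "a \<in> carrier src.C" "b \<in> carrier src.C"
    using that by (simp add: push_def src.add_C tgt.add_C f_simps src.carrier_closed)
  have cup: "f (src.cup a b l) = tgt.cup (push a) (push b) l"
    if "\<And>l. a l \<in> carrier A" "\<And>l. b l \<in> carrier A" for a b l
    using that(1)
  proof (induction l arbitrary: a)
    case (Cons g l)
    have "f (src.cup (\<lambda>m. a (g # m)) b l) = tgt.cup (\<lambda>m. push a (g # m)) (push b) l"
      using Cons.IH[of "\<lambda>m. a (g # m)"] Cons.prems by (simp add: push_def)
    then show ?case using Cons.prems that(2) by (simp add: f_simps) (simp add: push_def)
  qed (simp add: f_simps that(2) push_def)
  show "push (a \<otimes>\<^bsub>src.C\<^esub> b) = push a \<otimes>\<^bsub>tgt.C\<^esub> push b" if "a \<in> carrier src.C" "b \<in> carrier src.C"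
    using that push_closed[OF that(1)] push_closed[OF that(2)]
    by (simp add: src.mult_C tgt.mult_C src.carrier_C tgt.carrier_C cup[symmetric] fun_eq_iff) (simp add: push_def cup)
qed (auto simp: push_def src.one_C tgt.one_C src.zero_C tgt.zero_C f_simps)

lemma push_scale: "a \<in> carrier src.C \<Longrightarrow> push (add_pow src.C (n::nat) a) = add_pow tgt.C n (push a)"
  by (induction n) (simp_all add: push_hom)

lemma push_pow: "a \<in> carrier src.C \<Longrightarrow> push (a [^]\<^bsub>src.C\<^esub> (n::nat)) = push a [^]\<^bsub>tgt.C\<^esub> n"
  by (induction n) (simp_all add: push_hom)

lemma push_\<delta>: "a \<in> carrier src.C \<Longrightarrow> push (src.\<delta> a) = tgt.\<delta> (push a)"
proof -
  assume a: "a \<in> carrier src.C"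
  have faces: "f (src.faces c g l) = tgt.faces (\<lambda>l. f (c l)) g l" if "\<And>l. c l \<in> carrier A" for c g l
    using that by (induction l arbitrary: c g) (simp_all add: f_simps)
  have "f (src.d a l) = tgt.d (push a) l" for l
    using src.carrier_closed[OF a] by (cases l) (simp_all add: f_simps faces push_def)
  then have "push (src.\<delta> a) l = tgt.\<delta> (push a) l" for l
    using src.carrier_closed[OF a] tgt.carrier_closed[OF push_closed[OF a]]
    by (simp add: src.coboundary_eq tgt.coboundary_eq push_def[of "\<lambda>l. if l \<in> _ then _ l else _"] f_simps)
  then show ?thesis by (rule ext)
qed

lemma push_cocycle: "a \<in> cocycles G A \<Longrightarrow> push a \<in> cocycles G B"
  unfolding src.cocycles_iff tgt.cocycles_iff by (simp add: push_closed push_\<delta>[symmetric] push_hom)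

lemma push_class_hom: "(\<lambda>c. tgt.cls (push c)) \<in> ring_hom src.Z tgt.H"
  by (rule ring_hom_memI)
     (simp_all add: push_cocycle tgt.cls_simps push_hom src.cocycles_iff[THEN iffD1])

lemma push_class_kill: "c \<in> coboundaries G A \<Longrightarrow> tgt.cls (push c) = \<zero>\<^bsub>tgt.H\<^esub>"
  by (auto simp: src.coboundaries_iff push_\<delta> tgt.cls_coboundary push_closed)

lemma cohomology_map_eq: "cohomology_map G B f = (\<lambda>Y. the_elem ((\<lambda>c. tgt.cls (push c)) ` Y))"
  by (simp add: fun_eq_iff cohomology_map_def push_def)

lemma cohomology_map_hom: "cohomology_map G B f \<in> ring_hom src.H tgt.H"
  using ring_hom_ring.homh[OF quotient_lift_hom[OF src.coboundary_ideal tgt.H.ring_axioms push_class_hom push_class_kill]]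
  unfolding cohomology_map_eq cohomology_ring_def[of G A] .

lemma cohomology_map_cls: "a \<in> cocycles G A \<Longrightarrow> cohomology_map G B f (src.cls a) = tgt.cls (push a)"
  unfolding cohomology_map_eq cohomology_class_def[of G A]
  by (rule the_elem_coset[OF src.coboundary_ideal tgt.H.ring_axioms push_class_hom push_class_kill]) simp_all

lemma cohomology_map_unit:
  "r \<in> carrier A \<Longrightarrow> cohomology_map G B f (cohomology_unit G A r) = cohomology_unit G B (f r)"
proof -
  assume r: "r \<in> carrier A"
  have "push (src.scalar r) = tgt.scalar (f r)"
    by (auto simp: push_def src.scalar_def tgt.scalar_def f_simps)
  then show ?thesis
    unfolding src.unit_eq tgt.unit_eq using cohomology_map_cls[OF src.scalar_cocycle[OF r]] by simp
qed

end

locale coefficient_reduction = coefficient_map A B G f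
  for A :: "('a, 'k) ring_scheme" and B :: "('b, 'l) ring_scheme" and G :: "('g, 'm) monoid_scheme" and f +
  fixes p :: nat
  assumes surj: "f ` carrier A = carrier B"
    and ker: "\<And>a. a \<in> carrier A \<Longrightarrow> f a = \<zero>\<^bsub>B\<^esub> \<longleftrightarrow> (\<exists>r\<in>carrier A. a = add_pow A p r)"
begin

text \<open>
  Lifting zero to zero keeps the support and the degrees of a cochain.
\<close>

lemma push_lift:
  assumes b: "b \<in> carrier tgt.C"
  shows "\<exists>a\<in>carrier src.C. push a = b \<and> (\<forall>l. b l = \<zero>\<^bsub>B\<^esub> \<longrightarrow> a l = \<zero>\<^bsub>A\<^esub>)"
proof -
  have bb: "b \<in> cochains G B" using b by (simp add: tgt.carrier_C)
  have "\<forall>l. \<exists>x\<in>carrier A. f x = b l \<and> (b l = \<zero>\<^bsub>B\<^esub> \<longrightarrow> x = \<zero>\<^bsub>A\<^esub>)"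
  proof
    fix l
    show "\<exists>x\<in>carrier A. f x = b l \<and> (b l = \<zero>\<^bsub>B\<^esub> \<longrightarrow> x = \<zero>\<^bsub>A\<^esub>)"
      using tgt.carrier_closed[OF b, of l] surj f_simps(2) src.zero_closed
      by (cases "b l = \<zero>\<^bsub>B\<^esub>") (metis, metis imageE)
  qed
  then obtain a where a: "\<And>l. a l \<in> carrier A" "\<And>l. f (a l) = b l" "\<And>l. b l = \<zero>\<^bsub>B\<^esub> \<Longrightarrow> a l = \<zero>\<^bsub>A\<^esub>"
    by metis
  obtain N where N: "\<forall>l. N < length l \<longrightarrow> b l = \<zero>\<^bsub>B\<^esub>" using tgt.cochains_bounded[OF bb] by blast
  have "a \<in> carrier src.C" unfolding src.carrier_C
    by (rule src.cochainsI[where N = N]) (use a N tgt.cochains_outside[OF bb] in auto)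
  then show ?thesis using a by (auto simp: push_def)
qed

lemma push_zeroD:
  assumes a: "a \<in> carrier src.C" "push a = \<zero>\<^bsub>tgt.C\<^esub>"
  shows "\<exists>e\<in>carrier src.C. a = add_pow src.C p e"
proof -
  have aa: "a \<in> cochains G A" using a by (simp add: src.carrier_C)
  have "\<forall>l. \<exists>x\<in>carrier A. a l = add_pow A p x \<and> (a l = \<zero>\<^bsub>A\<^esub> \<longrightarrow> x = \<zero>\<^bsub>A\<^esub>)"
  proof
    fix l
    have "f (a l) = \<zero>\<^bsub>B\<^esub>" using fun_cong[OF a(2), of l] by (simp add: push_def tgt.zero_C)
    then obtain r where "r \<in> carrier A" "a l = add_pow A p r"
      using ker[OF src.carrier_closed[OF a(1)]] by blast
    then show "\<exists>x\<in>carrier A. a l = add_pow A p x \<and> (a l = \<zero>\<^bsub>A\<^esub> \<longrightarrow> x = \<zero>\<^bsub>A\<^esub>)"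
      using src.add.nat_pow_one[of p] src.zero_closed by metis
  qed
  then obtain e where e: "\<And>l. e l \<in> carrier A" "\<And>l. a l = add_pow A p (e l)" "\<And>l. a l = \<zero>\<^bsub>A\<^esub> \<Longrightarrow> e l = \<zero>\<^bsub>A\<^esub>"
    by metis
  obtain N where N: "\<forall>l. N < length l \<longrightarrow> a l = \<zero>\<^bsub>A\<^esub>" using src.cochains_bounded[OF aa] by blast
  have eC: "e \<in> carrier src.C" unfolding src.carrier_C
    by (rule src.cochainsI[where N = N]) (use e N src.cochains_outside[OF aa] in auto)
  moreover have "a = add_pow src.C p e"
    using e(2) by (auto simp: src.scale_apply[OF eC])
  ultimately show ?thesis by blast
qed

lemma f_scale: "a \<in> carrier A \<Longrightarrow> f (add_pow A (n::nat) a) = add_pow B n (f a)"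
  by (induction n) (simp_all add: f_simps)

lemma char_target: "b \<in> carrier B \<Longrightarrow> add_pow B p b = \<zero>\<^bsub>B\<^esub>"
proof -
  assume "b \<in> carrier B"
  then obtain a where a: "a \<in> carrier A" "b = f a" using surj by blast
  have "f (add_pow A p a) = \<zero>\<^bsub>B\<^esub>" using a ker[of "add_pow A p a"] by auto
  then show ?thesis using a by (simp add: f_scale)
qed

lemma scale_push_zero: "b \<in> carrier tgt.C \<Longrightarrow> add_pow tgt.C p b = \<zero>\<^bsub>tgt.C\<^esub>"
  by (auto simp: fun_eq_iff tgt.scale_apply tgt.zero_C char_target tgt.carrier_closed)

lemma char_cohomology: "x \<in> carrier tgt.H \<Longrightarrow> add_pow tgt.H p x = \<zero>\<^bsub>tgt.H\<^esub>"
proof -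
  assume "x \<in> carrier tgt.H"
  then obtain v where v: "v \<in> cocycles G B" "x = tgt.cls v" using tgt.cls_surj by blast
  then show ?thesis
    using tgt.cls_scale[of v p] scale_push_zero[of v] by (simp add: tgt.cls_simps tgt.cocycles_iff)
qed

text \<open>
  The first \<open>p\<close>-th power makes the class even, after which \<open>power_lifts_to_cocycle\<close> applies to a lift of
  an even representative.
\<close>

lemma power_in_image:
  assumes fin: "finite (carrier G)" and p: "Factorial_Ring.prime p"
    and tors: "\<And>n r. r \<in> carrier A \<Longrightarrow> add_pow A (p ^ n :: nat) r = \<zero>\<^bsub>A\<^esub> \<Longrightarrow> add_pow A (p ^ k :: nat) r = \<zero>\<^bsub>A\<^esub>"
    and t: "t \<in> carrier tgt.H"
  shows "\<exists>n. \<exists>h\<in>carrier src.H. t [^]\<^bsub>tgt.H\<^esub> (p ^ n) = cohomology_map G B f h"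
proof -
  obtain z where z: "z \<in> cocycles G B" "t = tgt.cls z" using tgt.cls_surj[OF t] by blast
  obtain y where y: "y \<in> tgt.Even" "y \<in> cocycles G B" "t [^]\<^bsub>tgt.H\<^esub> p = tgt.cls y"
    using tgt.pth_power_even[OF p char_target z(1)] z(2) by blast
  obtain c where c: "c \<in> carrier src.C" "push c = y" "\<forall>l. y l = \<zero>\<^bsub>B\<^esub> \<longrightarrow> c l = \<zero>\<^bsub>A\<^esub>"
    using push_lift[of y] y(2) by (auto simp: tgt.cocycles_iff)
  have cE: "c \<in> src.Even" using c(1,3) tgt.EvenD(2)[OF y(1)] by (auto simp: src.Even_def)
  have "push (src.\<delta> c) = \<zero>\<^bsub>tgt.C\<^esub>" using y(2) c by (simp add: push_\<delta> tgt.cocycles_iff)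
  then obtain e where e: "e \<in> carrier src.C" "src.\<delta> c = add_pow src.C p e"
    using push_zeroD[of "src.\<delta> c"] c(1) by auto
  have "\<exists>n. \<exists>w\<in>carrier src.C. src.\<delta> (c [^]\<^bsub>src.C\<^esub> (p ^ n) \<oplus>\<^bsub>src.C\<^esub> add_pow src.C p w) = \<zero>\<^bsub>src.C\<^esub>"
    by (rule src.power_lifts_to_cocycle[OF fin p _ cE e]) (rule tors)
  then obtain n w where w: "w \<in> carrier src.C"
      "src.\<delta> (c [^]\<^bsub>src.C\<^esub> (p ^ n) \<oplus>\<^bsub>src.C\<^esub> add_pow src.C p w) = \<zero>\<^bsub>src.C\<^esub>"
    by blast
  define v where "v = c [^]\<^bsub>src.C\<^esub> (p ^ n) \<oplus>\<^bsub>src.C\<^esub> add_pow src.C p w"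
  have v: "v \<in> cocycles G A" using w c(1) by (simp add: v_def src.cocycles_iff)
  have "push v = y [^]\<^bsub>tgt.C\<^esub> (p ^ n)"
    using c(1,2) w(1) y(2)
    by (simp add: v_def push_hom push_pow push_scale scale_push_zero push_closed tgt.cocycles_iff)
  then have "cohomology_map G B f (src.cls v) = tgt.cls y [^]\<^bsub>tgt.H\<^esub> (p ^ n)"
    using cohomology_map_cls[OF v] tgt.cls_pow[OF y(2)] by simp
  also have "\<dots> = t [^]\<^bsub>tgt.H\<^esub> (p ^ Suc n)"
    unfolding y(3)[symmetric] using t by (simp add: tgt.H.nat_pow_pow)
  finally show ?thesis using src.cls_simps(1)[OF v] by metis
qed

text \<open>
  If the reduction of a cocycle \<open>c\<close> is the coboundary of \<open>e\<close>, then subtracting the coboundary of a lift of \<open>e\<close>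
  makes \<open>c\<close> vanish modulo \<open>p\<close> without changing its class.
\<close>

lemma kernel_rep:
  assumes x: "x \<in> carrier src.H" "cohomology_map G B f x = \<zero>\<^bsub>tgt.H\<^esub>"
  shows "\<exists>a\<in>carrier src.C. add_pow src.C p a \<in> cocycles G A \<and> x = src.cls (add_pow src.C p a)"
proof -
  obtain c where c: "c \<in> cocycles G A" "x = src.cls c" using src.cls_surj[OF x(1)] by blast
  have cC: "c \<in> carrier src.C" using c(1) by (simp add: src.cocycles_iff)
  have "tgt.cls (push c) = \<zero>\<^bsub>tgt.H\<^esub>" using x(2) c cohomology_map_cls by simp
  then obtain e where e: "e \<in> carrier tgt.C" "push c = tgt.\<delta> e"
    using tgt.cls_zeroD[OF push_cocycle[OF c(1)]] by blast
  obtain b where b: "b \<in> carrier src.C" "push b = e" using push_lift[OF e(1)] by blast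
  have "push c = push (src.\<delta> b)" using b e push_\<delta> by simp
  moreover have "push (\<ominus>\<^bsub>src.C\<^esub> src.\<delta> b) = \<ominus>\<^bsub>tgt.C\<^esub> push (src.\<delta> b)"
    using b(1) push_closed by (intro tgt.C.minus_equality[symmetric]) (simp_all add: push_hom[symmetric] src.C.l_neg push_closed)
  ultimately have "push (c \<oplus>\<^bsub>src.C\<^esub> \<ominus>\<^bsub>src.C\<^esub> src.\<delta> b) = \<zero>\<^bsub>tgt.C\<^esub>"
    using cC b(1) push_closed by (simp add: push_hom tgt.C.r_neg)
  then obtain a where a: "a \<in> carrier src.C" "c \<oplus>\<^bsub>src.C\<^esub> \<ominus>\<^bsub>src.C\<^esub> src.\<delta> b = add_pow src.C p a"
    using push_zeroD[of "c \<oplus>\<^bsub>src.C\<^esub> \<ominus>\<^bsub>src.C\<^esub> src.\<delta> b"] cC b(1) by auto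
  have cy: "add_pow src.C p a \<in> cocycles G A"
    unfolding a(2)[symmetric]
    using c(1) b(1) by (intro src.cocycles_closed) (simp_all add: src.cocycles_iff src.\<delta>_\<delta>)
  have "c = add_pow src.C p a \<oplus>\<^bsub>src.C\<^esub> src.\<delta> b"
    unfolding a(2)[symmetric] using cC b(1) by (simp add: src.C.a_assoc src.C.l_neg)
  then have "x = src.cls (add_pow src.C p a)" unfolding c(2) using c(1) cy b(1) by (rule_tac src.cls_eqI)
  then show ?thesis using a(1) cy by blast
qed

text \<open>
  Although \<open>a\<close> and \<open>b\<close> need not be cocycles, \<open>a \<union> p b\<close> is one: the factor \<open>p\<close> may be moved to whichever
  of \<open>a\<close> and \<open>b\<close> is being differentiated.
\<close>

lemma kernel_product:
  assumes x: "x \<in> carrier src.H" "cohomology_map G B f x = \<zero>\<^bsub>tgt.H\<^esub>"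
    and y: "y \<in> carrier src.H" "cohomology_map G B f y = \<zero>\<^bsub>tgt.H\<^esub>"
  shows "\<exists>w\<in>carrier src.H. x \<otimes>\<^bsub>src.H\<^esub> y = add_pow src.H p w"
proof -
  obtain a where a: "a \<in> carrier src.C" "add_pow src.C p a \<in> cocycles G A" "x = src.cls (add_pow src.C p a)"
    using kernel_rep[OF x] by blast
  obtain b where b: "b \<in> carrier src.C" "add_pow src.C p b \<in> cocycles G A" "y = src.cls (add_pow src.C p b)"
    using kernel_rep[OF y] by blast
  define v where "v = a \<otimes>\<^bsub>src.C\<^esub> add_pow src.C p b"
  have "src.\<delta> v = add_pow src.C p (src.\<delta> a) \<otimes>\<^bsub>src.C\<^esub> b \<oplus>\<^bsub>src.C\<^esub> src.sign a \<otimes>\<^bsub>src.C\<^esub> src.\<delta> (add_pow src.C p b)"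
    unfolding v_def using a(1) b(1)
    by (simp add: src.\<delta>_mult src.C.add_pow_ldistr[of "src.\<delta> a"] src.C.add_pow_rdistr[of "src.\<delta> a"])
  then have "v \<in> cocycles G A"
    using a b by (simp add: src.cocycles_iff v_def src.\<delta>_scale[symmetric])
  moreover have "add_pow src.C p a \<otimes>\<^bsub>src.C\<^esub> add_pow src.C p b = add_pow src.C p v"
    unfolding v_def using a(1) b(1) by (simp add: src.C.add_pow_ldistr)
  ultimately have "x \<otimes>\<^bsub>src.H\<^esub> y = add_pow src.H p (src.cls v)" "src.cls v \<in> carrier src.H"
    using a b by (simp_all add: src.cls_simps(3)[symmetric] src.cls_scale src.cls_simps(1))
  then show ?thesis by blast
qed

end

section \<open>Reduction modulo a prime\<close>

lemma (in cring) multiples_ideal: "ideal (multiples p R) R"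
proof (rule idealI)
  show "subgroup (multiples p R) (add_monoid R)"
  proof (rule group.subgroupI[OF a_group])
    show "multiples p R \<noteq> {}" by (auto simp: multiples_def)
    fix a assume "a \<in> multiples p R"
    then obtain r where r: "r \<in> carrier R" "a = add_pow R p r" by (auto simp: multiples_def)
    then have "\<ominus> a = add_pow R p (\<ominus> r)" by (simp add: add_pow_neg)
    then show "inv\<^bsub>add_monoid R\<^esub> a \<in> multiples p R"
      using r unfolding a_inv_def[symmetric] multiples_def by auto
    fix b assume "b \<in> multiples p R"
    then obtain s where s: "s \<in> carrier R" "b = add_pow R p s" by (auto simp: multiples_def)
    then have "a \<oplus> b = add_pow R p (r \<oplus> s)" using r by (simp add: add.nat_pow_distrib)
    then show "a \<otimes>\<^bsub>add_monoid R\<^esub> b \<in> multiples p R"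
      using r s unfolding multiples_def by auto
  qed (auto simp: multiples_def)
  fix a x assume "a \<in> multiples p R" and x: "x \<in> carrier R"
  then obtain r where r: "r \<in> carrier R" "a = add_pow R p r" by (auto simp: multiples_def)
  then have "x \<otimes> a = add_pow R p (x \<otimes> r)" "a \<otimes> x = add_pow R p (r \<otimes> x)"
    using x by (simp_all add: add_pow_ldistr add_pow_rdistr)
  then show "x \<otimes> a \<in> multiples p R" "a \<otimes> x \<in> multiples p R"
    using r x unfolding multiples_def by auto
qed (rule ring_axioms)

text \<open>
  The ideals of elements killed by \<open>p\<^sup>k\<close> form an ascending chain, which becomes stationary.
\<close>

lemma (in noetherian_ring) bounded_torsion:
  fixes p :: nat
  shows "\<exists>k. \<forall>n. \<forall>r\<in>carrier R. add_pow R (p ^ n) r = \<zero> \<longrightarrow> add_pow R (p ^ k) r = \<zero>"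
proof -
  define I where "I k = {r \<in> carrier R. add_pow R (p ^ k) r = \<zero>}" for k :: nat
  have "ideal (I k) R" for k
  proof (rule idealI)
    show "subgroup (I k) (add_monoid R)"
    proof (rule group.subgroupI[OF a_group])
      show "I k \<noteq> {}" by (auto simp: I_def intro!: exI[of _ \<zero>])
      show "inv\<^bsub>add_monoid R\<^esub> a \<in> I k" if "a \<in> I k" for a
        using that unfolding a_inv_def[symmetric] I_def by (simp add: add_pow_neg minus_zero)
    qed (auto simp: I_def add.nat_pow_distrib)
    fix a x assume a: "a \<in> I k" and x: "x \<in> carrier R"
    then have *: "a \<in> carrier R" "add_pow R (p ^ k) a = \<zero>" by (simp_all add: I_def)
    have "add_pow R (p ^ k) (x \<otimes> a) = \<zero>" "add_pow R (p ^ k) (a \<otimes> x) = \<zero>"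
      using add_pow_rdistr[OF x *(1), of "p ^ k", symmetric] add_pow_ldistr[OF *(1) x, of "p ^ k", symmetric] x
      by (simp_all only: *(2) r_null l_null)
    then show "x \<otimes> a \<in> I k" "a \<otimes> x \<in> I k"
      using a x by (simp_all add: I_def)
  qed (rule ring_axioms)
  moreover have mono: "I k \<subseteq> I n" if "k \<le> n" for k n
  proof
    fix r assume r: "r \<in> I k"
    have pn: "p ^ n = p ^ k * p ^ (n - k)" using that by (simp add: power_add[symmetric])
    have "add_pow R (p ^ n) r = add_pow R (p ^ (n - k)) (add_pow R (p ^ k) r)"
      unfolding pn by (rule add.nat_pow_pow[symmetric]) (use r in \<open>simp add: I_def\<close>)
    then show "r \<in> I n" using r by (simp add: I_def)
  qed
  have "I k \<subseteq> I n \<or> I n \<subseteq> I k" for k n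
    using mono[of k n] mono[of n k] linear[of k n] by blast
  ultimately have "subset.chain {J. ideal J R} (range I)"
    unfolding subset_chain_def by blast
  then have "\<Union> (range I) \<in> range I"
    by (intro ideal_chain_is_trivial) auto
  then obtain k where "\<Union> (range I) = I k" by blast
  then have "r \<in> I k" if "r \<in> I n" for r n using that by blast
  then show ?thesis unfolding I_def by blast
qed

lemma coefficient_reduction_mod:
  assumes R: "cring R" and G: "group G"
  shows "coefficient_reduction R (reduction p R) G (reduction_map p R) p"
proof -
  interpret R: cring R by fact
  note I = R.multiples_ideal[of p]
  interpret I: ideal "multiples p R" R by (rule I)
  interpret Q: cring "reduction p R" by (rule I.quotient_is_cring[OF R])
  interpret G: group G by fact
  have zero: "\<zero>\<^bsub>reduction p R\<^esub> = multiples p R" by (simp add: FactRing_def)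
  show ?thesis
  proof unfold_locales
    show "reduction_map p R \<in> ring_hom R (reduction p R)" by (rule I.rcos_ring_hom)
    show "reduction_map p R ` carrier R = carrier (reduction p R)"
      unfolding FactRing_def A_RCOSETS_def' by auto
    show "multiples p R +>\<^bsub>R\<^esub> a = \<zero>\<^bsub>reduction p R\<^esub> \<longleftrightarrow> (\<exists>r\<in>carrier R. a = add_pow R p r)" if "a \<in> carrier R" for a
    proof -
      have "multiples p R +>\<^bsub>R\<^esub> a = multiples p R \<longleftrightarrow> a \<in> multiples p R"
        using I.a_rcos_self[OF that] I.a_rcos_const by auto
      moreover have "a \<in> multiples p R \<longleftrightarrow> (\<exists>r\<in>carrier R. a = add_pow R p r)"
        unfolding multiples_def by blast
      ultimately show ?thesis unfolding zero by (simp only:)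
    qed
  qed
qed

section \<open>The natural map is an F-isomorphism\<close>

theorem theorem5p5:
  fixes G :: "('g, 'm) monoid_scheme" and R :: "('r, 'k) ring_scheme" and p :: nat
  assumes "group G" and "finite (carrier G)"
    and "cring R" and "noetherian_ring R"
    and "Factorial_Ring.prime p"
  shows "F_isomorphism p (cohomology_mod p G R) (cohomology_ring G (reduction p R))
           (natural_map p G R)"
proof -
  let ?B = "reduction p R" and ?\<pi> = "reduction_map p R"
  interpret cr: coefficient_reduction R ?B G ?\<pi> p
    using assms by (intro coefficient_reduction_mod)
  let ?H = "cohomology_ring G R" and ?T = "cohomology_ring G ?B"
  interpret tensor_product R ?H ?B "cohomology_unit G R" ?\<pi>
  proof (intro tensor_product.intro tensor_product_axioms.intro)
    show "cohomology_unit G R r \<in> carrier ?H" if "r \<in> carrier R" for r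
      using that unfolding cr.src.unit_eq by (intro cr.src.cls_simps cr.src.scalar_cocycle)
  qed (fact assms cr.src.H.ring_axioms cr.tgt.ring_axioms cr.f_simps(1) cr.src.unit_central
        | (rule cr.tgt.m_comm; (assumption | rule cr.f_simps(1))+))+
  let ?S = "cohomology_mod p G R" and ?nat = "natural_map p G R"
  have S_eq: "?S = S" by (simp add: cohomology_mod_def)
  have unit_hom: "cohomology_unit G ?B \<in> ring_hom ?B ?T"
    using cr.tgt.scalar_hom unfolding cr.tgt.unit_eq[abs_def] .
  have nat_hom: "ring_hom_ring S ?T ?nat"
    and nat_pure: "\<And>x b. x \<in> carrier ?H \<Longrightarrow> b \<in> carrier ?B \<Longrightarrow>
      ?nat (pure x b) = cohomology_map G ?B ?\<pi> x \<otimes>\<^bsub>?T\<^esub> cohomology_unit G ?B b"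
    unfolding natural_map_def
    using tensor_lift_hom[OF cr.tgt.H.ring_axioms cr.cohomology_map_hom unit_hom]
      cr.tgt.unit_central ring_hom_closed[OF cr.cohomology_map_hom] cr.cohomology_map_unit by auto
  have nat_pure_one: "?nat (pure x \<one>\<^bsub>?B\<^esub>) = cohomology_map G ?B ?\<pi> x" if "x \<in> carrier ?H" for x
    using that nat_pure[of x "\<one>\<^bsub>?B\<^esub>"] ring_hom_one[OF unit_hom] ring_hom_closed[OF cr.cohomology_map_hom] by simp
  have char: "add_pow S p (pure x \<one>\<^bsub>?B\<^esub>) = \<zero>\<^bsub>S\<^esub>" if "x \<in> carrier ?H" for x
    using that pure_scale_right[of x "\<one>\<^bsub>?B\<^esub>" p] cr.char_target by (simp add: pure_zero_right)

  let ?K = "a_kernel S ?T ?nat"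
  have K_ideal: "ideal ?K S" by (rule ring_hom_ring.kernel_is_ideal[OF nat_hom])
  have K_square: "x \<otimes>\<^bsub>S\<^esub> y = \<zero>\<^bsub>S\<^esub>" if "x \<in> ?K" "y \<in> ?K" for x y
  proof -
    have rep: "\<exists>a\<in>carrier ?H. v = pure a \<one>\<^bsub>?B\<^esub> \<and> cohomology_map G ?B ?\<pi> a = \<zero>\<^bsub>?T\<^esub>" if "v \<in> ?K" for v
    proof -
      have v: "v \<in> carrier S" "?nat v = \<zero>\<^bsub>?T\<^esub>" using that by (auto simp: a_kernel_def')
      then show ?thesis using all_pure[OF cr.surj v(1)] nat_pure_one by metis
    qed
    obtain a b where a: "a \<in> carrier ?H" "x = pure a \<one>\<^bsub>?B\<^esub>" "cohomology_map G ?B ?\<pi> a = \<zero>\<^bsub>?T\<^esub>"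
      and b: "b \<in> carrier ?H" "y = pure b \<one>\<^bsub>?B\<^esub>" "cohomology_map G ?B ?\<pi> b = \<zero>\<^bsub>?T\<^esub>"
      using rep \<open>x \<in> ?K\<close> \<open>y \<in> ?K\<close> by blast
    obtain w where w: "w \<in> carrier ?H" "a \<otimes>\<^bsub>?H\<^esub> b = add_pow ?H p w"
      using cr.kernel_product[OF a(1,3) b(1,3)] by blast
    have "x \<otimes>\<^bsub>S\<^esub> y = pure (add_pow ?H p w) \<one>\<^bsub>?B\<^esub>"
      using a b w by (simp add: pure_mult)
    then show ?thesis using w(1) by (simp add: pure_scale_left char)
  qed
  have "ideal_prod S (ideal_prod S (carrier S) ?K) ?K = {\<zero>\<^bsub>S\<^esub>}"
  proof
    have sub: "ideal_prod S (carrier S) ?K \<subseteq> ?K"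
      using S.ideal_prod_inter[OF S.oneideal K_ideal] by simp
    show "ideal_prod S (ideal_prod S (carrier S) ?K) ?K \<subseteq> {\<zero>\<^bsub>S\<^esub>}"
    proof
      fix z assume "z \<in> ideal_prod S (ideal_prod S (carrier S) ?K) ?K"
      then show "z \<in> {\<zero>\<^bsub>S\<^esub>}"
        by (induction z rule: ideal_prod.induct) (use sub K_square in auto)
    qed
    have "\<zero>\<^bsub>S\<^esub> \<in> ?K" using additive_subgroup.zero_closed[OF ideal.axioms(1)[OF K_ideal]] .
    then have "\<zero>\<^bsub>S\<^esub> \<otimes>\<^bsub>S\<^esub> \<zero>\<^bsub>S\<^esub> \<in> ideal_prod S (ideal_prod S (carrier S) ?K) ?K"
      using ideal_prod.prod[of "\<zero>\<^bsub>S\<^esub>" "carrier S" "\<zero>\<^bsub>S\<^esub>" ?K S] by (intro ideal_prod.prod) simp_all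
    then show "{\<zero>\<^bsub>S\<^esub>} \<subseteq> ideal_prod S (ideal_prod S (carrier S) ?K) ?K" by simp
  qed
  then have nilpotent: "?K [^]\<^bsub>ideals_set S\<^esub> Suc (Suc 0) = \<zero>\<^bsub>ideals_set S\<^esub>"
    by (simp add: ideals_set_def)

  obtain k where k: "\<And>n r. r \<in> carrier R \<Longrightarrow> add_pow R (p ^ n) r = \<zero>\<^bsub>R\<^esub> \<Longrightarrow> add_pow R (p ^ k) r = \<zero>\<^bsub>R\<^esub>"
    using noetherian_ring.bounded_torsion[OF assms(4), of p] by blast
  have power: "\<exists>n :: nat. t [^]\<^bsub>?T\<^esub> (p ^ n) \<in> ?nat ` carrier S" if "t \<in> carrier ?T" for t
  proof -
    have "\<exists>n. \<exists>h\<in>carrier ?H. t [^]\<^bsub>?T\<^esub> (p ^ n) = cohomology_map G ?B ?\<pi> h"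
      by (rule cr.power_in_image[OF assms(2,5) _ that]) (rule k)
    then obtain n h where h: "h \<in> carrier ?H" "t [^]\<^bsub>?T\<^esub> (p ^ n) = cohomology_map G ?B ?\<pi> h" by blast
    then have "t [^]\<^bsub>?T\<^esub> (p ^ n) = ?nat (pure h \<one>\<^bsub>?B\<^esub>)" by (simp add: nat_pure_one)
    then show ?thesis using pure_closed[OF h(1), of "\<one>\<^bsub>?B\<^esub>"] by blast
  qed
  show ?thesis
    unfolding F_isomorphism_def S_eq
    using assms(5) nat_hom char[of "\<one>\<^bsub>?H\<^esub>"] cr.char_cohomology[of "\<one>\<^bsub>?T\<^esub>"] nilpotent power
    by (auto simp: pure_one simp del: nat_pow_Suc)
qed

end
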